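(* Let $S$ be the $\mathbb N^r$-graded ring described in the context, let $M$ be a finitely generated $\mathbb Z^r$-graded $S$-module, and let $s=vad(M^{( * )})$. There exists $\underline a=(a_1,\dots,a_r)\in\mathbb N^{*r}$ such that for all $\underline b\in\{(\lambda_1a_1,\dots,\lambda_ra_r)\mid \lambda_i\in\mathbb N^*\}$ $$\mathrm{depth}(M^{(\underline b)})=s$$ is constant.
   Context: $\mathbb N$ is the set of non-negative integers and $\mathbb N^*$ the set of positive integers. Fix $r\ge 1$ and vectors $\gamma_i=(\gamma_1^i,\dots,\gamma_i^i,0,\dots,0)\in\mathbb N^r$ with $\gamma_i^i\neq 0$, $i=1,\dots,r$. $S=\bigoplus_{\underline n\in\mathbb N^r}S_{\underline n}$ is a Noetherian $\mathbb N^r$-graded ring, generated as an $S_{\underline 0}$-algebra by finitely many homogeneous elements $g_i^j$ ($1\le i\le r$, $1\le j\le \mu_i$) with $\deg g_i^j=\gamma_i$; $S_{\underline 0}$ is a local ring with maximal ideal $\mathfrak m$ and infinite residue field. For $\underline a\in\mathbb N^{*r}$ and $\underline n\in\mathbb Z^r$ put $\phi_{\underline a}(\underline n)=\sum_{i=1}^r n_ia_i\gamma_i$. The Veronese transforms are $S^{(\underline a)}=\bigoplus_{\underline n\in\mathbb N^r}S_{\phi_{\underline a}(\underline n)}$, a graded subring of $S$ with $(S^{(\underline a)})_{\underline n}=S_{\phi_{\underline a}(\underline n)}$, and $M^{(\underline a)}=\bigoplus_{\underline n\in\mathbb Z^r}M_{\phi_{\underline a}(\underline n)}$, a graded $S^{(\underline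 a)}$-module. $\mathrm{depth}(M^{(\underline a)})$ is the depth with respect to the maximal homogeneous ideal $\mathcal M^{(\underline a)}=\mathfrak m\oplus\bigoplus_{\underline n\ne\underline 0}(S^{(\underline a)})_{\underline n}$ of $S^{(\underline a)}$. The Veronese asymptotic depth $vad(M^{( * )})$ is the maximum of $\mathrm{depth}(M^{(\underline a)})$ over all $\underline a\in\mathbb N^{*r}$. *)

theory Defs
  imports
    "HOL-Analysis.Finite_Cartesian_Product"
    "HOL-Library.Extended_Nat"
    "HOL-Algebra.Algebra"
begin

section \<open>Local rings and finitely generated modules\<close>

definition local_ring :: "('a, 'c) ring_scheme \<Rightarrow> 'a set \<Rightarrow> bool" where
  "local_ring R \<mm> \<longleftrightarrow>
     cring R \<and> maximalideal \<mm> R \<and> (\<forall>I. maximalideal I R \<longrightarrow> I = \<mm>)"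

definition generated_submodule ::
    "('a, 'c) ring_scheme \<Rightarrow> ('a, 'b, 'd) module_scheme \<Rightarrow> 'b set \<Rightarrow> 'b set" where
  "generated_submodule R M B = \<Inter>{N. submodule N R M \<and> B \<subseteq> N}"

definition fin_gen_module ::
    "('a, 'c) ring_scheme \<Rightarrow> ('a, 'b, 'd) module_scheme \<Rightarrow> bool" where
  "fin_gen_module R M \<longleftrightarrow>
     (\<exists>B. finite B \<and> B \<subseteq> carrier M \<and> generated_submodule R M B = carrier M)"

section \<open>Depth\<close>

definition ideal_smult ::
    "('a, 'c) ring_scheme \<Rightarrow> ('a, 'b, 'd) module_scheme \<Rightarrow> 'a set \<Rightarrow> 'b set" where
  "ideal_smult R M I =
     generated_submodule R M {x \<odot>\<^bsub>M\<^esub> m | x m. x \<in> I \<and> m \<in> carrier M}"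

text \<open>In the second condition \<open>x\<^sub>i\<close> is a nonzerodivisor on
  \<open>M / (x\<^sub>0, \<dots>, x\<^sub>i\<^sub>-\<^sub>1) M\<close>; this is expressed by representatives in \<open>M\<close>.\<close>

definition regular_sequence ::
    "('a, 'c) ring_scheme \<Rightarrow> ('a, 'b, 'd) module_scheme \<Rightarrow> 'a list \<Rightarrow> bool" where
  "regular_sequence R M xs \<longleftrightarrow>
     set xs \<subseteq> carrier R \<and>
     (\<forall>i < length xs. \<forall>m \<in> carrier M.
        xs ! i \<odot>\<^bsub>M\<^esub> m \<in> ideal_smult R M (genideal R (set (take i xs))) \<longrightarrow>
        m \<in> ideal_smult R M (genideal R (set (take i xs)))) \<and>
     ideal_smult R M (genideal R (set xs)) \<noteq> carrier M"

text \<open>The usual convention is that the depth is infinite if \<open>I M = M\<close>; in particular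
  the zero module has infinite depth.\<close>

definition depth ::
    "('a, 'c) ring_scheme \<Rightarrow> 'a set \<Rightarrow> ('a, 'b, 'd) module_scheme \<Rightarrow> enat" where
  "depth R I M =
     (if ideal_smult R M I = carrier M then \<infinity>
      else (SUP xs \<in> {xs. regular_sequence R M xs \<and> set xs \<subseteq> I}. enat (length xs)))"

section \<open>Multigraded rings and modules\<close>

definition family_sum :: "('m, 'c) ring_scheme \<Rightarrow> ('g \<Rightarrow> 'm set) \<Rightarrow> 'm set" where
  "family_sum G A = {finsum G f F | f F. finite F \<and> (\<forall>n \<in> F. f n \<in> A n)}"

definition internal_direct_sum :: "('m, 'c) ring_scheme \<Rightarrow> ('g \<Rightarrow> 'm set) \<Rightarrow> bool" where
  "internal_direct_sum G A \<longleftrightarrow>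
     (\<forall>n. subgroup (A n) (add_monoid G)) \<and>
     family_sum G A = carrier G \<and>
     (\<forall>f F. finite F \<and> (\<forall>n \<in> F. f n \<in> A n) \<and> finsum G f F = \<zero>\<^bsub>G\<^esub> \<longrightarrow>
        (\<forall>n \<in> F. f n = \<zero>\<^bsub>G\<^esub>))"

definition multigraded_ring ::
    "('a, 'c) ring_scheme \<Rightarrow> (nat ^ 'r::finite \<Rightarrow> 'a set) \<Rightarrow> bool" where
  "multigraded_ring S A \<longleftrightarrow>
     cring S \<and> internal_direct_sum S A \<and>
     (\<forall>m n. \<forall>x \<in> A m. \<forall>y \<in> A n. x \<otimes>\<^bsub>S\<^esub> y \<in> A (m + n))"

definition int_vec :: "nat ^ 'r::finite \<Rightarrow> int ^ 'r" where
  "int_vec n = (\<chi> j. int (n $ j))"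

definition multigraded_module ::
    "('a, 'c) ring_scheme \<Rightarrow> (nat ^ 'r::finite \<Rightarrow> 'a set) \<Rightarrow>
     ('a, 'b, 'd) module_scheme \<Rightarrow> (int ^ 'r \<Rightarrow> 'b set) \<Rightarrow> bool" where
  "multigraded_module S A M B \<longleftrightarrow>
     Module.module S M \<and> internal_direct_sum M B \<and>
     (\<forall>m n. \<forall>x \<in> A m. \<forall>y \<in> B n. x \<odot>\<^bsub>M\<^esub> y \<in> B (int_vec m + n))"

definition degree_zero_ring ::
    "('a, 'c) ring_scheme \<Rightarrow> (nat ^ 'r::finite \<Rightarrow> 'a set) \<Rightarrow> ('a, 'c) ring_scheme" where
  "degree_zero_ring S A = S\<lparr>carrier := A 0\<rparr>"

section \<open>Veronese transforms\<close>

text \<open>The coefficient type is \<open>nat\<close> for degrees of the ring and \<open>int\<close> for degrees of the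
  module.\<close>

definition phi ::
    "('r::finite \<Rightarrow> nat ^ 'r) \<Rightarrow> nat ^ 'r \<Rightarrow> 'k::comm_semiring_1 ^ 'r \<Rightarrow> 'k ^ 'r" where
  "phi \<gamma> a n = (\<chi> j. \<Sum>i\<in>UNIV. n $ i * of_nat (a $ i) * of_nat (\<gamma> i $ j))"

definition veronese_ring ::
    "('a, 'c) ring_scheme \<Rightarrow> (nat ^ 'r::finite \<Rightarrow> 'a set) \<Rightarrow>
     ('r \<Rightarrow> nat ^ 'r) \<Rightarrow> nat ^ 'r \<Rightarrow> ('a, 'c) ring_scheme" where
  "veronese_ring S A \<gamma> a =
     S\<lparr>carrier := family_sum S (\<lambda>n :: nat ^ 'r. A (phi \<gamma> a n))\<rparr>"

definition veronese_module ::
    "('a, 'b, 'd) module_scheme \<Rightarrow> (int ^ 'r::finite \<Rightarrow> 'b set) \<Rightarrow>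
     ('r \<Rightarrow> nat ^ 'r) \<Rightarrow> nat ^ 'r \<Rightarrow> ('a, 'b, 'd) module_scheme" where
  "veronese_module M B \<gamma> a =
     M\<lparr>carrier := family_sum M (\<lambda>n :: int ^ 'r. B (phi \<gamma> a n))\<rparr>"

definition veronese_max_ideal ::
    "('a, 'c) ring_scheme \<Rightarrow> (nat ^ 'r::finite \<Rightarrow> 'a set) \<Rightarrow> 'a set \<Rightarrow>
     ('r \<Rightarrow> nat ^ 'r) \<Rightarrow> nat ^ 'r \<Rightarrow> 'a set" where
  "veronese_max_ideal S A \<mm> \<gamma> a =
     family_sum S (\<lambda>n :: nat ^ 'r. if n = 0 then \<mm> else A (phi \<gamma> a n))"

definition veronese_depth ::
    "('a, 'c) ring_scheme \<Rightarrow> (nat ^ 'r::finite \<Rightarrow> 'a set) \<Rightarrow> 'a set \<Rightarrow>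
     ('a, 'b, 'd) module_scheme \<Rightarrow> (int ^ 'r \<Rightarrow> 'b set) \<Rightarrow>
     ('r \<Rightarrow> nat ^ 'r) \<Rightarrow> nat ^ 'r \<Rightarrow> enat" where
  "veronese_depth S A \<mm> M B \<gamma> a =
     depth (veronese_ring S A \<gamma> a) (veronese_max_ideal S A \<mm> \<gamma> a) (veronese_module M B \<gamma> a)"

text \<open>A supremum in \<open>enat\<close>, so that the definition is total; it is the maximum whenever
  it is attained.\<close>

definition vad ::
    "('a, 'c) ring_scheme \<Rightarrow> (nat ^ 'r::finite \<Rightarrow> 'a set) \<Rightarrow> 'a set \<Rightarrow>
     ('a, 'b, 'd) module_scheme \<Rightarrow> (int ^ 'r \<Rightarrow> 'b set) \<Rightarrow> ('r \<Rightarrow> nat ^ 'r) \<Rightarrow> enat" where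
  "vad S A \<mm> M B \<gamma> = (SUP a \<in> {a. \<forall>i. 0 < a $ i}. veronese_depth S A \<mm> M B \<gamma> a)"

end

theory Submission
  imports Defs
begin

text \<open>
  Depth can only grow when one passes from \<open>a\<close> to a coordinatewise multiple \<open>b\<close>, and it takes only
  finitely many values. Choosing \<open>a\<close> with the largest depth therefore gives an \<open>a\<close> all of whose
  multiples attain the maximum \<open>s\<close>. The usual proof of monotonicity is that local cohomology commutes
  with Veronese functors. The proof below stays with regular sequences.

  \<^emph>\<open>Monotonicity\<close> (\<open>veronese_depth_multiple\<close>). Write \<open>R\<close>, \<open>N\<close>, \<open>I\<close> for the Veronese ring, module and
  maximal ideal of \<open>a\<close>, and \<open>R'\<close>, \<open>N'\<close>, \<open>J\<close> for those of \<open>b\<close>. Every homogeneous element of \<open>R\<close> has a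
  power in \<open>R'\<close>, so a prime of \<open>R\<close> that contains \<open>J\<close> contains \<open>I\<close>. Given an \<open>N\<close>-regular sequence
  \<open>x\<^sub>1, \<dots>, x\<^sub>k\<close> in \<open>I\<close>, no associated prime of any \<open>N/(x\<^sub>1, \<dots>, x\<^sub>i)N\<close> with \<open>i < k\<close> contains \<open>I\<close>, hence
  none contains \<open>J\<close>, and prime avoidance yields one \<open>y \<in> J\<close> that is a nonzerodivisor on all these
  quotients. Then \<open>y, x\<^sub>1, \<dots>, x\<^sub>k\<^sub>-\<^sub>1\<close> is again regular, and repeating the step on \<open>N/yN\<close> trades the whole
  sequence for one in \<open>J\<close> (\<open>weakly_regular_replacement\<close>). Since \<open>N'\<close> is a direct summand of \<open>N\<close> over
  \<open>R'\<close>, the new sequence is also regular on \<open>N'\<close> (\<open>depth_le_depth_summand\<close>).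

  \<^emph>\<open>Finitely many values\<close> (\<open>veronese_depth_bounded\<close>). In the place of \<open>J\<close> one may use a list \<open>z\<close> of
  finitely many elements of \<open>\<mm>\<close> that generate \<open>\<mm> S\<close>, followed by the powers of the \<open>g\<^sub>i\<^sup>j\<close> with
  exponent \<open>b\<^sub>i\<close>: a prime of \<open>R\<close> that contains \<open>z\<close> contains \<open>I\<close>. The length \<open>h\<close> of \<open>z\<close> does not depend
  on \<open>b\<close>. The \<open>i\<close>-th new element can be taken from the coset of \<open>z\<^sub>i\<close> modulo the span of
  the later entries of \<open>z\<close>. After \<open>h\<close> steps the new elements generate the same ideal as \<open>z\<close>, and a longer regular sequence forces \<open>I N = N\<close>. So a depth is infinite or at most \<open>h\<close>.

  Prime avoidance needs \<open>N\<close> to be Noetherian. This descends from \<open>M\<close> over \<open>S\<close>, because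
  \<open>K \<mapsto> S K\<close> embeds the \<open>R\<close>-submodules of \<open>N\<close> strictly monotonically into the \<open>S\<close>-submodules of \<open>M\<close>
  (\<open>noetherian_retract\<close>). The generation of \<open>S\<close> in degrees \<open>\<gamma>\<^sub>i\<close> enters here as well: a
  nonzero component of \<open>S\<close> whose degree lies in the lattice spanned by the \<open>a\<^sub>i \<gamma>\<^sub>i\<close> lies in the monoid
  spanned by them.
\<close>

section \<open>Nonzerodivisors and associated primes\<close>

text \<open>The submodule \<open>K + x M\<close>, which is the preimage of \<open>x (M/K)\<close>. Regular sequences are studied on one fixed
  module with a growing submodule \<open>K\<close> in the role of the ideal generated so far times \<open>M\<close>, so that
  quotient modules need not be formed.\<close>

definition cut :: "('a, 'b, 'd) module_scheme \<Rightarrow> 'b set \<Rightarrow> 'a \<Rightarrow> 'b set" where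
  "cut M K x = {k \<oplus>\<^bsub>M\<^esub> x \<odot>\<^bsub>M\<^esub> m | k m. k \<in> K \<and> m \<in> carrier M}"

definition nonzerodivisor_mod :: "('a, 'b, 'd) module_scheme \<Rightarrow> 'b set \<Rightarrow> 'a \<Rightarrow> bool" where
  "nonzerodivisor_mod M K x \<longleftrightarrow> (\<forall>m \<in> carrier M. x \<odot>\<^bsub>M\<^esub> m \<in> K \<longrightarrow> m \<in> K)"

text \<open>Regularity without the properness condition: a sequence that has already cut \<open>M\<close> down to zero may be continued
  arbitrarily. This makes the exchange argument uniform.\<close>

fun weakly_regular :: "('a, 'b, 'd) module_scheme \<Rightarrow> 'b set \<Rightarrow> 'a list \<Rightarrow> bool" where
  "weakly_regular M K [] \<longleftrightarrow> True"
| "weakly_regular M K (x # xs) \<longleftrightarrow> nonzerodivisor_mod M K x \<and> weakly_regular M (cut M K x) xs"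

text \<open>For \<open>xs\<close> of length \<open>k\<close> this asks about the quotients by the first \<open>0, \<dots>, k - 1\<close> entries only. The
  full quotient is left out because the last entry is the one that \<open>y\<close> will replace.\<close>

fun nonzerodivisor_along :: "('a, 'b, 'd) module_scheme \<Rightarrow> 'b set \<Rightarrow> 'a list \<Rightarrow> 'a \<Rightarrow> bool" where
  "nonzerodivisor_along M K [] y \<longleftrightarrow> True"
| "nonzerodivisor_along M K (x # xs) y \<longleftrightarrow>
     nonzerodivisor_mod M K y \<and> nonzerodivisor_along M (cut M K x) xs y"

definition colon :: "('a, 'c) ring_scheme \<Rightarrow> ('a, 'b, 'd) module_scheme \<Rightarrow> 'b set \<Rightarrow> 'b \<Rightarrow> 'a set" where
  "colon R M K n = {r \<in> carrier R. r \<odot>\<^bsub>M\<^esub> n \<in> K}"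

definition annihilator_mod ::
    "('a, 'c) ring_scheme \<Rightarrow> ('a, 'b, 'd) module_scheme \<Rightarrow> 'b set \<Rightarrow> 'a set" where
  "annihilator_mod R M K = {r \<in> carrier R. \<forall>n \<in> carrier M. r \<odot>\<^bsub>M\<^esub> n \<in> K}"

definition associated_primes ::
    "('a, 'c) ring_scheme \<Rightarrow> ('a, 'b, 'd) module_scheme \<Rightarrow> 'b set \<Rightarrow> 'a set set" where
  "associated_primes R M K =
     {P. primeideal P R \<and> (\<exists>n \<in> carrier M. n \<notin> K \<and> P = colon R M K n)}"

text \<open>The larger submodule stands on the left, so that well-foundedness is the ascending chain condition.\<close>

definition submodule_order ::
    "('a, 'c) ring_scheme \<Rightarrow> ('a, 'b, 'd) module_scheme \<Rightarrow> ('b set \<times> 'b set) set" where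
  "submodule_order R M = {(L, K). submodule L R M \<and> submodule K R M \<and> K \<subset> L}"

definition noetherian_module ::
    "('a, 'c) ring_scheme \<Rightarrow> ('a, 'b, 'd) module_scheme \<Rightarrow> bool" where
  "noetherian_module R M \<longleftrightarrow> wf (submodule_order R M)"

context module
begin

lemma submodule_zero: "submodule K R M \<Longrightarrow> \<zero>\<^bsub>M\<^esub> \<in> K"
  using subgroup.one_closed[OF submodule.axioms(1)] by fastforce

lemma submodule_subset: "submodule K R M \<Longrightarrow> k \<in> K \<Longrightarrow> k \<in> carrier M"
  using submoduleE(1) by blast

lemma submodule_cancel:
  assumes "submodule K R M" "k \<in> K" "x \<in> carrier M" "k \<oplus>\<^bsub>M\<^esub> x \<in> K"
  shows "x \<in> K"
proof -
  have k: "k \<in> carrier M" using assms submodule_subset by blast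
  have "\<ominus>\<^bsub>M\<^esub> k \<oplus>\<^bsub>M\<^esub> (k \<oplus>\<^bsub>M\<^esub> x) = x" using k assms(3) by (metis M.r_neg1)
  moreover have "\<ominus>\<^bsub>M\<^esub> k \<oplus>\<^bsub>M\<^esub> (k \<oplus>\<^bsub>M\<^esub> x) \<in> K" using assms submoduleE(3,5) by blast
  ultimately show ?thesis by simp
qed

lemma submodule_cancel2:
  assumes "submodule K R M" "k \<in> K" "x \<in> carrier M" "x \<oplus>\<^bsub>M\<^esub> k \<in> K"
  shows "x \<in> K"
  using submodule_cancel[OF assms(1-3)] assms submodule_subset by (simp add: M.add.m_comm)

lemma smult_commute:
  "\<lbrakk>a \<in> carrier R; b \<in> carrier R; m \<in> carrier M\<rbrakk> \<Longrightarrow> a \<odot>\<^bsub>M\<^esub> (b \<odot>\<^bsub>M\<^esub> m) = b \<odot>\<^bsub>M\<^esub> (a \<odot>\<^bsub>M\<^esub> m)"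
  by (metis R.m_comm smult_assoc1)

lemma zero_submodule: "submodule {\<zero>\<^bsub>M\<^esub>} R M"
  by (rule submoduleI) auto

lemma submodule_cut:
  assumes K: "submodule K R M" and x: "x \<in> carrier R"
  shows "submodule (cut M K x) R M"
proof (rule submoduleI)
  note Kc = submodule_subset[OF K]
  show "cut M K x \<subseteq> carrier M" using x Kc by (auto simp: cut_def)
  have "\<zero>\<^bsub>M\<^esub> = \<zero>\<^bsub>M\<^esub> \<oplus>\<^bsub>M\<^esub> x \<odot>\<^bsub>M\<^esub> \<zero>\<^bsub>M\<^esub>" using x by simp
  then show "\<zero>\<^bsub>M\<^esub> \<in> cut M K x"
    unfolding cut_def using submodule_zero[OF K] M.zero_closed by blast
  fix a b assume a: "a \<in> cut M K x"
  then obtain k m where km: "a = k \<oplus>\<^bsub>M\<^esub> x \<odot>\<^bsub>M\<^esub> m" "k \<in> K" "m \<in> carrier M"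
    by (auto simp: cut_def)
  have "\<ominus>\<^bsub>M\<^esub> a = \<ominus>\<^bsub>M\<^esub> k \<oplus>\<^bsub>M\<^esub> x \<odot>\<^bsub>M\<^esub> (\<ominus>\<^bsub>M\<^esub> m)"
    using km x Kc by (simp add: M.minus_add smult_r_minus)
  then show "\<ominus>\<^bsub>M\<^esub> a \<in> cut M K x" using km submoduleE(3)[OF K] by (auto simp: cut_def)
  assume "b \<in> cut M K x"
  then obtain k' m' where km': "b = k' \<oplus>\<^bsub>M\<^esub> x \<odot>\<^bsub>M\<^esub> m'" "k' \<in> K" "m' \<in> carrier M"
    by (auto simp: cut_def)
  have "a \<oplus>\<^bsub>M\<^esub> b = (k \<oplus>\<^bsub>M\<^esub> k') \<oplus>\<^bsub>M\<^esub> x \<odot>\<^bsub>M\<^esub> (m \<oplus>\<^bsub>M\<^esub> m')"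
    using km km' x Kc by (simp add: smult_r_distr M.a_ac)
  then show "a \<oplus>\<^bsub>M\<^esub> b \<in> cut M K x"
    using km km' submoduleE(5)[OF K] by (auto simp: cut_def)
next
  note Kc = submodule_subset[OF K]
  fix r a assume r: "r \<in> carrier R" and a: "a \<in> cut M K x"
  then obtain k m where km: "a = k \<oplus>\<^bsub>M\<^esub> x \<odot>\<^bsub>M\<^esub> m" "k \<in> K" "m \<in> carrier M"
    by (auto simp: cut_def)
  have "r \<odot>\<^bsub>M\<^esub> a = r \<odot>\<^bsub>M\<^esub> k \<oplus>\<^bsub>M\<^esub> x \<odot>\<^bsub>M\<^esub> (r \<odot>\<^bsub>M\<^esub> m)"
    using km x r Kc by (simp add: smult_r_distr smult_commute)
  then show "r \<odot>\<^bsub>M\<^esub> a \<in> cut M K x"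
    using km r submoduleE(4)[OF K] by (auto simp: cut_def)
qed

lemma subset_cut:
  assumes K: "submodule K R M" and x: "x \<in> carrier R"
  shows "K \<subseteq> cut M K x"
proof
  fix k assume "k \<in> K"
  then have "k = k \<oplus>\<^bsub>M\<^esub> x \<odot>\<^bsub>M\<^esub> \<zero>\<^bsub>M\<^esub>" using x submodule_subset[OF K] by simp
  then show "k \<in> cut M K x" unfolding cut_def using \<open>k \<in> K\<close> by blast
qed

lemma smult_in_cut:
  assumes K: "submodule K R M" and x: "x \<in> carrier R" and m: "m \<in> carrier M"
  shows "x \<odot>\<^bsub>M\<^esub> m \<in> cut M K x"
proof -
  have "x \<odot>\<^bsub>M\<^esub> m = \<zero>\<^bsub>M\<^esub> \<oplus>\<^bsub>M\<^esub> x \<odot>\<^bsub>M\<^esub> m" using x m by simp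
  then show ?thesis unfolding cut_def using submodule_zero[OF K] m by blast
qed

lemma cut_least:
  assumes "submodule L R M" "K \<subseteq> L" "\<And>m. m \<in> carrier M \<Longrightarrow> x \<odot>\<^bsub>M\<^esub> m \<in> L"
  shows "cut M K x \<subseteq> L"
  using assms submoduleE(5)[OF assms(1)] by (auto simp: cut_def)

lemma cut_commute:
  assumes K: "submodule K R M" and x: "x \<in> carrier R" and y: "y \<in> carrier R"
  shows "cut M (cut M K x) y = cut M (cut M K y) x"
proof -
  have "cut M (cut M K x) y \<subseteq> cut M (cut M K y) x"
    if x: "x \<in> carrier R" and y: "y \<in> carrier R" for x y
  proof (intro cut_least)
    have Ky: "submodule (cut M K y) R M" using submodule_cut K y by blast
    show Kyx: "submodule (cut M (cut M K y) x) R M" using submodule_cut Ky x by blast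
    then show "submodule (cut M (cut M K y) x) R M" .
    show "K \<subseteq> cut M (cut M K y) x" using subset_cut K Ky x y by blast
    show "x \<odot>\<^bsub>M\<^esub> m \<in> cut M (cut M K y) x" if "m \<in> carrier M" for m
      using smult_in_cut Ky x that by blast
    show "y \<odot>\<^bsub>M\<^esub> m \<in> cut M (cut M K y) x" if "m \<in> carrier M" for m
      using smult_in_cut[OF K y that] subset_cut[OF Ky x] by blast
  qed
  then show ?thesis using x y by blast
qed

lemma submodule_foldl_cut:
  "submodule K R M \<Longrightarrow> set xs \<subseteq> carrier R \<Longrightarrow> submodule (foldl (cut M) K xs) R M"
  by (induction xs arbitrary: K) (auto simp: submodule_cut)

lemma subset_foldl_cut:
  "submodule K R M \<Longrightarrow> set xs \<subseteq> carrier R \<Longrightarrow> K \<subseteq> foldl (cut M) K xs"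
proof (induction xs arbitrary: K)
  case (Cons x xs)
  then show ?case using Cons.IH[of "cut M K x"] submodule_cut[of K x] subset_cut[of K x] by force
qed simp

lemma smult_in_foldl_cut:
  "submodule K R M \<Longrightarrow> set xs \<subseteq> carrier R \<Longrightarrow> x \<in> set xs \<Longrightarrow> m \<in> carrier M \<Longrightarrow>
     x \<odot>\<^bsub>M\<^esub> m \<in> foldl (cut M) K xs"
proof (induction xs arbitrary: K)
  case (Cons y xs)
  have sub: "submodule (cut M K y) R M" using Cons.prems submodule_cut by auto
  show ?case
  proof (cases "x = y")
    case True
    then show ?thesis
      using Cons.prems smult_in_cut[of K y m] subset_foldl_cut[OF sub, of xs] by auto
  next
    case False
    then show ?thesis using Cons.IH[OF sub] Cons.prems by auto
  qed
qed simp

lemma foldl_cut_least: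
  "submodule L R M \<Longrightarrow> K \<subseteq> L \<Longrightarrow> (\<And>x m. x \<in> set xs \<Longrightarrow> m \<in> carrier M \<Longrightarrow> x \<odot>\<^bsub>M\<^esub> m \<in> L) \<Longrightarrow>
     foldl (cut M) K xs \<subseteq> L"
proof (induction xs arbitrary: K)
  case (Cons y xs)
  show ?case using Cons.IH[of "cut M K y"] Cons.prems cut_least[of L K y] by auto
qed simp

lemma weakly_regular_iff_nth:
  "weakly_regular M K xs \<longleftrightarrow>
     (\<forall>i < length xs. nonzerodivisor_mod M (foldl (cut M) K (take i xs)) (xs ! i))"
proof (induction xs arbitrary: K)
  case (Cons x xs)
  show ?case by (simp add: Cons.IH All_less_Suc2)
qed simp

lemma colon_ideal:
  assumes K: "submodule K R M" and n: "n \<in> carrier M"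
  shows "ideal (colon R M K n) R"
proof (rule idealI)
  show "ring R" by (rule R.ring_axioms)
  note Kc = submoduleE[OF K] 
  show "subgroup (colon R M K n) (add_monoid R)"
  proof (rule subgroup.intro)
    show "colon R M K n \<subseteq> carrier (add_monoid R)" by (auto simp: colon_def)
    show "\<one>\<^bsub>add_monoid R\<^esub> \<in> colon R M K n"
      using submodule_zero[OF K] n by (simp add: colon_def)
    fix x y assume x: "x \<in> colon R M K n"
    have "inv\<^bsub>add_monoid R\<^esub> x = \<ominus> x" by (simp add: a_inv_def)
    then show "inv\<^bsub>add_monoid R\<^esub> x \<in> colon R M K n"
      using x Kc(3) n by (simp add: colon_def smult_l_minus)
    assume "y \<in> colon R M K n"
    then show "x \<otimes>\<^bsub>add_monoid R\<^esub> y \<in> colon R M K n"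
      using x Kc(5) n by (simp add: colon_def smult_l_distr)
  qed
  fix a x assume a: "a \<in> colon R M K n" and x: "x \<in> carrier R"
  show "x \<otimes> a \<in> colon R M K n"
    using a x Kc(4) n by (simp add: colon_def smult_assoc1)
  then show "a \<otimes> x \<in> colon R M K n"
    using a x by (simp add: colon_def R.m_comm)
qed

lemma annihilator_ideal:
  assumes K: "submodule K R M"
  shows "ideal (annihilator_mod R M K) R"
proof -
  have "annihilator_mod R M K = \<Inter>(colon R M K ` carrier M)"
    using M.zero_closed by (auto simp: annihilator_mod_def colon_def)
  moreover have "ideal (\<Inter>(colon R M K ` carrier M)) R"
    using colon_ideal[OF K] M.zero_closed by (intro R.i_Intersect) auto
  ultimately show ?thesis by simp
qed

lemma colon_subset_colon_smult:
  assumes K: "submodule K R M" and n: "n \<in> carrier M" and a: "a \<in> carrier R"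
  shows "colon R M K n \<subseteq> colon R M K (a \<odot>\<^bsub>M\<^esub> n)"
proof
  fix p assume "p \<in> colon R M K n"
  then have p: "p \<in> carrier R" "p \<odot>\<^bsub>M\<^esub> n \<in> K" by (auto simp: colon_def)
  have "p \<odot>\<^bsub>M\<^esub> (a \<odot>\<^bsub>M\<^esub> n) = a \<odot>\<^bsub>M\<^esub> (p \<odot>\<^bsub>M\<^esub> n)" using smult_commute p a n by blast
  then show "p \<in> colon R M K (a \<odot>\<^bsub>M\<^esub> n)"
    using p submoduleE(4)[OF K a] by (simp add: colon_def)
qed

lemma submodule_ideal_times_add:
  assumes K: "submodule K R M" and I: "ideal I R" and n: "n \<in> carrier M"
  shows "submodule {r \<odot>\<^bsub>M\<^esub> n \<oplus>\<^bsub>M\<^esub> k | r k. r \<in> I \<and> k \<in> K} R M" (is "submodule ?L R M")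
proof (rule submoduleI)
  interpret I: ideal I R by fact
  note Kc = submodule_subset[OF K] submoduleE(3,4,5)[OF K]
  show "?L \<subseteq> carrier M" using n Kc I.a_Hcarr by auto
  have "\<zero>\<^bsub>M\<^esub> = \<zero> \<odot>\<^bsub>M\<^esub> n \<oplus>\<^bsub>M\<^esub> \<zero>\<^bsub>M\<^esub>" using n by simp
  then show "\<zero>\<^bsub>M\<^esub> \<in> ?L" using submodule_zero[OF K] I.zero_closed by blast
  fix a b assume a: "a \<in> ?L"
  then obtain r k where rk: "a = r \<odot>\<^bsub>M\<^esub> n \<oplus>\<^bsub>M\<^esub> k" "r \<in> I" "k \<in> K" by blast
  have rc: "r \<in> carrier R" using rk I.a_Hcarr by blast
  have "\<ominus>\<^bsub>M\<^esub> a = (\<ominus> r) \<odot>\<^bsub>M\<^esub> n \<oplus>\<^bsub>M\<^esub> \<ominus>\<^bsub>M\<^esub> k"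
    using rk rc n Kc by (simp add: M.minus_add smult_l_minus)
  moreover have "\<ominus> r \<in> I" using rk by simp
  moreover have "\<ominus>\<^bsub>M\<^esub> k \<in> K" using rk Kc by blast
  ultimately show "\<ominus>\<^bsub>M\<^esub> a \<in> ?L" by blast
  assume "b \<in> ?L"
  then obtain r' k' where rk': "b = r' \<odot>\<^bsub>M\<^esub> n \<oplus>\<^bsub>M\<^esub> k'" "r' \<in> I" "k' \<in> K" by blast
  have "r' \<in> carrier R" using rk' I.a_Hcarr by blast
  then have "a \<oplus>\<^bsub>M\<^esub> b = (r \<oplus> r') \<odot>\<^bsub>M\<^esub> n \<oplus>\<^bsub>M\<^esub> (k \<oplus>\<^bsub>M\<^esub> k')"
    using rk rk' rc n Kc by (simp add: smult_l_distr M.a_ac)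
  moreover have "r \<oplus> r' \<in> I" "k \<oplus>\<^bsub>M\<^esub> k' \<in> K" using rk rk' Kc by auto
  ultimately show "a \<oplus>\<^bsub>M\<^esub> b \<in> ?L" by blast
next
  interpret I: ideal I R by fact
  note Kc = submodule_subset[OF K] submoduleE(3,4,5)[OF K]
  fix x a assume x: "x \<in> carrier R" and a: "a \<in> ?L"
  then obtain r k where rk: "a = r \<odot>\<^bsub>M\<^esub> n \<oplus>\<^bsub>M\<^esub> k" "r \<in> I" "k \<in> K" by blast
  have rc: "r \<in> carrier R" using rk I.a_Hcarr by blast
  have "x \<odot>\<^bsub>M\<^esub> a = (x \<otimes> r) \<odot>\<^bsub>M\<^esub> n \<oplus>\<^bsub>M\<^esub> x \<odot>\<^bsub>M\<^esub> k"
    using rk rc n Kc x by (simp add: smult_r_distr smult_assoc1)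
  moreover have "x \<otimes> r \<in> I" "x \<odot>\<^bsub>M\<^esub> k \<in> K" using rk Kc x I.I_l_closed by auto
  ultimately show "x \<odot>\<^bsub>M\<^esub> a \<in> ?L" by blast
qed

lemma adjoin_element:
  assumes K: "submodule K R M" and n: "n \<in> carrier M"
  shows submodule_adjoin: "submodule {r \<odot>\<^bsub>M\<^esub> n \<oplus>\<^bsub>M\<^esub> k | r k. r \<in> carrier R \<and> k \<in> K} R M" (is "submodule ?L R M")
    and subset_adjoin: "K \<subseteq> {r \<odot>\<^bsub>M\<^esub> n \<oplus>\<^bsub>M\<^esub> k | r k. r \<in> carrier R \<and> k \<in> K}"
    and element_adjoin: "n \<in> {r \<odot>\<^bsub>M\<^esub> n \<oplus>\<^bsub>M\<^esub> k | r k. r \<in> carrier R \<and> k \<in> K}"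
proof -
  show "submodule ?L R M" by (rule submodule_ideal_times_add[OF K R.oneideal n])
  show "K \<subseteq> ?L"
  proof
    fix k assume "k \<in> K"
    then have "k = \<zero> \<odot>\<^bsub>M\<^esub> n \<oplus>\<^bsub>M\<^esub> k" using n submodule_subset[OF K] by simp
    then show "k \<in> ?L" using \<open>k \<in> K\<close> R.zero_closed by blast
  qed
  have "n = \<one> \<odot>\<^bsub>M\<^esub> n \<oplus>\<^bsub>M\<^esub> \<zero>\<^bsub>M\<^esub>" using n by simp
  then show "n \<in> ?L" using submodule_zero[OF K] R.one_closed by blast
qed

text \<open>Among the colon ideals of elements of \<open>R n\<close> outside \<open>K\<close>, a maximal one is prime. The chain condition is
  only given for submodules, so maximality is taken for the submodules \<open>(K : r n) n + K\<close>. They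
  are large enough to recover what is needed about \<open>(K : r n)\<close>.\<close>

lemma prime_colon_exists:
  assumes noeth: "noetherian_module R M" and K: "submodule K R M"
    and n: "n \<in> carrier M" "n \<notin> K"
  shows "\<exists>n' \<in> carrier M. n' \<notin> K \<and> colon R M K n \<subseteq> colon R M K n' \<and> primeideal (colon R M K n') R"
proof -
  note Kc = submodule_subset[OF K] submoduleE(3,4,5)[OF K]
  define L where "L r = {s \<odot>\<^bsub>M\<^esub> n \<oplus>\<^bsub>M\<^esub> k | s k. s \<in> colon R M K (r \<odot>\<^bsub>M\<^esub> n) \<and> k \<in> K}" for r
  define Q where "Q = {L r | r. r \<in> carrier R \<and> r \<odot>\<^bsub>M\<^esub> n \<notin> K}"
  have L_sub: "submodule (L r) R M" if "r \<in> carrier R" for r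
    unfolding L_def using submodule_ideal_times_add[OF K colon_ideal[OF K]] that n by simp
  have "\<one> \<odot>\<^bsub>M\<^esub> n \<notin> K" using n by simp
  then have "L \<one> \<in> Q" unfolding Q_def using R.one_closed by blast
  then obtain Z where Z: "Z \<in> Q" "\<And>Y. (Y, Z) \<in> submodule_order R M \<Longrightarrow> Y \<notin> Q"
    using wfE_min[OF noeth[unfolded noetherian_module_def]] by metis
  then obtain r where r: "Z = L r" "r \<in> carrier R" "r \<odot>\<^bsub>M\<^esub> n \<notin> K" by (auto simp: Q_def)
  let ?n = "r \<odot>\<^bsub>M\<^esub> n"
  have "primeideal (colon R M K ?n) R"
  proof (rule primeidealI)
    show "ideal (colon R M K ?n) R" using colon_ideal K n r by simp
    show "cring R" by (rule R.is_cring)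
    have "\<one> \<notin> colon R M K ?n" using r n by (simp add: colon_def)
    then show "carrier R \<noteq> colon R M K ?n" by auto
    fix a b assume ab: "a \<in> carrier R" "b \<in> carrier R" "a \<otimes> b \<in> colon R M K ?n"
    show "a \<in> colon R M K ?n \<or> b \<in> colon R M K ?n"
    proof (rule disjCI, rule ccontr)
      assume "b \<notin> colon R M K ?n" and "a \<notin> colon R M K ?n"
      then have arn: "(a \<otimes> r) \<odot>\<^bsub>M\<^esub> n \<notin> K" using ab r n by (simp add: colon_def smult_assoc1)
      have eq: "(a \<otimes> r) \<odot>\<^bsub>M\<^esub> n = a \<odot>\<^bsub>M\<^esub> ?n" using ab r n by (simp add: smult_assoc1)
      have "colon R M K ?n \<subseteq> colon R M K (a \<odot>\<^bsub>M\<^esub> ?n)"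
        using colon_subset_colon_smult[OF K] ab r n by simp
      then have "L r \<subseteq> L (a \<otimes> r)" unfolding L_def eq by blast
      moreover have "L (a \<otimes> r) \<in> Q" using arn ab r by (auto simp: Q_def)
      ultimately have "L r = L (a \<otimes> r)"
        using Z(2)[of "L (a \<otimes> r)"] r ab L_sub by (auto simp: submodule_order_def)
      moreover have "b \<in> colon R M K ((a \<otimes> r) \<odot>\<^bsub>M\<^esub> n)"
      proof -
        have "b \<odot>\<^bsub>M\<^esub> (a \<odot>\<^bsub>M\<^esub> ?n) = (a \<otimes> b) \<odot>\<^bsub>M\<^esub> ?n"
          using ab r n by (simp add: smult_assoc1 smult_commute)
        then show ?thesis using ab eq by (simp add: colon_def)
      qed
      then have "b \<odot>\<^bsub>M\<^esub> n \<oplus>\<^bsub>M\<^esub> \<zero>\<^bsub>M\<^esub> \<in> L (a \<otimes> r)"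
        unfolding L_def using submodule_zero[OF K] by blast
      ultimately have "b \<odot>\<^bsub>M\<^esub> n \<in> L r" using ab n by simp
      then obtain p k where pk: "b \<odot>\<^bsub>M\<^esub> n = p \<odot>\<^bsub>M\<^esub> n \<oplus>\<^bsub>M\<^esub> k" "p \<in> colon R M K ?n" "k \<in> K"
        by (auto simp: L_def)
      have pc: "p \<in> carrier R" "p \<odot>\<^bsub>M\<^esub> ?n \<in> K" using pk by (auto simp: colon_def)
      have "b \<odot>\<^bsub>M\<^esub> ?n = r \<odot>\<^bsub>M\<^esub> (b \<odot>\<^bsub>M\<^esub> n)" using ab r n smult_commute by simp
      also have "\<dots> = p \<odot>\<^bsub>M\<^esub> ?n \<oplus>\<^bsub>M\<^esub> r \<odot>\<^bsub>M\<^esub> k"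
        using pk pc r n Kc by (simp add: smult_r_distr smult_commute)
      (* b n differs from an element of (K : r n) n by an element of K, so b annihilates r n modulo K *)
      finally have "b \<odot>\<^bsub>M\<^esub> ?n \<in> K" using pc pk r Kc by simp
      then show False using \<open>b \<notin> colon R M K ?n\<close> ab by (simp add: colon_def)
    qed
  qed
  moreover have "colon R M K n \<subseteq> colon R M K ?n"
    using colon_subset_colon_smult[OF K] r n by simp
  ultimately show ?thesis using r n by (intro bexI[of _ ?n]) auto
qed

lemma associated_prime_avoids:
  assumes "P \<in> associated_primes R M K" "x \<in> carrier R" "nonzerodivisor_mod M K x"
  shows "x \<notin> P"
  using assms by (auto simp: associated_primes_def colon_def nonzerodivisor_mod_def)

lemma nonzerodivisor_modI:
  assumes noeth: "noetherian_module R M" and K: "submodule K R M" and x: "x \<in> carrier R"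
    and "\<And>P. P \<in> associated_primes R M K \<Longrightarrow> x \<notin> P"
  shows "nonzerodivisor_mod M K x"
proof (unfold nonzerodivisor_mod_def, intro ballI impI, rule ccontr)
  fix n assume n: "n \<in> carrier M" "x \<odot>\<^bsub>M\<^esub> n \<in> K" "n \<notin> K"
  obtain n' where n': "n' \<in> carrier M" "n' \<notin> K" "colon R M K n \<subseteq> colon R M K n'"
    "primeideal (colon R M K n') R"
    using prime_colon_exists[OF noeth K n(1,3)] by blast
  moreover have "x \<in> colon R M K n" using n x by (simp add: colon_def)
  ultimately show False using assms(4)[of "colon R M K n'"] by (auto simp: associated_primes_def)
qed

lemma annihilator_subset_associated_prime:
  "P \<in> associated_primes R M K \<Longrightarrow> annihilator_mod R M K \<subseteq> P"
  by (auto simp: associated_primes_def annihilator_mod_def colon_def)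

text \<open>Noetherian induction from above. If \<open>(K : n\<^sub>0)\<close> is prime, then an associated prime \<open>(K : m)\<close> other than it is
  also associated to the larger submodule \<open>K + R n\<^sub>0\<close>: otherwise \<open>R m\<close> and \<open>R n\<^sub>0\<close> have a common
  nonzero multiple modulo \<open>K\<close>, whose annihilator is both \<open>(K : m)\<close> and \<open>(K : n\<^sub>0)\<close>.\<close>

lemma finite_associated_primes:
  assumes noeth: "noetherian_module R M"
  shows "submodule K R M \<Longrightarrow> finite (associated_primes R M K)"
proof (induction K rule: wf_induct_rule[OF noeth[unfolded noetherian_module_def]])
  case (1 K)
  note K = \<open>submodule K R M\<close>
  note Kc = submodule_subset[OF K] submoduleE(3,4,5)[OF K]
  show ?case
  proof (cases "K = carrier M")
    case True
    then show ?thesis by (simp add: associated_primes_def)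
  next
    case False
    then obtain n where "n \<in> carrier M" "n \<notin> K" using Kc by blast
    then obtain n0 where n0: "n0 \<in> carrier M" "n0 \<notin> K" "primeideal (colon R M K n0) R"
      using prime_colon_exists[OF noeth K] by blast
    define K' where "K' = {r \<odot>\<^bsub>M\<^esub> n0 \<oplus>\<^bsub>M\<^esub> k | r k. r \<in> carrier R \<and> k \<in> K}"
    have K': "submodule K' R M" and KK': "K \<subseteq> K'" and "n0 \<in> K'"
      unfolding K'_def using adjoin_element[OF K n0(1)] by blast+
    then have "(K', K) \<in> submodule_order R M"
      using K K' KK' n0 by (auto simp: submodule_order_def)
    then have fin: "finite (associated_primes R M K')" using 1 K' by blast
    have "associated_primes R M K \<subseteq> insert (colon R M K n0) (associated_primes R M K')"
    proof
      fix P assume "P \<in> associated_primes R M K"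
      then obtain m where P: "primeideal P R" and m: "m \<in> carrier M" "m \<notin> K" "P = colon R M K m"
        by (auto simp: associated_primes_def)
      show "P \<in> insert (colon R M K n0) (associated_primes R M K')"
      proof (cases "\<forall>r \<in> carrier R. r \<odot>\<^bsub>M\<^esub> m \<in> K' \<longrightarrow> r \<odot>\<^bsub>M\<^esub> m \<in> K")
        case True
        then have "P = colon R M K' m" using m KK' by (auto simp: colon_def)
        moreover have "m \<notin> K'" using True[rule_format, of \<one>] m by auto
        ultimately show ?thesis using P m by (auto simp: associated_primes_def)
      next
        case False
        then obtain r where r: "r \<in> carrier R" "r \<odot>\<^bsub>M\<^esub> m \<in> K'" "r \<odot>\<^bsub>M\<^esub> m \<notin> K" by blast
        then obtain s k where sk: "r \<odot>\<^bsub>M\<^esub> m = s \<odot>\<^bsub>M\<^esub> n0 \<oplus>\<^bsub>M\<^esub> k" "s \<in> carrier R" "k \<in> K"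
          by (auto simp: K'_def)
        have snot: "s \<odot>\<^bsub>M\<^esub> n0 \<notin> K" using r sk Kc by auto
        have key: "t \<odot>\<^bsub>M\<^esub> (r \<odot>\<^bsub>M\<^esub> m) \<in> K \<longleftrightarrow> t \<odot>\<^bsub>M\<^esub> (s \<odot>\<^bsub>M\<^esub> n0) \<in> K" if t: "t \<in> carrier R" for t
        proof -
          have "t \<odot>\<^bsub>M\<^esub> (r \<odot>\<^bsub>M\<^esub> m) = t \<odot>\<^bsub>M\<^esub> (s \<odot>\<^bsub>M\<^esub> n0) \<oplus>\<^bsub>M\<^esub> t \<odot>\<^bsub>M\<^esub> k"
            using sk t n0 Kc by (simp add: smult_r_distr)
          moreover have "t \<odot>\<^bsub>M\<^esub> k \<in> K" "t \<odot>\<^bsub>M\<^esub> (s \<odot>\<^bsub>M\<^esub> n0) \<in> carrier M" using sk t n0 Kc by auto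
          ultimately show ?thesis using submodule_cancel2[OF K] Kc(4) by metis
        qed
        have prime_cancel: "t \<odot>\<^bsub>M\<^esub> (u \<odot>\<^bsub>M\<^esub> q) \<in> K \<longleftrightarrow> t \<odot>\<^bsub>M\<^esub> q \<in> K"
          if "primeideal (colon R M K q) R" "u \<in> carrier R" "t \<in> carrier R" "q \<in> carrier M"
            "u \<odot>\<^bsub>M\<^esub> q \<notin> K" for t u q
        proof
          assume "t \<odot>\<^bsub>M\<^esub> (u \<odot>\<^bsub>M\<^esub> q) \<in> K"
          then have "t \<otimes> u \<in> colon R M K q" using that by (simp add: colon_def smult_assoc1)
          then have "t \<in> colon R M K q \<or> u \<in> colon R M K q"
            using primeideal.I_prime[OF that(1)] that by blast
          then show "t \<odot>\<^bsub>M\<^esub> q \<in> K" using that by (auto simp: colon_def)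
        next
          assume "t \<odot>\<^bsub>M\<^esub> q \<in> K"
          then show "t \<odot>\<^bsub>M\<^esub> (u \<odot>\<^bsub>M\<^esub> q) \<in> K" using Kc(3) smult_commute that by metis
        qed
        have "t \<in> P \<longleftrightarrow> t \<in> colon R M K n0" if t: "t \<in> carrier R" for t
        proof -
          have "t \<odot>\<^bsub>M\<^esub> m \<in> K \<longleftrightarrow> t \<odot>\<^bsub>M\<^esub> (r \<odot>\<^bsub>M\<^esub> m) \<in> K"
            using prime_cancel[OF _ r(1) t m(1) r(3)] P m(3) by blast
          also have "\<dots> \<longleftrightarrow> t \<odot>\<^bsub>M\<^esub> (s \<odot>\<^bsub>M\<^esub> n0) \<in> K" by (rule key[OF t])
          also have "\<dots> \<longleftrightarrow> t \<odot>\<^bsub>M\<^esub> n0 \<in> K"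
            by (rule prime_cancel[OF n0(3) sk(2) t n0(1) snot])
          finally show ?thesis using t m(3) by (simp add: colon_def)
        qed
        then have "P = colon R M K n0" using m(3) by (auto simp: colon_def)
        then show ?thesis by simp
      qed
    qed
    then show ?thesis using fin finite_subset by blast
  qed
qed

text \<open>Take \<open>L\<close> maximal among the proper submodules above \<open>K\<close>. Then \<open>M/L\<close> is generated by any \<open>n\<^sub>0 \<notin> L\<close>, and
  \<open>P = (L : n\<^sub>0)\<close> annihilates it. This takes the place of Nakayama's lemma: if \<open>J M \<noteq> M\<close> and every prime over \<open>J\<close>
  contains \<open>I\<close>, then \<open>I M \<noteq> M\<close>.\<close>

lemma proper_submodule_prime:
  assumes noeth: "noetherian_module R M" and K: "submodule K R M" and proper: "K \<noteq> carrier M"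
  shows "\<exists>P L. primeideal P R \<and> submodule L R M \<and> L \<noteq> carrier M \<and> annihilator_mod R M K \<subseteq> P \<and>
           P \<subseteq> annihilator_mod R M L"
proof -
  define Q where "Q = {L. submodule L R M \<and> K \<subseteq> L \<and> L \<noteq> carrier M}"
  have "K \<in> Q" using K proper by (simp add: Q_def)
  then obtain L where L: "L \<in> Q" "\<And>Y. (Y, L) \<in> submodule_order R M \<Longrightarrow> Y \<notin> Q"
    using wfE_min[OF noeth[unfolded noetherian_module_def]] by metis
  then have Ls: "submodule L R M" "K \<subseteq> L" "L \<noteq> carrier M" by (auto simp: Q_def)
  note Lc = submodule_subset[OF Ls(1)] submoduleE(3,4,5)[OF Ls(1)]
  obtain n where "n \<in> carrier M" "n \<notin> L" using Ls Lc by blast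
  then obtain n0 where n0: "n0 \<in> carrier M" "n0 \<notin> L" "primeideal (colon R M L n0) R"
    using prime_colon_exists[OF noeth Ls(1)] by blast
  define L' where "L' = {r \<odot>\<^bsub>M\<^esub> n0 \<oplus>\<^bsub>M\<^esub> k | r k. r \<in> carrier R \<and> k \<in> L}"
  have L': "submodule L' R M" and LL': "L \<subseteq> L'" and "n0 \<in> L'"
    unfolding L'_def using adjoin_element[OF Ls(1) n0(1)] by blast+
  then have "L' \<notin> Q" using L(2) L' Ls LL' n0 by (auto simp: submodule_order_def)
  then have full: "L' = carrier M" using L' LL' Ls by (auto simp: Q_def)
  have "colon R M L n0 \<subseteq> annihilator_mod R M L"
  proof
    fix p assume p: "p \<in> colon R M L n0"
    have "p \<odot>\<^bsub>M\<^esub> m \<in> L" if "m \<in> carrier M" for m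
    proof -
      have "m \<in> L'" using full that by simp
      then obtain r k where rk: "m = r \<odot>\<^bsub>M\<^esub> n0 \<oplus>\<^bsub>M\<^esub> k" "r \<in> carrier R" "k \<in> L"
        unfolding L'_def by blast
      have "p \<odot>\<^bsub>M\<^esub> m = r \<odot>\<^bsub>M\<^esub> (p \<odot>\<^bsub>M\<^esub> n0) \<oplus>\<^bsub>M\<^esub> p \<odot>\<^bsub>M\<^esub> k"
        using rk p n0 Lc by (simp add: colon_def smult_r_distr smult_commute)
      then show ?thesis using rk p Lc by (simp add: colon_def)
    qed
    then show "p \<in> annihilator_mod R M L" using p by (simp add: annihilator_mod_def colon_def)
  qed
  moreover have "annihilator_mod R M K \<subseteq> colon R M L n0"
    using n0 Ls by (auto simp: annihilator_mod_def colon_def)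
  ultimately show ?thesis using n0 Ls by blast
qed

end

section \<open>Prime avoidance\<close>

context cring
begin

text \<open>A product with one factor from each of the other primes. It avoids \<open>P\<close> because \<open>P\<close> is prime.\<close>

lemma subring_element_in_primes:
  assumes "finite \<P>" and U: "subring U R"
    and P: "primeideal P R" and q: "q \<in> U" "q \<notin> P"
    and \<P>: "\<And>P'. P' \<in> \<P> \<Longrightarrow> primeideal P' R \<and> \<not> U \<inter> P' \<subseteq> P"
  shows "\<exists>u \<in> U. u \<notin> P \<and> (\<forall>P' \<in> \<P>. u \<in> P')"
  using assms(1) \<P>
proof (induction \<P> rule: finite_induct)
  case empty
  then show ?case using q by blast
next
  case (insert P' \<P>)
  then obtain u where u: "u \<in> U" "u \<notin> P" "\<forall>P' \<in> \<P>. u \<in> P'" by auto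
  obtain v where v: "v \<in> U" "v \<in> P'" "v \<notin> P" using insert.prems by blast
  note Uc = subringE(1)[OF U] subringE(6)[OF U]
  have "u \<otimes> v \<notin> P" using primeideal.I_prime[OF P, of u v] u v Uc by blast
  moreover have "u \<otimes> v \<in> P''" if "P'' \<in> insert P' \<P>" for P''
  proof -
    have "ideal P'' R" using insert.prems that primeideal.axioms(1) by blast
    then show ?thesis
      using that u v Uc ideal.I_l_closed[of P'' R v u] ideal.I_r_closed[of P'' R u v] by blast
  qed
  ultimately show ?case using Uc u v by blast
qed

text \<open>Avoidance by elements of a subring \<open>U\<close>, inside the coset of \<open>y\<close> modulo an ideal \<open>Q\<close> of \<open>U\<close>: it is
  ordinary coset avoidance in \<open>U\<close> for the contracted primes. The associated primes to be
  avoided live in the larger ring, whereas the element has to lie in \<open>U\<close>, where it also acts on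
  \<open>U\<close>-submodules.\<close>

lemma coset_prime_avoidance:
  assumes "finite \<P>" and U: "subring U R"
    and Q: "Q \<subseteq> U" "\<zero> \<in> Q" "\<And>a b. a \<in> Q \<Longrightarrow> b \<in> Q \<Longrightarrow> a \<oplus> b \<in> Q"
      "\<And>u a. u \<in> U \<Longrightarrow> a \<in> Q \<Longrightarrow> u \<otimes> a \<in> Q"
    and y: "y \<in> U"
    and \<P>: "\<And>P. P \<in> \<P> \<Longrightarrow> primeideal P R \<and> (y \<notin> P \<or> \<not> Q \<subseteq> P)"
  shows "\<exists>c \<in> Q. \<forall>P \<in> \<P>. y \<oplus> c \<notin> P"
  using assms(1) \<P>
proof (induction "card \<P>" arbitrary: \<P>)
  case 0
  then show ?case using Q by auto
next
  case (Suc n)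
  note Uc = subringE(1)[OF U] subringE(6,7)[OF U]
  (* P has a minimal contraction, so that some element of U lies in all the other primes but not in P *)
  obtain P where P: "P \<in> \<P>" and min: "\<And>P'. P' \<in> \<P> \<Longrightarrow> U \<inter> P' \<subseteq> U \<inter> P \<Longrightarrow> U \<inter> P' = U \<inter> P"
  proof -
    have fin: "finite ((\<lambda>P. U \<inter> P) ` \<P>)" using Suc.prems(1) by simp
    have ne: "(\<lambda>P. U \<inter> P) ` \<P> \<noteq> {}" using Suc.hyps(2) by auto
    obtain m where m: "m \<in> (\<lambda>P. U \<inter> P) ` \<P>" "\<forall>b \<in> (\<lambda>P. U \<inter> P) ` \<P>. b \<subseteq> m \<longrightarrow> m = b"
      using finite_has_minimal[OF fin ne] by blast
    from m(1) obtain P where P: "m = U \<inter> P" "P \<in> \<P>" by (rule imageE)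
    show thesis
    proof (rule that[OF P(2)])
      fix P' assume "P' \<in> \<P>" "U \<inter> P' \<subseteq> U \<inter> P"
      then show "U \<inter> P' = U \<inter> P" using m(2)[rule_format, of "U \<inter> P'"] P(1) by simp
    qed
  qed
  have Pp: "primeideal P R" using Suc.prems(2) P by blast
  interpret P: ideal P R using Pp primeideal.axioms(1) by blast
  have "n = card (\<P> - {P})" using Suc.hyps(2) Suc.prems(1) P by simp
  then obtain c where c: "c \<in> Q" "\<forall>P' \<in> \<P> - {P}. y \<oplus> c \<notin> P'"
    using Suc.hyps(1)[of "\<P> - {P}"] Suc.prems by auto
  show ?case
  proof (cases "y \<oplus> c \<in> P")
    case False
    then show ?thesis using c by (intro bexI[of _ c]) auto
  next
    case True
    have ycU: "y \<in> carrier R" "c \<in> carrier R" "y \<oplus> c \<in> U" using y c Q(1) Uc by auto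
    have "\<not> Q \<subseteq> P"
    proof
      assume sub: "Q \<subseteq> P"
      then have "y = (y \<oplus> c) \<ominus> c" using ycU by (simp add: minus_eq a_assoc r_neg)
      also have "\<dots> \<in> P" using True c sub by (simp add: minus_eq subsetD)
      finally show False using sub Suc.prems(2) P by blast
    qed
    then obtain q where q: "q \<in> Q" "q \<notin> P" by blast
    have "\<not> U \<inter> P' \<subseteq> P" if "P' \<in> \<P> - {P}" for P'
    proof
      assume "U \<inter> P' \<subseteq> P"
      then have "U \<inter> P' = U \<inter> P" using min[of P'] that by blast
      then show False using c that True ycU by blast
    qed
    then obtain u where u: "u \<in> U" "u \<notin> P" "\<forall>P' \<in> \<P> - {P}. u \<in> P'"
      using subring_element_in_primes[OF _ U Pp, of "\<P> - {P}" q] q Q(1) Suc.prems by blast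
    have uqc: "u \<in> carrier R" "q \<in> carrier R" "u \<otimes> q \<in> Q" using u q Q Uc by auto
    have cQ: "c \<oplus> u \<otimes> q \<in> Q" using c uqc Q by simp
    have eq: "y \<oplus> (c \<oplus> u \<otimes> q) = (y \<oplus> c) \<oplus> u \<otimes> q" using ycU uqc by (simp add: a_assoc)
    have cancel: "a \<in> I" if "ideal I R" "b \<in> I" "a \<oplus> b \<in> I" "a \<in> carrier R" for I a b
    proof -
      interpret I: ideal I R by fact
      have bc: "b \<in> carrier R" using that I.a_Hcarr by blast
      then have "a = (a \<oplus> b) \<ominus> b" using that by (simp add: minus_eq a_assoc r_neg)
      also have "\<dots> \<in> I" using that bc by (simp add: minus_eq)
      finally show ?thesis .
    qed
    have "y \<oplus> (c \<oplus> u \<otimes> q) \<notin> P'" if P': "P' \<in> \<P>" for P'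
    proof (cases "P' = P")
      case True
      have "u \<otimes> q \<notin> P" using primeideal.I_prime[OF Pp] uqc u q by blast
      moreover have "y \<oplus> (c \<oplus> u \<otimes> q) = u \<otimes> q \<oplus> (y \<oplus> c)"
        using eq ycU uqc by (simp add: a_comm)
      ultimately show ?thesis
        using \<open>y \<oplus> c \<in> P\<close> cancel[OF P.is_ideal, of "y \<oplus> c" "u \<otimes> q"] uqc True by auto
    next
      case False
      have id: "ideal P' R" using Suc.prems(2) P' primeideal.axioms(1) by blast
      then have "u \<otimes> q \<in> P'" using u uqc False P' ideal.I_r_closed[of P' R u q] by blast
      then have "y \<oplus> c \<in> P'" if "(y \<oplus> c) \<oplus> u \<otimes> q \<in> P'" using cancel[OF id _ that] ycU by simp
      then show ?thesis using c False P' eq by auto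
    qed
    then show ?thesis using cQ by blast
  qed
qed

end

text \<open>The recursion displays the span of the tail. When the head generator \<open>z\<close> is replaced by a suitable
  element of its coset \<open>z + span\<close>, the tail remains available for the later steps.\<close>

fun span_over :: "('a, 'c) ring_scheme \<Rightarrow> 'a set \<Rightarrow> 'a list \<Rightarrow> 'a set" where
  "span_over R U [] = {\<zero>\<^bsub>R\<^esub>}"
| "span_over R U (z # zs) = {u \<otimes>\<^bsub>R\<^esub> z \<oplus>\<^bsub>R\<^esub> c | u c. u \<in> U \<and> c \<in> span_over R U zs}"

context cring
begin

lemma span_over_properties:
  assumes U: "subring U R" and zs: "set zs \<subseteq> U"
  shows span_over_subset: "span_over R U zs \<subseteq> U"
    and span_over_zero: "\<zero> \<in> span_over R U zs"
    and span_over_add: "a \<in> span_over R U zs \<Longrightarrow> b \<in> span_over R U zs \<Longrightarrow> a \<oplus> b \<in> span_over R U zs"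
    and span_over_mult: "u \<in> U \<Longrightarrow> a \<in> span_over R U zs \<Longrightarrow> u \<otimes> a \<in> span_over R U zs"
    and span_over_superset: "set zs \<subseteq> span_over R U zs"
proof -
  note Uc = subringE(1,2,3,6,7)[OF U]
  have "span_over R U zs \<subseteq> U \<and> \<zero> \<in> span_over R U zs \<and>
     (\<forall>a b. a \<in> span_over R U zs \<longrightarrow> b \<in> span_over R U zs \<longrightarrow> a \<oplus> b \<in> span_over R U zs) \<and>
     (\<forall>u a. u \<in> U \<longrightarrow> a \<in> span_over R U zs \<longrightarrow> u \<otimes> a \<in> span_over R U zs) \<and>
     set zs \<subseteq> span_over R U zs"
    using zs
  proof (induction zs)
    case Nil
    then show ?case using Uc by (auto simp: subset_eq)
  next
    case (Cons z zs)
    let ?V = "span_over R U zs" and ?W = "span_over R U (z # zs)"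
    have IH: "?V \<subseteq> U" "\<zero> \<in> ?V" "\<And>a b. a \<in> ?V \<Longrightarrow> b \<in> ?V \<Longrightarrow> a \<oplus> b \<in> ?V"
      "\<And>u a. u \<in> U \<Longrightarrow> a \<in> ?V \<Longrightarrow> u \<otimes> a \<in> ?V" "set zs \<subseteq> ?V" and z: "z \<in> U"
      using Cons by auto
    have carr: "\<And>x. x \<in> U \<Longrightarrow> x \<in> carrier R" "\<And>x. x \<in> ?V \<Longrightarrow> x \<in> carrier R" using Uc IH by auto
    have memI: "u \<otimes> z \<oplus> c \<in> ?W" if "u \<in> U" "c \<in> ?V" for u c using that by auto
    have V_W: "c \<in> ?W" if "c \<in> ?V" for c
      using memI[of \<zero> c] that carr z subringE(2)[OF U] by simp
    show ?case
    proof (intro conjI allI impI)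
      show "?W \<subseteq> U" using z IH Uc by auto
      show "\<zero> \<in> ?W" using V_W IH by blast
      have "z \<in> ?W" using memI[of \<one> \<zero>] IH carr z subringE(3)[OF U] by simp
      then show "set (z # zs) \<subseteq> ?W" using V_W IH by (simp only: list.set) blast
      fix a b assume "a \<in> ?W" "b \<in> ?W"
      then obtain u c u' c' where uc: "a = u \<otimes> z \<oplus> c" "b = u' \<otimes> z \<oplus> c'"
        "u \<in> U" "u' \<in> U" "c \<in> ?V" "c' \<in> ?V" by auto
      have "a \<oplus> b = (u \<oplus> u') \<otimes> z \<oplus> (c \<oplus> c')" using uc carr z by (simp add: l_distr a_ac)
      then show "a \<oplus> b \<in> ?W" using memI uc IH Uc by simp
    next
      fix v a assume v: "v \<in> U" and "a \<in> ?W"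
      then obtain u c where uc: "a = u \<otimes> z \<oplus> c" "u \<in> U" "c \<in> ?V" by auto
      have "v \<otimes> a = (v \<otimes> u) \<otimes> z \<oplus> v \<otimes> c" using uc carr z v by (simp add: r_distr m_assoc)
      then show "v \<otimes> a \<in> ?W" using memI uc IH Uc v by simp
    qed
  qed
  then show "span_over R U zs \<subseteq> U" "\<zero> \<in> span_over R U zs"
    "a \<in> span_over R U zs \<Longrightarrow> b \<in> span_over R U zs \<Longrightarrow> a \<oplus> b \<in> span_over R U zs"
    "u \<in> U \<Longrightarrow> a \<in> span_over R U zs \<Longrightarrow> u \<otimes> a \<in> span_over R U zs"
    "set zs \<subseteq> span_over R U zs" by blast+
qed

lemma span_over_least:
  assumes "U \<subseteq> carrier R" "ideal P R" "set zs \<subseteq> P"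
  shows "span_over R U zs \<subseteq> P"
  using assms(3)
proof (induction zs)
  interpret P: ideal P R by fact
  case Nil
  show ?case by simp
next
  interpret P: ideal P R by fact
  case (Cons z zs)
  then have "\<And>c. c \<in> span_over R U zs \<Longrightarrow> c \<in> P" "z \<in> P" by auto
  then show ?case using assms(1) P.I_l_closed by auto
qed

end

section \<open>Replacing regular sequences\<close>

context module
begin

text \<open>If \<open>x n = y m\<close> modulo \<open>K\<close>, then \<open>y m \<in> K + x M\<close> gives \<open>m = x m'\<close> modulo \<open>K\<close>, and cancelling \<open>x\<close>
  gives \<open>n = y m'\<close> modulo \<open>K\<close>.\<close>

lemma nonzerodivisor_mod_exchange:
  assumes K: "submodule K R M" and x: "x \<in> carrier R" and y: "y \<in> carrier R"
    and xK: "nonzerodivisor_mod M K x" and yx: "nonzerodivisor_mod M (cut M K x) y"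
  shows "nonzerodivisor_mod M (cut M K y) x"
proof (unfold nonzerodivisor_mod_def, intro ballI impI)
  note Kc = submodule_subset[OF K] submoduleE(3,4,5)[OF K]
  fix n assume n: "n \<in> carrier M" "x \<odot>\<^bsub>M\<^esub> n \<in> cut M K y"
  then obtain k m where km: "x \<odot>\<^bsub>M\<^esub> n = k \<oplus>\<^bsub>M\<^esub> y \<odot>\<^bsub>M\<^esub> m" "k \<in> K" "m \<in> carrier M"
    by (auto simp: cut_def)
  have Kx: "submodule (cut M K x) R M" using submodule_cut K x by blast
  have "k \<oplus>\<^bsub>M\<^esub> y \<odot>\<^bsub>M\<^esub> m \<in> cut M K x" using smult_in_cut[OF K x n(1)] km by simp
  then have "y \<odot>\<^bsub>M\<^esub> m \<in> cut M K x"
    using submodule_cancel[OF Kx] km y subset_cut[OF K x] by (meson smult_closed subsetD)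
  then have "m \<in> cut M K x" using yx km by (simp add: nonzerodivisor_mod_def)
  then obtain k' m' where km': "m = k' \<oplus>\<^bsub>M\<^esub> x \<odot>\<^bsub>M\<^esub> m'" "k' \<in> K" "m' \<in> carrier M"
    by (auto simp: cut_def)
  let ?d = "n \<ominus>\<^bsub>M\<^esub> y \<odot>\<^bsub>M\<^esub> m'"
  have "y \<odot>\<^bsub>M\<^esub> m = y \<odot>\<^bsub>M\<^esub> k' \<oplus>\<^bsub>M\<^esub> x \<odot>\<^bsub>M\<^esub> (y \<odot>\<^bsub>M\<^esub> m')"
    using km' x y Kc by (simp add: smult_r_distr smult_commute)
  then have "x \<odot>\<^bsub>M\<^esub> n = (k \<oplus>\<^bsub>M\<^esub> y \<odot>\<^bsub>M\<^esub> k') \<oplus>\<^bsub>M\<^esub> x \<odot>\<^bsub>M\<^esub> (y \<odot>\<^bsub>M\<^esub> m')"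
    using km km' x y Kc by (simp add: M.a_assoc)
  then have "x \<odot>\<^bsub>M\<^esub> ?d = k \<oplus>\<^bsub>M\<^esub> y \<odot>\<^bsub>M\<^esub> k'"
    using km km' x y Kc n by (simp add: M.minus_eq smult_r_distr smult_r_minus M.a_assoc M.r_neg)
  then have "x \<odot>\<^bsub>M\<^esub> ?d \<in> K" using km km' y Kc by simp
  then have "?d \<in> K" using xK n km' y by (simp add: nonzerodivisor_mod_def)
  moreover have "n = ?d \<oplus>\<^bsub>M\<^esub> y \<odot>\<^bsub>M\<^esub> m'"
    using n km' y by (simp add: M.minus_eq M.a_assoc M.l_neg)
  ultimately show "n \<in> cut M K y" using km' unfolding cut_def by blast
qed

text \<open>Moving \<open>y\<close> from the end to the front of \<open>x\<^sub>1, \<dots>, x\<^sub>k\<^sub>-\<^sub>1, y\<close>, one transposition at a time.\<close>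

lemma weakly_regular_exchange:
  assumes "submodule K R M" "set xs \<subseteq> carrier R" "y \<in> carrier R"
    "weakly_regular M K xs" "nonzerodivisor_along M K xs y"
  shows "weakly_regular M (cut M K y) (butlast xs)"
  using assms
proof (induction xs arbitrary: K)
  case (Cons x xs)
  show ?case
  proof (cases "xs = []")
    case False
    then have yx: "nonzerodivisor_mod M (cut M K x) y"
      using Cons.prems by (cases xs) auto
    have "weakly_regular M (cut M (cut M K x) y) (butlast xs)"
      using Cons.IH[of "cut M K x"] Cons.prems submodule_cut by auto
    then show ?thesis
      using False nonzerodivisor_mod_exchange[of K x y] yx Cons.prems cut_commute[of K x y] by auto
  qed simp
qed simp

text \<open>The associated primes of the successive quotients. Such a prime misses the next entry of \<open>xs\<close>.\<close>

lemma primes_along: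
  assumes noeth: "noetherian_module R M"
  shows "submodule K R M \<Longrightarrow> set xs \<subseteq> carrier R \<Longrightarrow> weakly_regular M K xs \<Longrightarrow>
    \<exists>\<P>. finite \<P> \<and>
      (\<forall>P \<in> \<P>. primeideal P R \<and> annihilator_mod R M K \<subseteq> P \<and> \<not> set xs \<subseteq> P) \<and>
      (\<forall>y \<in> carrier R. (\<forall>P \<in> \<P>. y \<notin> P) \<longrightarrow> nonzerodivisor_along M K xs y)"
proof (induction xs arbitrary: K)
  case Nil
  then show ?case by (intro exI[of _ "{}"]) simp
next
  case (Cons x xs)
  have sub: "submodule (cut M K x) R M" using Cons.prems submodule_cut by auto
  have ann: "annihilator_mod R M K \<subseteq> annihilator_mod R M (cut M K x)"
    using subset_cut[of K x] Cons.prems by (auto simp: annihilator_mod_def)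
  have "set xs \<subseteq> carrier R" "weakly_regular M (cut M K x) xs" using Cons.prems by auto
  from Cons.IH[OF sub this] obtain \<P> where fin: "finite \<P>"
    and prime: "\<forall>P \<in> \<P>. primeideal P R \<and> annihilator_mod R M (cut M K x) \<subseteq> P \<and> \<not> set xs \<subseteq> P"
    and along: "\<forall>y \<in> carrier R. (\<forall>P \<in> \<P>. y \<notin> P) \<longrightarrow> nonzerodivisor_along M (cut M K x) xs y"
    by (elim exE conjE)
  show ?case
  proof (intro exI[of _ "associated_primes R M K \<union> \<P>"] conjI ballI impI)
    show "finite (associated_primes R M K \<union> \<P>)"
      using fin finite_associated_primes[OF noeth] Cons.prems by simp
    fix P assume "P \<in> associated_primes R M K \<union> \<P>"
    then consider "P \<in> associated_primes R M K" | "P \<in> \<P>" by blast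
    then have "primeideal P R \<and> annihilator_mod R M K \<subseteq> P \<and> \<not> set (x # xs) \<subseteq> P"
    proof cases
      case 1
      then have "primeideal P R" by (simp add: associated_primes_def)
      moreover have "x \<notin> P" using associated_prime_avoids[OF 1, of x] Cons.prems by simp
      ultimately show ?thesis using annihilator_subset_associated_prime[OF 1] by simp
    next
      case 2
      then show ?thesis using prime ann by auto
    qed
    then show "primeideal P R" "annihilator_mod R M K \<subseteq> P" "\<not> set (x # xs) \<subseteq> P" by blast+
  next
    fix y assume y: "y \<in> carrier R" "\<forall>P \<in> associated_primes R M K \<union> \<P>. y \<notin> P"
    then have "nonzerodivisor_mod M K y"
      using nonzerodivisor_modI[OF noeth Cons.prems(1), of y] by blast
    then show "nonzerodivisor_along M K (x # xs) y" using along y by simp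
  qed
qed

text \<open>The exchange principle. The condition on primes says that \<open>xs\<close> lies in the radical of the ideal generated
  by \<open>zs\<close> and the annihilator of \<open>M/K\<close>. It passes to \<open>K + y M\<close> and the tail of \<open>zs\<close> when \<open>y\<close> is
  congruent to the head \<open>z\<close> modulo the tail, since a prime containing \<open>y\<close> and the tail contains \<open>z\<close>. When \<open>zs\<close> is used
  up and \<open>xs\<close> is not, the next entry of \<open>xs\<close> is a nonzerodivisor lying in every associated prime of \<open>M/K\<close>,
  so \<open>M/K = 0\<close>; the new sequence is then padded with zeros.\<close>

theorem weakly_regular_replacement:
  assumes noeth: "noetherian_module R M" and U: "subring U R"
  shows "submodule K R M \<Longrightarrow> set zs \<subseteq> U \<Longrightarrow> set xs \<subseteq> carrier R \<Longrightarrow> weakly_regular M K xs \<Longrightarrow>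
    (\<And>P. primeideal P R \<Longrightarrow> annihilator_mod R M K \<subseteq> P \<Longrightarrow> set zs \<subseteq> P \<Longrightarrow> set xs \<subseteq> P) \<Longrightarrow>
    \<exists>ys. set ys \<subseteq> span_over R U zs \<and> length ys = length xs \<and> weakly_regular M K ys \<and>
      (length zs < length xs \<longrightarrow> foldl (cut M) K ys = carrier M)"
proof (induction zs arbitrary: K xs)
  case Nil
  show ?case
  proof (cases xs)
    case Nil
    then show ?thesis by simp
  next
    case (Cons x xs')
    note K = Nil.prems(1)
    have "K = carrier M"
    proof (rule ccontr)
      assume "K \<noteq> carrier M"
      then obtain n where n: "n \<in> carrier M" "n \<notin> K" using submodule_subset[OF K] by blast
      then obtain n' where n': "n' \<in> carrier M" "n' \<notin> K" "primeideal (colon R M K n') R"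
        using prime_colon_exists[OF noeth K] by blast
      then have P: "colon R M K n' \<in> associated_primes R M K" by (auto simp: associated_primes_def)
      then have "set xs \<subseteq> colon R M K n'"
        using Nil.prems(5) n' annihilator_subset_associated_prime by simp
      then show False using associated_prime_avoids[OF P, of x] Cons Nil.prems by auto
    qed
    have cut0: "cut M (carrier M) \<zero> = carrier M"
      using submodule_subset[OF submodule_cut[OF carrier_is_submodule, of \<zero>]]
        subset_cut[OF carrier_is_submodule, of \<zero>] by auto
    have "weakly_regular M (carrier M) (replicate n \<zero>) \<and>
        foldl (cut M) (carrier M) (replicate n \<zero>) = carrier M" for n
      by (induction n) (auto simp: nonzerodivisor_mod_def cut0)
    then show ?thesis using \<open>K = carrier M\<close>
      by (intro exI[of _ "replicate (length xs) \<zero>"]) auto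
  qed
next
  case (Cons z zs)
  note K = Cons.prems(1)
  have zU: "z \<in> U" "set zs \<subseteq> U" using Cons.prems by auto
  note Uc = subringE(1,6,7)[OF U]
  note S = span_over_properties[OF U zU(2)]
  show ?case
  proof (cases "xs = []")
    case True
    then show ?thesis by simp
  next
    case xs: False
    from primes_along[OF noeth K Cons.prems(3,4)] obtain \<P> where \<P>: "finite \<P>"
      "\<forall>P \<in> \<P>. primeideal P R \<and> annihilator_mod R M K \<subseteq> P \<and> \<not> set xs \<subseteq> P"
      "\<forall>y \<in> carrier R. (\<forall>P \<in> \<P>. y \<notin> P) \<longrightarrow> nonzerodivisor_along M K xs y"
      by (elim exE conjE)
    have "\<exists>c \<in> span_over R U zs. \<forall>P \<in> \<P>. z \<oplus> c \<notin> P"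
    proof (rule R.coset_prime_avoidance[OF \<P>(1) U S(1,2)])
      fix P assume P: "P \<in> \<P>"
      have "z \<notin> P \<or> \<not> span_over R U zs \<subseteq> P"
      proof (rule ccontr)
        assume "\<not> ?thesis"
        then have "set (z # zs) \<subseteq> P" using S(5) by auto
        then show False using Cons.prems(5)[of P] \<P>(2) P by blast
      qed
      then show "primeideal P R \<and> (z \<notin> P \<or> \<not> span_over R U zs \<subseteq> P)" using \<P>(2) P by blast
    qed (use S zU in auto)
    then obtain c where c: "c \<in> span_over R U zs" "\<forall>P \<in> \<P>. z \<oplus> c \<notin> P" by blast
    let ?y = "z \<oplus> c"
    have cU: "c \<in> U" using c S by blast
    have carr: "z \<in> carrier R" "c \<in> carrier R" "?y \<in> carrier R" using cU zU Uc by auto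
    have along: "nonzerodivisor_along M K xs ?y" using \<P>(3) c carr by blast
    then have yK: "nonzerodivisor_mod M K ?y" using xs by (cases xs) auto
    let ?K = "cut M K ?y"
    have K': "submodule ?K R M" using submodule_cut K carr by blast
    have yann: "?y \<in> annihilator_mod R M ?K"
      using carr smult_in_cut[OF K] by (simp add: annihilator_mod_def)
    have "\<exists>ys. set ys \<subseteq> span_over R U zs \<and> length ys = length (butlast xs) \<and> weakly_regular M ?K ys \<and>
      (length zs < length (butlast xs) \<longrightarrow> foldl (cut M) ?K ys = carrier M)"
    proof (rule Cons.IH[OF K' zU(2)])
      show "set (butlast xs) \<subseteq> carrier R" using Cons.prems(3) by (meson in_set_butlastD subset_eq)
      show "weakly_regular M ?K (butlast xs)"
        using weakly_regular_exchange[OF K Cons.prems(3) carr(3) Cons.prems(4) along] .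
      fix P assume P: "primeideal P R" "annihilator_mod R M ?K \<subseteq> P" "set zs \<subseteq> P"
      interpret P: ideal P R using P(1) primeideal.axioms(1) by blast
      have "c \<in> P" using R.span_over_least[OF Uc(1) P.is_ideal P(3)] c by blast
      moreover have "?y \<in> P" using yann P by blast
      ultimately have "?y \<ominus> c \<in> P" by (simp add: R.minus_eq)
      moreover have "?y \<ominus> c = z" using carr by (simp add: R.minus_eq R.a_assoc R.r_neg)
      ultimately have "set (z # zs) \<subseteq> P" using P by simp
      moreover have "annihilator_mod R M K \<subseteq> annihilator_mod R M ?K"
        using subset_cut[OF K carr(3)] by (auto simp: annihilator_mod_def)
      ultimately have "set xs \<subseteq> P" using Cons.prems(5) P by blast
      then show "set (butlast xs) \<subseteq> P" by (meson in_set_butlastD subset_eq)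
    qed
    then obtain ys where ys: "set ys \<subseteq> span_over R U zs" "length ys = length (butlast xs)"
      "weakly_regular M ?K ys" "length zs < length (butlast xs) \<Longrightarrow> foldl (cut M) ?K ys = carrier M"
      by blast
    have "\<And>d. d \<in> span_over R U zs \<Longrightarrow> d \<in> span_over R U (z # zs)"
    proof -
      fix d assume "d \<in> span_over R U zs"
      moreover from this have "d = \<zero> \<otimes> z \<oplus> d" using carr S(1) Uc by (simp add: subset_eq)
      ultimately show "d \<in> span_over R U (z # zs)" using subringE(2)[OF U] by auto
    qed
    moreover have "?y \<in> span_over R U (z # zs)"
    proof -
      have "?y = \<one> \<otimes> z \<oplus> c" using carr by simp
      then show ?thesis using c(1) subringE(3)[OF U] unfolding span_over.simps by blast
    qed
    ultimately show ?thesis using ys yK xs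
      by (intro exI[of _ "?y # ys"]) auto
  qed
qed

end

section \<open>Finite sums\<close>

text \<open>Sums of elements of \<open>W\<close> with no reference to the carrier of \<open>G\<close>. Replacing the carrier, which is how the Veronese
  transforms arise, leaves them unchanged.\<close>

inductive_set fsums :: "('b, 'd) ring_scheme \<Rightarrow> 'b set \<Rightarrow> 'b set" for G and W where
  zero: "\<zero>\<^bsub>G\<^esub> \<in> fsums G W"
| add: "w \<in> W \<Longrightarrow> x \<in> fsums G W \<Longrightarrow> w \<oplus>\<^bsub>G\<^esub> x \<in> fsums G W"

lemma fsums_least:
  assumes "\<zero>\<^bsub>G\<^esub> \<in> H" "\<And>w x. w \<in> W \<Longrightarrow> x \<in> H \<Longrightarrow> w \<oplus>\<^bsub>G\<^esub> x \<in> H"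
  shows "fsums G W \<subseteq> H"
proof
  fix x assume "x \<in> fsums G W"
  then show "x \<in> H" by induction (use assms in auto)
qed

lemma fsums_mono: "W \<subseteq> W' \<Longrightarrow> fsums G W \<subseteq> fsums G W'"
  by (rule fsums_least) (auto intro: fsums.intros)

context abelian_monoid
begin

lemma fsums_subset_carrier: "W \<subseteq> carrier G \<Longrightarrow> fsums G W \<subseteq> carrier G"
  by (rule fsums_least) auto

lemma fsums_incl:
  assumes "W \<subseteq> carrier G"
  shows "W \<subseteq> fsums G W"
proof
  fix w assume "w \<in> W"
  then have "w \<oplus> \<zero> \<in> fsums G W" by (intro fsums.intros)
  then show "w \<in> fsums G W" using \<open>w \<in> W\<close> assms by auto
qed

lemma fsums_closed:
  assumes W: "W \<subseteq> carrier G" and "x \<in> fsums G W" and y: "y \<in> fsums G W"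
  shows "x \<oplus> y \<in> fsums G W"
  using assms(2)
proof induction
  case zero
  then show ?case using y fsums_subset_carrier[OF W] by auto
next
  case (add w x)
  have "(w \<oplus> x) \<oplus> y = w \<oplus> (x \<oplus> y)"
    using add.hyps y fsums_subset_carrier[OF W] W by (intro a_assoc) auto
  then show ?case using add.IH add.hyps by (simp add: fsums.intros)
qed

end

context module
begin

lemma submodule_fsums:
  assumes W: "W \<subseteq> carrier M" and smult: "\<And>r w. r \<in> carrier R \<Longrightarrow> w \<in> W \<Longrightarrow> r \<odot>\<^bsub>M\<^esub> w \<in> W"
  shows "submodule (fsums M W) R M"
proof (rule submoduleI)
  note sc = M.fsums_subset_carrier[OF W]
  have sm: "r \<odot>\<^bsub>M\<^esub> x \<in> fsums M W" if r: "r \<in> carrier R" and x: "x \<in> fsums M W" for r x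
    using x
  proof induction
    case zero
    then show ?case using r by (simp add: fsums.intros)
  next
    case (add w x)
    have "r \<odot>\<^bsub>M\<^esub> (w \<oplus>\<^bsub>M\<^esub> x) = r \<odot>\<^bsub>M\<^esub> w \<oplus>\<^bsub>M\<^esub> r \<odot>\<^bsub>M\<^esub> x"
      using r add.hyps W sc by (intro smult_r_distr) auto
    then show ?case using add smult[OF r] by (simp add: fsums.intros)
  qed
  show "fsums M W \<subseteq> carrier M" by (rule sc)
  show "\<zero>\<^bsub>M\<^esub> \<in> fsums M W" by (rule fsums.zero)
  show "a \<oplus>\<^bsub>M\<^esub> b \<in> fsums M W" if "a \<in> fsums M W" "b \<in> fsums M W" for a b
    using M.fsums_closed[OF W that] .
  show "r \<odot>\<^bsub>M\<^esub> x \<in> fsums M W" if "r \<in> carrier R" "x \<in> fsums M W" for r x using sm that .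
  show "\<ominus>\<^bsub>M\<^esub> a \<in> fsums M W" if "a \<in> fsums M W" for a
  proof -
    have "(\<ominus> \<one>) \<odot>\<^bsub>M\<^esub> a \<in> fsums M W" using sm that by simp
    moreover have "(\<ominus> \<one>) \<odot>\<^bsub>M\<^esub> a = \<ominus>\<^bsub>M\<^esub> a" using smult_l_minus[of \<one> a] that sc by auto
    ultimately show ?thesis by simp
  qed
qed

end

section \<open>Noetherian modules\<close>

lemma (in noetherian_ring) wf_ideals: "wf {(J, I). ideal J R \<and> ideal I R \<and> I \<subset> J}" (is "wf ?r")
proof -
  have "\<not> (\<exists>f. \<forall>i. (f (Suc i), f i) \<in> ?r)"
  proof
    assume "\<exists>f. \<forall>i. (f (Suc i), f i) \<in> ?r"
    then obtain f where "\<forall>i. (f (Suc i), f i) \<in> ?r" by blast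
    then have f: "\<And>i. ideal (f i) R" "\<And>i. f i \<subset> f (Suc i)" by auto
    have mono: "f i \<subseteq> f j" if "i \<le> j" for i j
      using lift_Suc_mono_le[of f i j, OF psubset_imp_subset[OF f(2)] that] .
    have "subset.chain {I. ideal I R} (range f)"
      unfolding subset_chain_def
    proof (intro conjI ballI)
      show "range f \<subseteq> {I. ideal I R}" using f(1) by blast
      fix I J assume "I \<in> range f" "J \<in> range f"
      then obtain i j where "I = f i" "J = f j" by blast
      then show "I \<subseteq> J \<or> J \<subseteq> I" using mono nat_le_linear[of i j] by blast
    qed
    then have "\<Union>(range f) \<in> range f"
      using ideal_chain_is_trivial[of "range f"] by blast
    then obtain k where "\<Union>(range f) = f k" by blast
    then show False using f(2)[of k] by blast
  qed
  then show ?thesis by (simp add: wf_iff_no_infinite_down_chain)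
qed

context module
begin

text \<open>Comparable submodules \<open>K\<close> of \<open>R b + V\<close> coincide if they have the same intersection with \<open>V\<close> and the same
  ideal of leading coefficients, which are the \<open>r\<close> with \<open>r b \<in> K + V\<close>. So the lexicographic order on these
  pairs is well-founded along strict inclusions.\<close>

lemma noetherian_step:
  assumes wfI: "wf {(J, I). ideal J R \<and> ideal I R \<and> I \<subset> J}"
    and V: "submodule V R M" and b: "b \<in> carrier M"
    and wfV: "wf {(L, K). submodule L R M \<and> submodule K R M \<and> K \<subset> L \<and> L \<subseteq> V}"
  shows "wf {(L, K). submodule L R M \<and> submodule K R M \<and> K \<subset> L \<and>
           L \<subseteq> {r \<odot>\<^bsub>M\<^esub> b \<oplus>\<^bsub>M\<^esub> v | r v. r \<in> carrier R \<and> v \<in> V}}" (is "wf ?r")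
proof -
  define C where "C K = {r \<in> carrier R. \<exists>v \<in> V. r \<odot>\<^bsub>M\<^esub> b \<oplus>\<^bsub>M\<^esub> v \<in> K}" for K
  note Vc = submodule_subset[OF V] submoduleE(3,4,5)[OF V]
  have C_ideal: "ideal (C K) R" if K: "submodule K R M" for K
  proof -
    let ?KV = "{k \<oplus>\<^bsub>M\<^esub> v | k v. k \<in> K \<and> v \<in> V}"
    note Kc = submodule_subset[OF K] submoduleE(3,4,5)[OF K]
    have "submodule ?KV R M"
    proof (rule submoduleI)
      show "?KV \<subseteq> carrier M" using Kc Vc by auto
      have "\<zero>\<^bsub>M\<^esub> = \<zero>\<^bsub>M\<^esub> \<oplus>\<^bsub>M\<^esub> \<zero>\<^bsub>M\<^esub>" by simp
      then show "\<zero>\<^bsub>M\<^esub> \<in> ?KV" using submodule_zero[OF K] submodule_zero[OF V] by blast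
      fix x assume "x \<in> ?KV"
      then obtain k v where x: "x = k \<oplus>\<^bsub>M\<^esub> v" "k \<in> K" "v \<in> V" by blast
      have "\<ominus>\<^bsub>M\<^esub> x = \<ominus>\<^bsub>M\<^esub> k \<oplus>\<^bsub>M\<^esub> \<ominus>\<^bsub>M\<^esub> v" using x Kc Vc by (simp add: M.minus_add)
      moreover have "\<ominus>\<^bsub>M\<^esub> k \<in> K" "\<ominus>\<^bsub>M\<^esub> v \<in> V" using x Kc Vc by auto
      ultimately show "\<ominus>\<^bsub>M\<^esub> x \<in> ?KV" by blast
      fix y assume "y \<in> ?KV"
      then obtain k' v' where y: "y = k' \<oplus>\<^bsub>M\<^esub> v'" "k' \<in> K" "v' \<in> V" by blast
      have "x \<oplus>\<^bsub>M\<^esub> y = (k \<oplus>\<^bsub>M\<^esub> k') \<oplus>\<^bsub>M\<^esub> (v \<oplus>\<^bsub>M\<^esub> v')" using x y Kc Vc by (simp add: M.a_ac)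
      moreover have "k \<oplus>\<^bsub>M\<^esub> k' \<in> K" "v \<oplus>\<^bsub>M\<^esub> v' \<in> V" using x y Kc Vc by auto
      ultimately show "x \<oplus>\<^bsub>M\<^esub> y \<in> ?KV" by blast
    next
      fix r x assume r: "r \<in> carrier R" and "x \<in> ?KV"
      then obtain k v where x: "x = k \<oplus>\<^bsub>M\<^esub> v" "k \<in> K" "v \<in> V" by blast
      have "r \<odot>\<^bsub>M\<^esub> x = r \<odot>\<^bsub>M\<^esub> k \<oplus>\<^bsub>M\<^esub> r \<odot>\<^bsub>M\<^esub> v" using x Kc Vc r by (simp add: smult_r_distr)
      moreover have "r \<odot>\<^bsub>M\<^esub> k \<in> K" "r \<odot>\<^bsub>M\<^esub> v \<in> V" using x Kc Vc r by auto
      ultimately show "r \<odot>\<^bsub>M\<^esub> x \<in> ?KV" by blast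
    qed
    moreover have "C K = colon R M ?KV b"
    proof -
      have "(\<exists>v \<in> V. y \<oplus>\<^bsub>M\<^esub> v \<in> K) \<longleftrightarrow> y \<in> ?KV" if y: "y \<in> carrier M" for y
      proof
        assume "\<exists>v \<in> V. y \<oplus>\<^bsub>M\<^esub> v \<in> K"
        then obtain v where v: "v \<in> V" "y \<oplus>\<^bsub>M\<^esub> v \<in> K" by blast
        have "y = (y \<oplus>\<^bsub>M\<^esub> v) \<oplus>\<^bsub>M\<^esub> \<ominus>\<^bsub>M\<^esub> v" using y v Vc by (simp add: M.a_assoc M.r_neg)
        moreover have "\<ominus>\<^bsub>M\<^esub> v \<in> V" using v Vc by blast
        ultimately show "y \<in> ?KV" using v by blast
      next
        assume "y \<in> ?KV"
        then obtain k v where kv: "y = k \<oplus>\<^bsub>M\<^esub> v" "k \<in> K" "v \<in> V" by blast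
        then have "y \<oplus>\<^bsub>M\<^esub> \<ominus>\<^bsub>M\<^esub> v = k" using Kc Vc by (simp add: M.a_assoc M.r_neg)
        moreover have "\<ominus>\<^bsub>M\<^esub> v \<in> V" using kv Vc by blast
        ultimately show "\<exists>v \<in> V. y \<oplus>\<^bsub>M\<^esub> v \<in> K" using kv by metis
      qed
      note memb = this[OF smult_closed[OF _ b]]
      show ?thesis unfolding C_def colon_def using memb by (intro Collect_cong conj_cong refl)
    qed
    ultimately show ?thesis using colon_ideal b by simp
  qed
  have inter: "submodule (K \<inter> V) R M" if K: "submodule K R M" for K
    using submoduleE[OF K] submoduleE[OF V] submodule_zero[OF K] submodule_zero[OF V]
    by (intro submoduleI) auto
  let ?s = "{(L, K). submodule L R M \<and> submodule K R M \<and> K \<subset> L \<and> L \<subseteq> V} <*lex*>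
      {(J, I). ideal J R \<and> ideal I R \<and> I \<subset> J}"
  have "?r \<subseteq> inv_image ?s (\<lambda>K. (K \<inter> V, C K))"
  proof (rule subrelI)
    fix L K assume "(L, K) \<in> ?r"
    then have L: "submodule L R M" and K: "submodule K R M" and KL: "K \<subset> L"
      and LV: "\<And>x. x \<in> L \<Longrightarrow> \<exists>r v. x = r \<odot>\<^bsub>M\<^esub> b \<oplus>\<^bsub>M\<^esub> v \<and> r \<in> carrier R \<and> v \<in> V" by auto
    note Lc = submodule_subset[OF L] submoduleE(3,4,5)[OF L]
    have CC: "C K \<subseteq> C L" using KL by (auto simp: C_def)
    have "K \<inter> V \<subset> L \<inter> V \<or> K \<inter> V = L \<inter> V \<and> C K \<subset> C L"
    proof (rule ccontr)
      assume "\<not> ?thesis"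
      then have eq: "K \<inter> V = L \<inter> V" "C K = C L" using KL CC by auto
      have "L \<subseteq> K"
      proof
        fix x assume x: "x \<in> L"
        then obtain r v where rv: "x = r \<odot>\<^bsub>M\<^esub> b \<oplus>\<^bsub>M\<^esub> v" "r \<in> carrier R" "v \<in> V" using LV by blast
        then have "r \<in> C K" using x eq(2) by (auto simp: C_def)
        then obtain w where w: "w \<in> V" "r \<odot>\<^bsub>M\<^esub> b \<oplus>\<^bsub>M\<^esub> w \<in> K" by (auto simp: C_def)
        let ?d = "v \<oplus>\<^bsub>M\<^esub> \<ominus>\<^bsub>M\<^esub> w"
        have wV: "\<ominus>\<^bsub>M\<^esub> w \<in> V" using w Vc by blast
        have wc: "v \<in> carrier M" "w \<in> carrier M" "r \<odot>\<^bsub>M\<^esub> b \<in> carrier M" using rv w Vc b by auto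
        have xe: "x = (r \<odot>\<^bsub>M\<^esub> b \<oplus>\<^bsub>M\<^esub> w) \<oplus>\<^bsub>M\<^esub> ?d"
        proof -
          have "(r \<odot>\<^bsub>M\<^esub> b \<oplus>\<^bsub>M\<^esub> w) \<oplus>\<^bsub>M\<^esub> ?d = r \<odot>\<^bsub>M\<^esub> b \<oplus>\<^bsub>M\<^esub> (v \<oplus>\<^bsub>M\<^esub> (w \<oplus>\<^bsub>M\<^esub> \<ominus>\<^bsub>M\<^esub> w))"
            using wc by (simp only: M.a_ac M.a_inv_closed M.a_closed)
          then show ?thesis using wc rv by (simp add: M.r_neg)
        qed
        have "?d \<in> L" using submodule_cancel[OF L _ _ x[unfolded xe]] w KL wc by auto
        moreover have "?d \<in> V" using rv wV Vc by blast
        ultimately have "?d \<in> K" using eq by blast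
        then show "x \<in> K" using xe w submoduleE(5)[OF K] by simp
      qed
      then show False using KL by blast
    qed
    then show "(L, K) \<in> inv_image ?s (\<lambda>K. (K \<inter> V, C K))"
      using inter[OF L] inter[OF K] C_ideal[OF L] C_ideal[OF K] by auto
  qed
  then show ?thesis using wf_subset[OF wf_inv_image[OF wf_lex_prod[OF wfV wfI]]] by blast
qed

lemma noetherian_module_if_fin_gen:
  assumes "noetherian_ring R" and fg: "fin_gen_module R M"
  shows "noetherian_module R M"
proof -
  have "\<exists>V. submodule V R M \<and> B \<subseteq> V \<and>
      wf {(L, K). submodule L R M \<and> submodule K R M \<and> K \<subset> L \<and> L \<subseteq> V}"
    if "finite B" "B \<subseteq> carrier M" for B
    using that
  proof (induction B rule: finite_induct)
    case empty
    have no: "\<not> (K \<subset> L \<and> L \<subseteq> {\<zero>\<^bsub>M\<^esub>})" if "submodule K R M" for K L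
      using submodule_zero[OF that] by blast
    have eq: "{(L, K). submodule L R M \<and> submodule K R M \<and> K \<subset> L \<and> L \<subseteq> {\<zero>\<^bsub>M\<^esub>}} = {}"
      using no by blast
    have "wf {(L, K). submodule L R M \<and> submodule K R M \<and> K \<subset> L \<and> L \<subseteq> {\<zero>\<^bsub>M\<^esub>}}"
      unfolding eq by (simp add: wf_def)
    then show ?case using zero_submodule by (intro exI[of _ "{\<zero>\<^bsub>M\<^esub>}"]) simp
  next
    case (insert b B)
    then obtain V where V: "submodule V R M" "B \<subseteq> V"
      "wf {(L, K). submodule L R M \<and> submodule K R M \<and> K \<subset> L \<and> L \<subseteq> V}" by auto
    have b: "b \<in> carrier M" using insert.prems by simp
    let ?V = "{r \<odot>\<^bsub>M\<^esub> b \<oplus>\<^bsub>M\<^esub> v | r v. r \<in> carrier R \<and> v \<in> V}"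
    have "submodule ?V R M" "insert b B \<subseteq> ?V" using adjoin_element[OF V(1) b] V(2) by auto
    then show ?case
      using noetherian_step[OF noetherian_ring.wf_ideals[OF assms(1)] V(1) b V(3)] by (intro exI[of _ ?V]) simp
  qed
  moreover obtain B where B: "finite B" "B \<subseteq> carrier M" "generated_submodule R M B = carrier M"
    using fg by (auto simp: fin_gen_module_def)
  ultimately obtain V where V: "submodule V R M" "B \<subseteq> V"
    "wf {(L, K). submodule L R M \<and> submodule K R M \<and> K \<subset> L \<and> L \<subseteq> V}" by meson
  have "carrier M \<subseteq> V" using B(3) V by (auto simp: generated_submodule_def)
  then show ?thesis
    unfolding noetherian_module_def submodule_order_def
    using submoduleE(1) by (intro wf_subset[OF V(3)]) blast
qed

end

lemma direct_sum_unique: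
  assumes M: "abelian_group M" and N: "abelian_group (M\<lparr>carrier := N\<rparr>)" "N \<subseteq> carrier M"
    and V: "V \<subseteq> carrier M" "N \<inter> V \<subseteq> {\<zero>\<^bsub>M\<^esub>}"
    and x: "x \<in> N" "x = k \<oplus>\<^bsub>M\<^esub> v" "k \<in> N" "v \<in> V"
  shows "x = k"
proof -
  interpret M: abelian_group M by fact
  interpret N: abelian_group "M\<lparr>carrier := N\<rparr>" by fact
  let ?N = "M\<lparr>carrier := N\<rparr>"
  have neg: "\<ominus>\<^bsub>?N\<^esub> k \<oplus>\<^bsub>M\<^esub> k = \<zero>\<^bsub>M\<^esub>" using N.l_neg[of k] x by simp
  have nk: "\<ominus>\<^bsub>?N\<^esub> k \<in> N" using N.a_inv_closed[of k] x by simp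
  have carr: "k \<in> carrier M" "v \<in> carrier M" "\<ominus>\<^bsub>?N\<^esub> k \<in> carrier M"
    using x N(2) V nk by auto
  have "\<ominus>\<^bsub>?N\<^esub> k \<oplus>\<^bsub>M\<^esub> x = (\<ominus>\<^bsub>?N\<^esub> k \<oplus>\<^bsub>M\<^esub> k) \<oplus>\<^bsub>M\<^esub> v"
    using x carr by (simp add: M.a_assoc)
  then have "\<ominus>\<^bsub>?N\<^esub> k \<oplus>\<^bsub>M\<^esub> x = v" using neg carr by simp
  moreover have "\<ominus>\<^bsub>?N\<^esub> k \<oplus>\<^bsub>M\<^esub> x \<in> N" using N.a_closed[of "\<ominus>\<^bsub>?N\<^esub> k" x] nk x by simp
  ultimately have "v = \<zero>\<^bsub>M\<^esub>" using V(2) x by blast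
  then show ?thesis using x carr by simp
qed

text \<open>Extension \<open>K \<mapsto> S K\<close> followed by intersection with \<open>N\<close> is the identity on \<open>R\<close>-submodules of \<open>N\<close>: splitting
  the coefficients along \<open>S = R + C\<close> changes an element of \<open>S K\<close> only by an element of \<open>K\<close> and one of \<open>V\<close>,
  and \<open>V\<close> meets \<open>N\<close> trivially. Hence extension is strictly monotone.\<close>

lemma noetherian_retract:
  fixes S :: "('a, 'c) ring_scheme" and M :: "('a, 'b, 'd) module_scheme"
  assumes M: "module S M" and noeth: "noetherian_module S M"
    and RN: "module (S\<lparr>carrier := R\<rparr>) (M\<lparr>carrier := N\<rparr>)" and N: "N \<subseteq> carrier M"
    and decomp: "\<And>s. s \<in> carrier S \<Longrightarrow> \<exists>r \<in> R. \<exists>c \<in> C. s = r \<oplus>\<^bsub>S\<^esub> c"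
    and C: "R \<subseteq> carrier S" "C \<subseteq> carrier S" "\<And>c n. c \<in> C \<Longrightarrow> n \<in> N \<Longrightarrow> c \<odot>\<^bsub>M\<^esub> n \<in> V"
    and V: "subgroup V (add_monoid M)" "N \<inter> V \<subseteq> {\<zero>\<^bsub>M\<^esub>}"
  shows "noetherian_module (S\<lparr>carrier := R\<rparr>) (M\<lparr>carrier := N\<rparr>)"
proof -
  interpret module S M by fact
  interpret N: module "S\<lparr>carrier := R\<rparr>" "M\<lparr>carrier := N\<rparr>" by fact
  let ?R = "S\<lparr>carrier := R\<rparr>" and ?N = "M\<lparr>carrier := N\<rparr>"
  define E where "E K = fsums M {s \<odot>\<^bsub>M\<^esub> k | s k. s \<in> carrier S \<and> k \<in> K}" for K
  have V0: "\<zero>\<^bsub>M\<^esub> \<in> V" using subgroup.one_closed[OF V(1)] by simp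
  have Vadd: "v \<oplus>\<^bsub>M\<^esub> w \<in> V" if "v \<in> V" "w \<in> V" for v w
    using subgroup.m_closed[OF V(1)] that by simp
  have Vc: "v \<in> carrier M" if "v \<in> V" for v using subgroup.subset[OF V(1)] that by auto
  have E_sub: "submodule (E K) S M" if "K \<subseteq> carrier M" for K
    unfolding E_def
  proof (rule submodule_fsums)
    show "{s \<odot>\<^bsub>M\<^esub> k | s k. s \<in> carrier S \<and> k \<in> K} \<subseteq> carrier M" using that by auto
    fix r w assume "r \<in> carrier S" "w \<in> {s \<odot>\<^bsub>M\<^esub> k | s k. s \<in> carrier S \<and> k \<in> K}"
    then obtain s k where sk: "w = s \<odot>\<^bsub>M\<^esub> k" "s \<in> carrier S" "k \<in> K" "r \<in> carrier S" by blast
    then have "r \<odot>\<^bsub>M\<^esub> w = (r \<otimes>\<^bsub>S\<^esub> s) \<odot>\<^bsub>M\<^esub> k" using that by (simp add: smult_assoc1 subset_eq)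
    moreover have "r \<otimes>\<^bsub>S\<^esub> s \<in> carrier S" using sk by simp
    ultimately show "r \<odot>\<^bsub>M\<^esub> w \<in> {s \<odot>\<^bsub>M\<^esub> k | s k. s \<in> carrier S \<and> k \<in> K}" using sk by blast
  qed
  have E_contract: "E K \<inter> N = K" if K: "submodule K ?R ?N" for K
  proof
    have KN: "K \<subseteq> N" using N.submoduleE(1)[OF K] by simp
    have "E K \<subseteq> {k \<oplus>\<^bsub>M\<^esub> v | k v. k \<in> K \<and> v \<in> V}" (is "_ \<subseteq> ?H")
      unfolding E_def
    proof (rule fsums_least)
      have "\<zero>\<^bsub>M\<^esub> \<in> K" using N.submodule_zero[OF K] by simp
      moreover have "\<zero>\<^bsub>M\<^esub> = \<zero>\<^bsub>M\<^esub> \<oplus>\<^bsub>M\<^esub> \<zero>\<^bsub>M\<^esub>" by simp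
      ultimately show "\<zero>\<^bsub>M\<^esub> \<in> ?H" using V0 by blast
      fix w x assume "w \<in> {s \<odot>\<^bsub>M\<^esub> k | s k. s \<in> carrier S \<and> k \<in> K}" "x \<in> ?H"
      then obtain s k k' v where w: "w = s \<odot>\<^bsub>M\<^esub> k" "s \<in> carrier S" "k \<in> K"
        and x: "x = k' \<oplus>\<^bsub>M\<^esub> v" "k' \<in> K" "v \<in> V" by blast
      obtain r c where rc: "s = r \<oplus>\<^bsub>S\<^esub> c" "r \<in> R" "c \<in> C" using decomp w by blast
      have carr: "k \<in> carrier M" "k' \<in> carrier M" "v \<in> carrier M" "r \<in> carrier S" "c \<in> carrier S"
        using w x rc KN N C Vc by auto
      have "w \<oplus>\<^bsub>M\<^esub> x = (r \<odot>\<^bsub>M\<^esub> k \<oplus>\<^bsub>M\<^esub> k') \<oplus>\<^bsub>M\<^esub> (c \<odot>\<^bsub>M\<^esub> k \<oplus>\<^bsub>M\<^esub> v)"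
        using w x rc carr by (simp add: smult_l_distr M.a_ac)
      moreover have "r \<odot>\<^bsub>M\<^esub> k \<oplus>\<^bsub>M\<^esub> k' \<in> K"
        using N.submoduleE(4)[OF K, of r k] N.submoduleE(5)[OF K] rc w x by simp
      moreover have "c \<odot>\<^bsub>M\<^esub> k \<oplus>\<^bsub>M\<^esub> v \<in> V" using Vadd C(3) rc w x KN by blast
      ultimately show "w \<oplus>\<^bsub>M\<^esub> x \<in> ?H" by blast
    qed
    moreover have "x \<in> K" if "x \<in> N" "x = k \<oplus>\<^bsub>M\<^esub> v" "k \<in> K" "v \<in> V" for x k v
      using direct_sum_unique[OF M.abelian_group_axioms N.M.abelian_group_axioms N _ V(2) that(1,2)]
        that(3,4) KN Vc by blast
    ultimately show "E K \<inter> N \<subseteq> K" by blast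
    show "K \<subseteq> E K \<inter> N"
    proof
      fix k assume k: "k \<in> K"
      have "{s \<odot>\<^bsub>M\<^esub> k | s k. s \<in> carrier S \<and> k \<in> K} \<subseteq> E K"
        unfolding E_def using KN N by (intro M.fsums_incl) auto
      moreover have "k = \<one>\<^bsub>S\<^esub> \<odot>\<^bsub>M\<^esub> k" using k KN N by auto
      ultimately have "k \<in> E K" using k R.one_closed by blast
      then show "k \<in> E K \<inter> N" using k KN by blast
    qed
  qed
  have "submodule_order ?R ?N \<subseteq> inv_image (submodule_order S M) E"
  proof (rule subrelI)
    fix L K assume "(L, K) \<in> submodule_order ?R ?N"
    then have LK: "submodule L ?R ?N" "submodule K ?R ?N" "K \<subset> L" by (auto simp: submodule_order_def)
    have "L \<subseteq> carrier M" "K \<subseteq> carrier M" using N.submoduleE(1) LK N by force+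
    moreover have "E K \<subseteq> E L" unfolding E_def using LK by (intro fsums_mono) blast
    moreover have "E K \<noteq> E L" using E_contract[OF LK(1)] E_contract[OF LK(2)] LK(3) by blast
    ultimately show "(L, K) \<in> inv_image (submodule_order S M) E"
      using E_sub by (auto simp: submodule_order_def)
  qed
  then show ?thesis
    using noeth wf_subset[OF wf_inv_image] unfolding noetherian_module_def by blast
qed

section \<open>Comparing depths\<close>

context module
begin

lemma submodule_generated:
  assumes "W \<subseteq> carrier M"
  shows "submodule (generated_submodule R M W) R M"
  unfolding generated_submodule_def
proof (rule submoduleI)
  let ?F = "{N. submodule N R M \<and> W \<subseteq> N}"
  show "\<Inter>?F \<subseteq> carrier M" using carrier_is_submodule assms by blast
  show "\<zero>\<^bsub>M\<^esub> \<in> \<Inter>?F" using submodule_zero by blast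
  show "\<ominus>\<^bsub>M\<^esub> a \<in> \<Inter>?F" if "a \<in> \<Inter>?F" for a using that submoduleE(3) by blast
  show "a \<oplus>\<^bsub>M\<^esub> b \<in> \<Inter>?F" if "a \<in> \<Inter>?F" "b \<in> \<Inter>?F" for a b using that submoduleE(5) by blast
  show "r \<odot>\<^bsub>M\<^esub> a \<in> \<Inter>?F" if "r \<in> carrier R" "a \<in> \<Inter>?F" for r a using that submoduleE(4) by blast
qed

lemma submodule_ideal_smult:
  assumes "I \<subseteq> carrier R"
  shows "submodule (ideal_smult R M I) R M"
  unfolding ideal_smult_def using assms by (intro submodule_generated) auto

lemma smult_in_ideal_smult: "x \<in> I \<Longrightarrow> m \<in> carrier M \<Longrightarrow> x \<odot>\<^bsub>M\<^esub> m \<in> ideal_smult R M I"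
  unfolding ideal_smult_def generated_submodule_def by blast

lemma ideal_smult_least:
  "submodule L R M \<Longrightarrow> (\<And>x m. x \<in> I \<Longrightarrow> m \<in> carrier M \<Longrightarrow> x \<odot>\<^bsub>M\<^esub> m \<in> L) \<Longrightarrow> ideal_smult R M I \<subseteq> L"
  unfolding ideal_smult_def generated_submodule_def by blast

lemma ideal_smult_genideal:
  assumes xs: "set xs \<subseteq> carrier R"
  shows "ideal_smult R M (genideal R (set xs)) = foldl (cut M) {\<zero>\<^bsub>M\<^esub>} xs"
proof
  let ?K = "foldl (cut M) {\<zero>\<^bsub>M\<^esub>} xs"
  have K: "submodule ?K R M" using submodule_foldl_cut zero_submodule xs by blast
  have "set xs \<subseteq> annihilator_mod R M ?K"
    using smult_in_foldl_cut[OF zero_submodule xs] xs by (auto simp: annihilator_mod_def)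
  then have "genideal R (set xs) \<subseteq> annihilator_mod R M ?K"
    using R.genideal_minimal annihilator_ideal K by blast
  then show "ideal_smult R M (genideal R (set xs)) \<subseteq> ?K"
    by (intro ideal_smult_least[OF K]) (auto simp: annihilator_mod_def)
  have sub: "submodule (ideal_smult R M (genideal R (set xs))) R M"
    by (rule submodule_ideal_smult) (use ideal.Icarr[OF R.genideal_ideal[OF xs]] in blast)
  show "?K \<subseteq> ideal_smult R M (genideal R (set xs))"
  proof (rule foldl_cut_least[OF sub])
    show "{\<zero>\<^bsub>M\<^esub>} \<subseteq> ideal_smult R M (genideal R (set xs))" using submodule_zero[OF sub] by blast
    show "x \<odot>\<^bsub>M\<^esub> m \<in> ideal_smult R M (genideal R (set xs))" if "x \<in> set xs" "m \<in> carrier M" for x m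
      using smult_in_ideal_smult[of x _ m] R.genideal_self[OF xs] that by blast
  qed
qed

lemma regular_sequence_iff:
  "regular_sequence R M xs \<longleftrightarrow> set xs \<subseteq> carrier R \<and> weakly_regular M {\<zero>\<^bsub>M\<^esub>} xs \<and>
     foldl (cut M) {\<zero>\<^bsub>M\<^esub>} xs \<noteq> carrier M"
proof (cases "set xs \<subseteq> carrier R")
  case True
  have "set (take i xs) \<subseteq> carrier R" for i using True set_take_subset by fast
  then show ?thesis
    unfolding regular_sequence_def weakly_regular_iff_nth nonzerodivisor_mod_def
    using True by (simp add: ideal_smult_genideal)
qed (simp add: regular_sequence_def)

lemma foldl_cut_subset_ideal_smult:
  assumes "I \<subseteq> carrier R" "set ys \<subseteq> I"
  shows "foldl (cut M) {\<zero>\<^bsub>M\<^esub>} ys \<subseteq> ideal_smult R M I"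
proof (rule foldl_cut_least)
  show sub: "submodule (ideal_smult R M I) R M" by (rule submodule_ideal_smult) fact
  show "{\<zero>\<^bsub>M\<^esub>} \<subseteq> ideal_smult R M I" using submodule_zero[OF sub] by blast
qed (use assms smult_in_ideal_smult in blast)

text \<open>With \<open>zs\<close> generating \<open>I\<close> up to radical, a regular sequence in \<open>I\<close> longer than \<open>zs\<close> can be replaced by
  elements \<open>ys\<close> of \<open>I\<close> with \<open>(ys) M = M\<close>, which is impossible when \<open>I M \<noteq> M\<close>.\<close>

theorem depth_le_number_of_generators:
  assumes noeth: "noetherian_module R M" and I: "ideal I R" and zs: "set zs \<subseteq> I"
    and radical: "\<And>P. primeideal P R \<Longrightarrow> set zs \<subseteq> P \<Longrightarrow> I \<subseteq> P"
  shows "depth R I M = \<infinity> \<or> depth R I M \<le> enat (length zs)"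
proof (cases "ideal_smult R M I = carrier M")
  case True
  then show ?thesis by (simp add: depth_def)
next
  case False
  interpret I: ideal I R by fact
  have Ic: "I \<subseteq> carrier R" using I.Icarr by blast
  have "enat (length xs) \<le> enat (length zs)"
    if "regular_sequence R M xs" "set xs \<subseteq> I" for xs
  proof (rule ccontr)
    assume "\<not> ?thesis"
    then have len: "length zs < length xs" by simp
    have xs: "set xs \<subseteq> carrier R" "weakly_regular M {\<zero>\<^bsub>M\<^esub>} xs"
      using that regular_sequence_iff by auto
    have "set xs \<subseteq> P" if "primeideal P R" "set zs \<subseteq> P" for P
      using radical[OF that] \<open>set xs \<subseteq> I\<close> by blast
    then obtain ys where ys: "set ys \<subseteq> span_over R (carrier R) zs"
      "foldl (cut M) {\<zero>\<^bsub>M\<^esub>} ys = carrier M"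
      using weakly_regular_replacement[OF noeth R.carrier_is_subring zero_submodule _ xs, of zs]
        len zs Ic by blast
    have "set ys \<subseteq> I" using ys R.span_over_least[OF _ I zs, of "carrier R"] by blast
    then have "carrier M \<subseteq> ideal_smult R M I"
      using foldl_cut_subset_ideal_smult[OF Ic] ys by metis
    then show False using False submodule_subset[OF submodule_ideal_smult[OF Ic]] by blast
  qed
  then have "depth R I M \<le> enat (length zs)"
    using False by (simp add: depth_def SUP_le_iff)
  then show ?thesis by blast
qed

end

text \<open>The submodules \<open>K'\<close> of \<open>N\<close> and \<open>K\<close> of \<open>M = N \<oplus> V\<close> that are cut out by the same elements of \<open>U\<close> satisfy
  \<open>K' \<subseteq> K \<subseteq> K' + V\<close>, and therefore \<open>K \<inter> N = K'\<close>. The induction carries the inclusions along.\<close>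

lemma weakly_regular_summand:
  fixes M :: "('a, 'b, 'd) module_scheme"
  assumes M: "module R M" and N: "abelian_group (M\<lparr>carrier := N\<rparr>)" "N \<subseteq> carrier M"
    and smultN: "\<And>y n. y \<in> U \<Longrightarrow> n \<in> N \<Longrightarrow> y \<odot>\<^bsub>M\<^esub> n \<in> N"
    and V: "subgroup V (add_monoid M)" "N \<inter> V \<subseteq> {\<zero>\<^bsub>M\<^esub>}"
      "\<And>y v. y \<in> U \<Longrightarrow> v \<in> V \<Longrightarrow> y \<odot>\<^bsub>M\<^esub> v \<in> V"
    and decomp: "\<And>m. m \<in> carrier M \<Longrightarrow> \<exists>n \<in> N. \<exists>v \<in> V. m = n \<oplus>\<^bsub>M\<^esub> v"
    and U: "U \<subseteq> carrier R"
  shows "set ys \<subseteq> U \<Longrightarrow> weakly_regular M K ys \<Longrightarrow> K' \<subseteq> N \<Longrightarrow> K' \<subseteq> K \<Longrightarrow>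
      K \<subseteq> {k \<oplus>\<^bsub>M\<^esub> v | k v. k \<in> K' \<and> v \<in> V} \<Longrightarrow>
    weakly_regular (M\<lparr>carrier := N\<rparr>) K' ys"
proof (induction ys arbitrary: K K')
  case Nil
  show ?case by simp
next
  case (Cons y ys)
  interpret module R M by fact
  interpret N: abelian_group "M\<lparr>carrier := N\<rparr>" by fact
  let ?N = "M\<lparr>carrier := N\<rparr>"
  have Vc: "v \<in> carrier M" if "v \<in> V" for v using subgroup.subset[OF V(1)] that by auto
  have Vadd: "v \<oplus>\<^bsub>M\<^esub> w \<in> V" if "v \<in> V" "w \<in> V" for v w
    using subgroup.m_closed[OF V(1)] that by simp
  have y: "y \<in> U" "y \<in> carrier R" using Cons.prems U by auto
  have "nonzerodivisor_mod ?N K' y"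
  proof (unfold nonzerodivisor_mod_def, intro ballI impI)
    fix n assume "n \<in> carrier ?N" and yn: "y \<odot>\<^bsub>?N\<^esub> n \<in> K'"
    then have n: "n \<in> N" "n \<in> carrier M" using N by auto
    have "y \<odot>\<^bsub>M\<^esub> n \<in> K" using yn Cons.prems(4) by auto
    then have "n \<in> K" using Cons.prems(2) n by (simp add: nonzerodivisor_mod_def)
    then obtain k v where kv: "n = k \<oplus>\<^bsub>M\<^esub> v" "k \<in> K'" "v \<in> V" using Cons.prems(5) by blast
    then have "n = k"
      using direct_sum_unique[OF M.abelian_group_axioms N _ V(2) n(1) kv(1)] Cons.prems(3) Vc by blast
    then show "n \<in> K'" using kv by simp
  qed
  moreover have "weakly_regular ?N (cut ?N K' y) ys"
  proof (rule Cons.IH)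
    show "set ys \<subseteq> U" "weakly_regular M (cut M K y) ys" using Cons.prems by auto
    have "k \<oplus>\<^bsub>M\<^esub> y \<odot>\<^bsub>M\<^esub> n \<in> N" if "k \<in> K'" "n \<in> N" for k n
      using N.a_closed[of k "y \<odot>\<^bsub>M\<^esub> n"] smultN[OF y(1) that(2)] that(1) Cons.prems(3) by auto
    then show "cut ?N K' y \<subseteq> N" by (auto simp: cut_def)
    show "cut ?N K' y \<subseteq> cut M K y" using Cons.prems(4) N(2) by (auto simp: cut_def)
    show "cut M K y \<subseteq> {k \<oplus>\<^bsub>M\<^esub> v | k v. k \<in> cut ?N K' y \<and> v \<in> V}"
    proof
      fix x assume "x \<in> cut M K y"
      then obtain k m where km: "x = k \<oplus>\<^bsub>M\<^esub> y \<odot>\<^bsub>M\<^esub> m" "k \<in> K" "m \<in> carrier M"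
        by (auto simp: cut_def)
      obtain k' v where k: "k = k' \<oplus>\<^bsub>M\<^esub> v" "k' \<in> K'" "v \<in> V" using Cons.prems(5) km by blast
      obtain n w where m: "m = n \<oplus>\<^bsub>M\<^esub> w" "n \<in> N" "w \<in> V" using decomp km by blast
      have carr: "k' \<in> carrier M" "v \<in> carrier M" "n \<in> carrier M" "w \<in> carrier M"
        using k m Vc N(2) Cons.prems(3) by auto
      have "x = (k' \<oplus>\<^bsub>M\<^esub> y \<odot>\<^bsub>M\<^esub> n) \<oplus>\<^bsub>M\<^esub> (v \<oplus>\<^bsub>M\<^esub> y \<odot>\<^bsub>M\<^esub> w)"
        using km k m carr y by (simp add: smult_r_distr M.a_ac)
      moreover have "v \<oplus>\<^bsub>M\<^esub> y \<odot>\<^bsub>M\<^esub> w \<in> V" using Vadd V(3) y k m by blast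
      moreover have "k' \<oplus>\<^bsub>M\<^esub> y \<odot>\<^bsub>M\<^esub> n \<in> cut ?N K' y" using k m by (auto simp: cut_def)
      ultimately show "x \<in> {k \<oplus>\<^bsub>M\<^esub> v | k v. k \<in> cut ?N K' y \<and> v \<in> V}" by blast
    qed
  qed
  ultimately show ?case by simp
qed

text \<open>The depth over \<open>R\<close> is first realised by a sequence in the contracted ideal \<open>J\<close>, which then restricts to the
  summand \<open>N\<close>. If \<open>J N = N\<close>, the right hand side is infinite. Otherwise \<open>J M \<noteq> M\<close> because \<open>N\<close> is
  a summand, and then \<open>I M \<noteq> M\<close> because some prime above \<open>J\<close>, which then contains \<open>I\<close>,
  annihilates a nonzero quotient of \<open>M\<close>.\<close>

theorem depth_le_depth_summand:
  fixes R :: "('a, 'c) ring_scheme" and M :: "('a, 'b, 'd) module_scheme"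
  assumes M: "module R M" and noeth: "noetherian_module R M" and I: "I \<subseteq> carrier R"
    and U: "subring U R" and UN: "module (R\<lparr>carrier := U\<rparr>) (M\<lparr>carrier := N\<rparr>)" "N \<subseteq> carrier M"
    and V: "subgroup V (add_monoid M)" "N \<inter> V \<subseteq> {\<zero>\<^bsub>M\<^esub>}"
      "\<And>u v. u \<in> U \<Longrightarrow> v \<in> V \<Longrightarrow> u \<odot>\<^bsub>M\<^esub> v \<in> V"
    and decomp: "\<And>m. m \<in> carrier M \<Longrightarrow> \<exists>n \<in> N. \<exists>v \<in> V. m = n \<oplus>\<^bsub>M\<^esub> v"
    and J: "ideal J (R\<lparr>carrier := U\<rparr>)" and zs: "set zs \<subseteq> J"
    and radical: "\<And>P. primeideal P R \<Longrightarrow> set zs \<subseteq> P \<Longrightarrow> I \<subseteq> P"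
  shows "depth R I M \<le> depth (R\<lparr>carrier := U\<rparr>) J (M\<lparr>carrier := N\<rparr>)"
proof -
  let ?R = "R\<lparr>carrier := U\<rparr>" and ?N = "M\<lparr>carrier := N\<rparr>"
  interpret module R M by fact
  interpret N: module ?R ?N by fact
  interpret J: ideal J ?R by fact
  have JU: "J \<subseteq> U" using J.Icarr by auto
  have Uc: "U \<subseteq> carrier R" using subringE(1)[OF U] .
  have smultN: "y \<odot>\<^bsub>M\<^esub> n \<in> N" if "y \<in> U" "n \<in> N" for y n
    using N.smult_closed[of y n] that by simp
  have Vc: "v \<in> carrier M" if "v \<in> V" for v using subgroup.subset[OF V(1)] that by auto
  have V0: "\<zero>\<^bsub>M\<^esub> \<in> V" using subgroup.one_closed[OF V(1)] by simp
  have Vadd: "v \<oplus>\<^bsub>M\<^esub> w \<in> V" if "v \<in> V" "w \<in> V" for v w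
    using subgroup.m_closed[OF V(1)] that by simp
  show ?thesis
  proof (cases "ideal_smult ?R ?N J = N")
    case True
    then show ?thesis by (simp add: depth_def)
  next
    case False
    have Jsub: "submodule (ideal_smult ?R ?N J) ?R ?N" using N.submodule_ideal_smult JU by simp
    (* the sums over W form the submodule J M; it is compared with J N along the decomposition of M *)
    define W where "W = {x \<odot>\<^bsub>M\<^esub> m | x m. x \<in> J \<and> m \<in> carrier M}"
    have K: "submodule (fsums M W) R M"
    proof (rule submodule_fsums)
      show "W \<subseteq> carrier M" using JU Uc by (auto simp: W_def)
      fix r w assume "r \<in> carrier R" "w \<in> W"
      then obtain x m where xm: "r \<in> carrier R" "w = x \<odot>\<^bsub>M\<^esub> m" "x \<in> J" "m \<in> carrier M"
        by (auto simp: W_def)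
      then have "r \<odot>\<^bsub>M\<^esub> w = x \<odot>\<^bsub>M\<^esub> (r \<odot>\<^bsub>M\<^esub> m)" using JU Uc smult_commute[of r x m] by auto
      then show "r \<odot>\<^bsub>M\<^esub> w \<in> W" unfolding W_def using xm smult_closed by blast
    qed
    have WK: "W \<subseteq> fsums M W" using JU Uc by (intro M.fsums_incl) (auto simp: W_def)
    have "fsums M W \<subseteq> {k \<oplus>\<^bsub>M\<^esub> v | k v. k \<in> ideal_smult ?R ?N J \<and> v \<in> V}" (is "_ \<subseteq> ?H")
    proof (rule fsums_least)
      have "\<zero>\<^bsub>M\<^esub> \<in> ideal_smult ?R ?N J" using N.submodule_zero[OF Jsub] by simp
      moreover have "\<zero>\<^bsub>M\<^esub> = \<zero>\<^bsub>M\<^esub> \<oplus>\<^bsub>M\<^esub> \<zero>\<^bsub>M\<^esub>" by simp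
      ultimately show "\<zero>\<^bsub>M\<^esub> \<in> ?H" using V0 by blast
      fix w h assume "w \<in> W" "h \<in> ?H"
      then obtain x m k v where w: "w = x \<odot>\<^bsub>M\<^esub> m" "x \<in> J" "m \<in> carrier M"
        and h: "h = k \<oplus>\<^bsub>M\<^esub> v" "k \<in> ideal_smult ?R ?N J" "v \<in> V" by (auto simp: W_def)
      obtain n u where m: "m = n \<oplus>\<^bsub>M\<^esub> u" "n \<in> N" "u \<in> V" using decomp w by blast
      have kN: "k \<in> N" using N.submodule_subset[OF Jsub] h by simp
      have carr: "n \<in> carrier M" "u \<in> carrier M" "k \<in> carrier M" "v \<in> carrier M" "x \<in> carrier R"
        using m h kN Vc UN(2) w JU Uc by auto
      have "w \<oplus>\<^bsub>M\<^esub> h = (x \<odot>\<^bsub>M\<^esub> n \<oplus>\<^bsub>M\<^esub> k) \<oplus>\<^bsub>M\<^esub> (x \<odot>\<^bsub>M\<^esub> u \<oplus>\<^bsub>M\<^esub> v)"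
        using w h m carr by (simp add: smult_r_distr M.a_ac)
      moreover have "x \<odot>\<^bsub>M\<^esub> n \<oplus>\<^bsub>M\<^esub> k \<in> ideal_smult ?R ?N J"
        using N.submoduleE(5)[OF Jsub, of "x \<odot>\<^bsub>M\<^esub> n" k] N.smult_in_ideal_smult[of x J n] w h m by simp
      moreover have "x \<odot>\<^bsub>M\<^esub> u \<oplus>\<^bsub>M\<^esub> v \<in> V" using Vadd V(3) w h m JU by blast
      ultimately show "w \<oplus>\<^bsub>M\<^esub> h \<in> ?H" by blast
    qed
    moreover obtain n where n: "n \<in> N" "n \<notin> ideal_smult ?R ?N J"
      using False N.submodule_subset[OF Jsub] by auto
    have "n \<notin> ?H"
    proof
      assume "n \<in> ?H"
      then obtain k v where kv: "n = k \<oplus>\<^bsub>M\<^esub> v" "k \<in> ideal_smult ?R ?N J" "v \<in> V" by blast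
      have "k \<in> N" using N.submodule_subset[OF Jsub] kv by simp
      then have "n = k"
        using direct_sum_unique[OF M.abelian_group_axioms N.M.abelian_group_axioms UN(2) _ V(2) n(1) kv(1)]
          kv Vc by blast
      then show False using kv n by simp
    qed
    ultimately have "fsums M W \<noteq> carrier M" using n UN(2) by blast
    then obtain P L where P: "primeideal P R" and L: "submodule L R M" "L \<noteq> carrier M"
      and PL: "annihilator_mod R M (fsums M W) \<subseteq> P" "P \<subseteq> annihilator_mod R M L"
      using proper_submodule_prime[OF noeth K] by blast
    have "J \<subseteq> annihilator_mod R M (fsums M W)"
      using WK JU Uc by (auto simp: annihilator_mod_def W_def)
    then have "I \<subseteq> P" using radical[OF P] PL zs by blast
    then have "ideal_smult R M I \<subseteq> L"
      using PL by (intro ideal_smult_least[OF L(1)]) (auto simp: annihilator_mod_def)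
    then have IM: "ideal_smult R M I \<noteq> carrier M" using L submodule_subset by blast
    have "enat (length xs) \<le> depth ?R J ?N"
      if reg: "regular_sequence R M xs" and xsI: "set xs \<subseteq> I" for xs
    proof -
      have xs: "set xs \<subseteq> carrier R" "weakly_regular M {\<zero>\<^bsub>M\<^esub>} xs"
        using reg regular_sequence_iff by auto
      have "set xs \<subseteq> P" if "primeideal P R" "set zs \<subseteq> P" for P
        using radical[OF that] xsI by blast
      then obtain ys where ys: "set ys \<subseteq> span_over R U zs" "length ys = length xs"
        "weakly_regular M {\<zero>\<^bsub>M\<^esub>} ys"
        using weakly_regular_replacement[OF noeth U zero_submodule _ xs, of zs] zs JU by blast
      have "span_over R U zs \<subseteq> J"
      proof -
        have "span_over ?R U zs \<subseteq> J" using N.R.span_over_least[OF _ J zs, of U] by simp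
        moreover have "span_over ?R U zs = span_over R U zs" by (induction zs) auto
        ultimately show ?thesis by simp
      qed
      then have ysJ: "set ys \<subseteq> J" using ys by blast
      have "weakly_regular ?N {\<zero>\<^bsub>M\<^esub>} ys"
      proof (rule weakly_regular_summand[OF M N.M.abelian_group_axioms UN(2) smultN V decomp Uc _ ys(3)])
        show "set ys \<subseteq> U" using ysJ JU by blast
        show "{\<zero>\<^bsub>M\<^esub>} \<subseteq> N" using N.M.zero_closed by simp
        have "\<zero>\<^bsub>M\<^esub> = \<zero>\<^bsub>M\<^esub> \<oplus>\<^bsub>M\<^esub> \<zero>\<^bsub>M\<^esub>" by simp
        then show "{\<zero>\<^bsub>M\<^esub>} \<subseteq> {k \<oplus>\<^bsub>M\<^esub> v | k v. k \<in> {\<zero>\<^bsub>M\<^esub>} \<and> v \<in> V}" using V0 by blast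
      qed auto
      moreover have "foldl (cut ?N) {\<zero>\<^bsub>M\<^esub>} ys \<noteq> N"
      proof -
        have "foldl (cut ?N) {\<zero>\<^bsub>M\<^esub>} ys \<subseteq> ideal_smult ?R ?N J"
          using N.foldl_cut_subset_ideal_smult[of J ys] JU ysJ by simp
        then show ?thesis using n by blast
      qed
      ultimately have "regular_sequence ?R ?N ys"
        using ysJ JU by (simp add: N.regular_sequence_iff)
      then have "ys \<in> {ys. regular_sequence ?R ?N ys \<and> set ys \<subseteq> J}" using ysJ by blast
      then have "enat (length ys) \<le> (SUP ys \<in> {ys. regular_sequence ?R ?N ys \<and> set ys \<subseteq> J}. enat (length ys))"
        by (rule SUP_upper)
      then show ?thesis using False ys(2) by (simp add: depth_def)
    qed
    then show ?thesis using IM unfolding depth_def[of R I M] by (simp add: SUP_le_iff)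
  qed
qed

section \<open>Sums of homogeneous components\<close>

definition homogeneous_sums :: "('m, 'c) ring_scheme \<Rightarrow> ('g \<Rightarrow> 'm set) \<Rightarrow> 'g set \<Rightarrow> 'm set" where
  "homogeneous_sums G A T = fsums G (\<Union>t\<in>T. A t)"

lemma abelian_group_on_subgroup:
  assumes "abelian_group G" "subgroup H (add_monoid G)"
  shows "abelian_group (G\<lparr>carrier := H\<rparr>)"
proof -
  interpret G: abelian_group G by fact
  show ?thesis
    using G.add.subgroup_imp_group[OF assms(2)]
      comm_monoid.submonoid_is_comm_monoid[OF G.a_comm_monoid subgroup.subgroup_is_submonoid[OF assms(2)]]
    by (intro abelian_group.intro abelian_monoid.intro abelian_group_axioms.intro)
      (auto simp: comm_group_def)
qed

lemma add_subgroup_facts: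
  assumes "subgroup H (add_monoid G)"
  shows "H \<subseteq> carrier G" "\<zero>\<^bsub>G\<^esub> \<in> H" "\<And>x y. x \<in> H \<Longrightarrow> y \<in> H \<Longrightarrow> x \<oplus>\<^bsub>G\<^esub> y \<in> H"
    "\<And>x. x \<in> H \<Longrightarrow> \<ominus>\<^bsub>G\<^esub> x \<in> H"
  using subgroup.subset[OF assms] subgroup.one_closed[OF assms] subgroup.m_closed[OF assms]
    subgroup.m_inv_closed[OF assms] by (simp_all add: a_inv_def)

lemma (in abelian_group) subgroup_fsums:
  assumes W: "W \<subseteq> carrier G" and neg: "\<And>w. w \<in> W \<Longrightarrow> \<ominus> w \<in> W"
  shows "subgroup (fsums G W) (add_monoid G)"
proof (rule subgroup.intro)
  note sc = fsums_subset_carrier[OF W]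
  show "fsums G W \<subseteq> carrier (add_monoid G)" using sc by simp
  show "\<one>\<^bsub>add_monoid G\<^esub> \<in> fsums G W" by (simp add: fsums.zero)
  show "x \<otimes>\<^bsub>add_monoid G\<^esub> y \<in> fsums G W" if "x \<in> fsums G W" "y \<in> fsums G W" for x y
    using fsums_closed[OF W that] by simp
  fix x assume "x \<in> fsums G W"
  then have "\<ominus> x \<in> fsums G W"
  proof induction
    case zero
    have "\<ominus> \<zero> = \<zero>" using add.inv_one by (simp add: a_inv_def)
    show ?case unfolding \<open>\<ominus> \<zero> = \<zero>\<close> by (rule fsums.zero)
  next
    case (add w x)
    have "w \<in> carrier G" "x \<in> carrier G" using add.hyps W sc by auto
    then have "\<ominus> (w \<oplus> x) = \<ominus> w \<oplus> \<ominus> x" by (simp add: minus_add)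
    then show ?case using add neg by (simp add: fsums.add)
  qed
  then show "inv\<^bsub>add_monoid G\<^esub> x \<in> fsums G W" by (simp add: a_inv_def)
qed

text \<open>Equal degrees are collected, so that an arbitrary sum of homogeneous elements becomes a sum indexed by
  degrees, which is the form in which directness is given.\<close>

lemma (in abelian_group) homogeneous_sums_eq_finsums:
  assumes A: "\<And>n. subgroup (A n) (add_monoid G)"
  shows "homogeneous_sums G A T =
    {finsum G f F | f F. finite F \<and> F \<subseteq> T \<and> (\<forall>n \<in> F. f n \<in> A n)}" (is "_ = ?H")
proof
  note Ac = add_subgroup_facts[OF A]
  show "homogeneous_sums G A T \<subseteq> ?H"
    unfolding homogeneous_sums_def
  proof (rule fsums_least)
    show "\<zero> \<in> ?H" by (intro CollectI exI[of _ "\<lambda>_. \<zero>"] exI[of _ "{}"]) simp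
    fix w x assume "w \<in> (\<Union>t\<in>T. A t)" "x \<in> ?H"
    then obtain t f F where t: "t \<in> T" "w \<in> A t"
      and F: "x = finsum G f F" "finite F" "F \<subseteq> T" "\<forall>n \<in> F. f n \<in> A n" by blast
    have wc: "w \<in> carrier G" using t Ac by blast
    have fc: "f \<in> F \<rightarrow> carrier G" using F Ac by blast
    show "w \<oplus> x \<in> ?H"
    proof (cases "t \<in> F")
      case False
      have "finsum G (f(t := w)) (insert t F) = w \<oplus> finsum G (f(t := w)) F"
        using False F fc wc by (subst finsum_insert) auto
      also have "finsum G (f(t := w)) F = finsum G f F"
        using False fc by (intro finsum_cong') auto
      finally have "w \<oplus> x = finsum G (f(t := w)) (insert t F)" unfolding F(1) by (rule sym)
      moreover have "\<forall>n \<in> insert t F. (f(t := w)) n \<in> A n" using t F by auto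
      ultimately show ?thesis using F t by blast
    next
      case True
      define F' where "F' = F - {t}"
      have F': "F = insert t F'" "t \<notin> F'" "finite F'" using True F by (auto simp: F'_def)
      have fc': "f t \<in> carrier G" "f \<in> F' \<rightarrow> carrier G" using fc F' by auto
      have "finsum G (f(t := w \<oplus> f t)) F = (w \<oplus> f t) \<oplus> finsum G (f(t := w \<oplus> f t)) F'"
        using F' fc' wc unfolding F'(1) by (subst finsum_insert) auto
      also have "finsum G (f(t := w \<oplus> f t)) F' = finsum G f F'"
        using F' fc' by (intro finsum_cong') auto
      also have "(w \<oplus> f t) \<oplus> finsum G f F' = w \<oplus> (f t \<oplus> finsum G f F')"
        using fc' wc by (intro a_assoc) auto
      also have "f t \<oplus> finsum G f F' = x"
        unfolding F(1) F'(1) using F' fc' by (subst finsum_insert) auto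
      finally have "w \<oplus> x = finsum G (f(t := w \<oplus> f t)) F" by (rule sym)
      moreover have "\<forall>n \<in> F. (f(t := w \<oplus> f t)) n \<in> A n" using t F True Ac(3) by auto
      ultimately show ?thesis using F by blast
    qed
  qed
  have W: "(\<Union>t\<in>T. A t) \<subseteq> carrier G" using Ac by blast
  have "finsum G f F \<in> homogeneous_sums G A T"
    if "finite F" "F \<subseteq> T" "\<forall>n \<in> F. f n \<in> A n" for f F
    using that
  proof (induction F rule: finite_induct)
    case empty
    then show ?case by (simp add: homogeneous_sums_def fsums.zero)
  next
    case (insert n F)
    then have "f \<in> F \<rightarrow> carrier G" "f n \<in> carrier G" using Ac by blast+
    then have "finsum G f (insert n F) = f n \<oplus> finsum G f F" using insert by simp
    then show ?case using insert by (auto simp: homogeneous_sums_def intro!: fsums.add)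
  qed
  then show "?H \<subseteq> homogeneous_sums G A T" by blast
qed

lemma (in abelian_group) family_sum_eq:
  assumes "\<And>n. subgroup (A n) (add_monoid G)"
  shows "family_sum G A = homogeneous_sums G A UNIV"
  unfolding homogeneous_sums_eq_finsums[OF assms] family_sum_def by simp

locale direct_sum = abelian_group G for G (structure) +
  fixes A :: "'g \<Rightarrow> 'a set"
  assumes direct: "internal_direct_sum G A"
begin

lemma component: "subgroup (A n) (add_monoid G)"
  using direct by (simp add: internal_direct_sum_def)

lemmas component_facts = add_subgroup_facts[OF component]

lemma components_subset: "(\<Union>t\<in>T. A t) \<subseteq> carrier G"
  using component_facts by blast

lemma subgroup_homogeneous_sums: "subgroup (homogeneous_sums G A T) (add_monoid G)"
  unfolding homogeneous_sums_def
  by (rule subgroup_fsums[OF components_subset]) (use component_facts(4) in blast)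

lemmas homogeneous_sums_facts = add_subgroup_facts[OF subgroup_homogeneous_sums]

lemma homogeneous_sums_UNIV: "homogeneous_sums G A UNIV = carrier G"
  using direct family_sum_eq[of A, OF component] by (simp add: internal_direct_sum_def)

lemma homogeneous_sums_mono: "T \<subseteq> T' \<Longrightarrow> homogeneous_sums G A T \<subseteq> homogeneous_sums G A T'"
  unfolding homogeneous_sums_def by (intro fsums_mono) blast

lemma component_subset_homogeneous_sums: "t \<in> T \<Longrightarrow> A t \<subseteq> homogeneous_sums G A T"
  unfolding homogeneous_sums_def using fsums_incl[OF components_subset] by blast

lemma homogeneous_sums_disjoint:
  assumes "T \<inter> T' = {}"
  shows "homogeneous_sums G A T \<inter> homogeneous_sums G A T' \<subseteq> {\<zero>}"
proof
  fix x assume "x \<in> homogeneous_sums G A T \<inter> homogeneous_sums G A T'"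
  then have x: "x \<in> homogeneous_sums G A T" "\<ominus> x \<in> homogeneous_sums G A T'" "x \<in> carrier G"
    using homogeneous_sums_facts by blast+
  obtain f F where f: "x = finsum G f F" "finite F" "F \<subseteq> T" "\<forall>n \<in> F. f n \<in> A n"
    using x(1) unfolding homogeneous_sums_eq_finsums[of A, OF component] by blast
  obtain g H where g: "\<ominus> x = finsum G g H" "finite H" "H \<subseteq> T'" "\<forall>n \<in> H. g n \<in> A n"
    using x(2) unfolding homogeneous_sums_eq_finsums[of A, OF component] by blast
  define h where "h n = (if n \<in> F then f n else g n)" for n
  have disj: "F \<inter> H = {}" using f g assms by blast
  have fc: "f \<in> F \<rightarrow> carrier G" "g \<in> H \<rightarrow> carrier G" using f g component_facts by blast+
  have hF: "finsum G h F = x" unfolding f(1) h_def using fc by (intro finsum_cong') auto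
  have hH: "finsum G h H = \<ominus> x" unfolding g(1) h_def using fc disj by (intro finsum_cong') auto
  have "h \<in> F \<rightarrow> carrier G" "h \<in> H \<rightarrow> carrier G" using fc disj by (auto simp: h_def)
  then have "finsum G h (F \<union> H) = finsum G h F \<oplus> finsum G h H"
    using f(2) g(2) disj by (intro finsum_Un_disjoint)
  then have "finsum G h (F \<union> H) = \<zero>" using hF hH x(3) by (simp add: r_neg)
  moreover have "\<forall>n \<in> F \<union> H. h n \<in> A n" "finite (F \<union> H)" using f g by (auto simp: h_def)
  ultimately have "\<forall>n \<in> F \<union> H. h n = \<zero>"
    using direct unfolding internal_direct_sum_def by blast
  moreover have "h n = f n" if "n \<in> F" for n using that by (simp add: h_def)
  ultimately have "\<forall>n \<in> F. f n = \<zero>" by (metis UnI1)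
  then have "finsum G f F = \<zero>" by (intro add.finprod_one_eqI) auto
  then show "x \<in> {\<zero>}" using f by simp
qed

lemma homogeneous_sums_split:
  assumes "x \<in> homogeneous_sums G A T"
  shows "\<exists>u \<in> homogeneous_sums G A (T \<inter> T'). \<exists>v \<in> homogeneous_sums G A (T - T'). x = u \<oplus> v"
proof -
  let ?U = "homogeneous_sums G A (T \<inter> T')" and ?V = "homogeneous_sums G A (T - T')"
  have "homogeneous_sums G A T \<subseteq> {u \<oplus> v | u v. u \<in> ?U \<and> v \<in> ?V}" (is "_ \<subseteq> ?H")
    unfolding homogeneous_sums_def[of G A T]
  proof (rule fsums_least)
    have "\<zero> = \<zero> \<oplus> \<zero>" by simp
    then show "\<zero> \<in> ?H" using homogeneous_sums_facts(2) by blast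
    fix w x assume "w \<in> (\<Union>t\<in>T. A t)" "x \<in> ?H"
    then obtain t u v where t: "t \<in> T" "w \<in> A t" and uv: "x = u \<oplus> v" "u \<in> ?U" "v \<in> ?V" by blast
    have carr: "w \<in> carrier G" "u \<in> carrier G" "v \<in> carrier G"
      using t uv component_facts(1) homogeneous_sums_facts(1) by blast+
    have eq: "w \<oplus> x = (w \<oplus> u) \<oplus> v" "w \<oplus> x = u \<oplus> (w \<oplus> v)" using uv carr by (simp_all add: a_ac)
    show "w \<oplus> x \<in> ?H"
    proof (cases "t \<in> T'")
      case True
      then have "w \<in> ?U" using component_subset_homogeneous_sums[of t "T \<inter> T'"] t by blast
      then have "w \<oplus> u \<in> ?U" using homogeneous_sums_facts(3) uv by blast
      then show ?thesis using eq(1) uv by blast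
    next
      case False
      then have "w \<in> ?V" using component_subset_homogeneous_sums[of t "T - T'"] t by blast
      then have "w \<oplus> v \<in> ?V" using homogeneous_sums_facts(3) uv by blast
      then show ?thesis using eq(2) uv by blast
    qed
  qed
  then show ?thesis using assms by blast
qed

lemma homogeneous_sums_singleton: "homogeneous_sums G A {d} = A d"
proof
  show "homogeneous_sums G A {d} \<subseteq> A d"
    unfolding homogeneous_sums_def using component_facts by (intro fsums_least) auto
  show "A d \<subseteq> homogeneous_sums G A {d}" using component_subset_homogeneous_sums by simp
qed

text \<open>A sum of homogeneous elements of a restricted kind that happens to be homogeneous of degree \<open>d\<close> is the sum
  of its terms of degree \<open>d\<close>.\<close>

lemma component_of_fsums:
  assumes H: "\<And>e. H e \<subseteq> A e" "\<zero> \<in> H d" "\<And>x y. x \<in> H d \<Longrightarrow> y \<in> H d \<Longrightarrow> x \<oplus> y \<in> H d"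
    and x: "x \<in> fsums G (\<Union>e. H e)" "x \<in> A d"
  shows "x \<in> H d"
proof -
  let ?V = "homogeneous_sums G A (- {d})"
  have "fsums G (\<Union>e. H e) \<subseteq> {h \<oplus> v | h v. h \<in> H d \<and> v \<in> ?V}" (is "_ \<subseteq> ?K")
  proof (rule fsums_least)
    have "\<zero> = \<zero> \<oplus> \<zero>" by simp
    then show "\<zero> \<in> ?K" using H(2) homogeneous_sums_facts(2) by blast
    fix w x assume "w \<in> (\<Union>e. H e)" "x \<in> ?K"
    then obtain e h v where e: "w \<in> H e" and hv: "x = h \<oplus> v" "h \<in> H d" "v \<in> ?V" by blast
    have carr: "w \<in> carrier G" "h \<in> carrier G" "v \<in> carrier G"
      using e hv H(1) component_facts(1) homogeneous_sums_facts(1) by blast+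
    have eq: "w \<oplus> x = (w \<oplus> h) \<oplus> v" "w \<oplus> x = h \<oplus> (w \<oplus> v)" using hv carr by (simp_all add: a_ac)
    show "w \<oplus> x \<in> ?K"
    proof (cases "e = d")
      case True
      then have "w \<oplus> h \<in> H d" using H(3) e hv by blast
      then show ?thesis using eq(1) hv by blast
    next
      case False
      then have "w \<in> ?V" using component_subset_homogeneous_sums[of e "- {d}"] e H(1) by blast
      then have "w \<oplus> v \<in> ?V" using homogeneous_sums_facts(3) hv by blast
      then show ?thesis using eq(2) hv by blast
    qed
  qed
  then obtain h v where hv: "x = h \<oplus> v" "h \<in> H d" "v \<in> ?V" using x(1) by blast
  have "A d \<inter> ?V \<subseteq> {\<zero>}"
    using homogeneous_sums_disjoint[of "{d}" "- {d}"] homogeneous_sums_singleton by simp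
  then have "x = h"
    using direct_sum_unique[OF abelian_group_axioms
        abelian_group_on_subgroup[OF abelian_group_axioms component] component_facts(1)
        homogeneous_sums_facts(1) _ x(2) hv(1)] hv H(1) by blast
  then show ?thesis using hv by simp
qed

end

section \<open>The degree lattice\<close>

text \<open>The map \<open>phi\<close> is this linear map after scaling the coordinates by \<open>a\<close>. It serves as a common coordinate
  system in which the degrees for different \<open>a\<close> can be compared.\<close>

definition degree_map :: "('r::finite \<Rightarrow> nat ^ 'r) \<Rightarrow> 'k::comm_semiring_1 ^ 'r \<Rightarrow> 'k ^ 'r" where
  "degree_map \<gamma> \<nu> = (\<chi> j. \<Sum>i\<in>UNIV. \<nu> $ i * of_nat (\<gamma> i $ j))"

lemma phi_eq_degree_map: "phi \<gamma> a n = degree_map \<gamma> (\<chi> i. n $ i * of_nat (a $ i))"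
  by (simp add: phi_def degree_map_def)

lemma degree_map_add: "degree_map \<gamma> (m + n) = degree_map \<gamma> m + degree_map \<gamma> n"
  by (simp add: degree_map_def vec_eq_iff algebra_simps sum.distrib)

lemma degree_map_0 [simp]: "degree_map \<gamma> 0 = 0"
  by (simp add: degree_map_def vec_eq_iff)

lemma degree_map_axis [simp]: "degree_map \<gamma> (axis i 1) = \<gamma> i"
  by (simp add: degree_map_def vec_eq_iff axis_def if_distrib if_distribR cong: if_cong)

lemma int_vec_degree_map: "int_vec (degree_map \<gamma> \<nu>) = degree_map \<gamma> (int_vec \<nu>)"
  by (simp add: degree_map_def int_vec_def vec_eq_iff)

lemma int_vec_phi: "int_vec (phi \<gamma> a n) = phi \<gamma> a (int_vec n)"
  by (simp add: phi_def int_vec_def vec_eq_iff)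

lemma int_vec_inj: "int_vec m = int_vec n \<Longrightarrow> m = n"
  by (simp add: int_vec_def vec_eq_iff)

lemma phi_add: "phi \<gamma> a (m + n) = phi \<gamma> a m + phi \<gamma> a n"
  by (simp add: phi_def vec_eq_iff algebra_simps sum.distrib)

lemma phi_0 [simp]: "phi \<gamma> a 0 = 0"
  by (simp add: phi_def vec_eq_iff)

lemma phi_diff: "phi \<gamma> a (m - n) = phi \<gamma> a m - (phi \<gamma> a n :: int ^ 'r::finite)"
  by (simp add: phi_def vec_eq_iff algebra_simps sum_subtractf)

text \<open>At the largest index \<open>j\<close> with \<open>z\<^sub>j \<noteq> 0\<close>, triangularity leaves only the diagonal term \<open>z\<^sub>j \<gamma>\<^sub>j\<^sup>j\<close>.\<close>

lemma degree_map_eq_0_int: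
  fixes z :: "int ^ 'r::{finite, linorder}"
  assumes tri: "\<And>i j. i < j \<Longrightarrow> \<gamma> i $ j = 0" and diag: "\<And>i. \<gamma> i $ i \<noteq> 0"
    and 0: "degree_map \<gamma> z = 0"
  shows "z = 0"
proof (rule ccontr)
  assume "z \<noteq> 0"
  then have ne: "{i. z $ i \<noteq> 0} \<noteq> {}" by (auto simp: vec_eq_iff)
  define j where "j = Max {i. z $ i \<noteq> 0}"
  have zj: "z $ j \<noteq> 0" using Max_in[OF _ ne] by (simp add: j_def)
  have zero: "z $ i * of_nat (\<gamma> i $ j) = 0" if "i \<noteq> j" for i
  proof (cases "i < j")
    case True
    then show ?thesis using tri by simp
  next
    case False
    then have "\<not> i \<le> j" using that by simp
    then have "z $ i = 0" using Max_ge[of "{i. z $ i \<noteq> 0}" i] by (auto simp: j_def)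
    then show ?thesis by simp
  qed
  have "degree_map \<gamma> z $ j = (\<Sum>i\<in>UNIV. z $ i * of_nat (\<gamma> i $ j))" by (simp add: degree_map_def)
  also have "\<dots> = z $ j * of_nat (\<gamma> j $ j) + (\<Sum>i\<in>UNIV - {j}. z $ i * of_nat (\<gamma> i $ j))"
    by (rule sum.remove) auto
  also have "(\<Sum>i\<in>UNIV - {j}. z $ i * of_nat (\<gamma> i $ j)) = 0"
    by (rule sum.neutral) (use zero in blast)
  finally show False using 0 zj diag[of j] by simp
qed

lemma degree_map_inj_int:
  fixes x y :: "int ^ 'r::{finite, linorder}"
  assumes tri: "\<And>i j. i < j \<Longrightarrow> \<gamma> i $ j = 0" and diag: "\<And>i. \<gamma> i $ i \<noteq> 0"
    and eq: "degree_map \<gamma> x = degree_map \<gamma> y"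
  shows "x = y"
proof -
  have "degree_map \<gamma> (x - y) = degree_map \<gamma> x - degree_map \<gamma> y"
    by (simp add: degree_map_def vec_eq_iff algebra_simps sum_subtractf)
  then have "degree_map \<gamma> (x - y) = 0" using eq by simp
  then have "x - y = 0" using degree_map_eq_0_int[of \<gamma> "x - y"] tri diag by blast
  then show ?thesis by (simp only: right_minus_eq)
qed

lemma degree_map_inj_nat:
  fixes x y :: "nat ^ 'r::{finite, linorder}"
  assumes tri: "\<And>i j. i < j \<Longrightarrow> \<gamma> i $ j = 0" and diag: "\<And>i. \<gamma> i $ i \<noteq> 0"
    and eq: "degree_map \<gamma> x = degree_map \<gamma> y"
  shows "x = y"
proof -
  have "degree_map \<gamma> (int_vec x) = degree_map \<gamma> (int_vec y)"
    using eq by (metis int_vec_degree_map)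
  then have "int_vec x = int_vec y"
    using degree_map_inj_int[of \<gamma> "int_vec x" "int_vec y"] tri diag by blast
  then show ?thesis by (rule int_vec_inj)
qed

section \<open>Splitting off generators\<close>

text \<open>Both multiplications, of the ring and on the module, are handled by this principle.\<close>

lemma fsums_bilinear:
  assumes G: "abelian_monoid G" and H: "abelian_monoid H"
    and x: "x \<in> fsums G W" and y: "y \<in> fsums H W'" and W: "W \<subseteq> carrier G" and W': "W' \<subseteq> carrier H"
    and K: "\<zero>\<^bsub>L\<^esub> \<in> K" "\<And>a b. a \<in> K \<Longrightarrow> b \<in> K \<Longrightarrow> a \<oplus>\<^bsub>L\<^esub> b \<in> K"
    and f: "\<And>w w'. w \<in> W \<Longrightarrow> w' \<in> W' \<Longrightarrow> f w w' \<in> K"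
      "\<And>a b c. a \<in> carrier G \<Longrightarrow> b \<in> carrier G \<Longrightarrow> c \<in> carrier H \<Longrightarrow>
         f (a \<oplus>\<^bsub>G\<^esub> b) c = f a c \<oplus>\<^bsub>L\<^esub> f b c"
      "\<And>a b c. a \<in> carrier G \<Longrightarrow> b \<in> carrier H \<Longrightarrow> c \<in> carrier H \<Longrightarrow>
         f a (b \<oplus>\<^bsub>H\<^esub> c) = f a b \<oplus>\<^bsub>L\<^esub> f a c"
      "\<And>c. c \<in> carrier H \<Longrightarrow> f \<zero>\<^bsub>G\<^esub> c = \<zero>\<^bsub>L\<^esub>" "\<And>a. a \<in> carrier G \<Longrightarrow> f a \<zero>\<^bsub>H\<^esub> = \<zero>\<^bsub>L\<^esub>"
  shows "f x y \<in> K"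
proof -
  note sG = abelian_monoid.fsums_subset_carrier[OF G W]
  note sH = abelian_monoid.fsums_subset_carrier[OF H W']
  have right: "f w z \<in> K" if w: "w \<in> W" and z: "z \<in> fsums H W'" for w z
    using z
  proof induction
    case zero
    then show ?case using f(5)[of w] w W K by auto
  next
    case (add w' z)
    have "f w (w' \<oplus>\<^bsub>H\<^esub> z) = f w w' \<oplus>\<^bsub>L\<^esub> f w z" using add.hyps w W W' sH by (intro f(3)) auto
    then show ?case using add f(1)[OF w] K by simp
  qed
  have yc: "y \<in> carrier H" using y sH by blast
  show ?thesis
    using x
  proof induction
    case zero
    then show ?case using f(4)[OF yc] K by simp
  next
    case (add w x)
    have "f (w \<oplus>\<^bsub>G\<^esub> x) y = f w y \<oplus>\<^bsub>L\<^esub> f x y" using add.hyps yc W sG by (intro f(2)) auto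
    then show ?case using add right[OF _ y] K by simp
  qed
qed

locale graded_module_setting = module S M + A: direct_sum S A + B: direct_sum M B
  for S :: "('a, 'c) ring_scheme" and A :: "nat ^ 'r::{finite, linorder} \<Rightarrow> 'a set"
    and M :: "('a, 'b, 'd) module_scheme" and B :: "int ^ 'r::{finite, linorder} \<Rightarrow> 'b set" +
  fixes \<gamma> :: "'r::{finite, linorder} \<Rightarrow> nat ^ 'r::{finite, linorder}" and \<mu> :: "'r \<Rightarrow> nat" and g :: "'r \<Rightarrow> nat \<Rightarrow> 'a" and \<mm> :: "'a set"
  assumes gamma_triangular: "\<And>i j. i < j \<Longrightarrow> \<gamma> i $ j = 0"
    and gamma_diagonal: "\<And>i. \<gamma> i $ i \<noteq> 0"
    and mult_degree: "\<And>m n x y. x \<in> A m \<Longrightarrow> y \<in> A n \<Longrightarrow> x \<otimes>\<^bsub>S\<^esub> y \<in> A (m + n)"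
    and smult_degree: "\<And>m n x y. x \<in> A m \<Longrightarrow> y \<in> B n \<Longrightarrow> x \<odot>\<^bsub>M\<^esub> y \<in> B (int_vec m + n)"
    and noetherian: "noetherian_ring S"
    and generator_degree: "\<And>i j. 1 \<le> j \<Longrightarrow> j \<le> \<mu> i \<Longrightarrow> g i j \<in> A (\<gamma> i)"
    and generated: "generate_ring S (A 0 \<union> {g i j | i j. 1 \<le> j \<and> j \<le> \<mu> i}) = carrier S"
    and local: "local_ring (degree_zero_ring S A) \<mm>"
    and fin_gen: "fin_gen_module S M"
begin

lemma degree_map_inj:
  fixes \<nu> \<kappa> :: "nat ^ 'r::{finite, linorder}"
  shows "degree_map \<gamma> \<nu> = degree_map \<gamma> \<kappa> \<Longrightarrow> \<nu> = \<kappa>"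
  using degree_map_inj_nat[of \<gamma> \<nu> \<kappa>] gamma_triangular gamma_diagonal by blast

lemma degree_map_inj_int:
  fixes \<nu> \<kappa> :: "int ^ 'r::{finite, linorder}"
  shows "degree_map \<gamma> \<nu> = degree_map \<gamma> \<kappa> \<Longrightarrow> \<nu> = \<kappa>"
  using degree_map_inj_int[of \<gamma> \<nu> \<kappa>] gamma_triangular gamma_diagonal by blast

lemma degree_zero_cring: "cring (S\<lparr>carrier := A 0\<rparr>)"
  using local by (simp add: local_ring_def degree_zero_ring_def)

lemma one_degree_zero: "\<one>\<^bsub>S\<^esub> \<in> A 0"
proof -
  interpret Z: cring "S\<lparr>carrier := A 0\<rparr>" by (rule degree_zero_cring)
  show ?thesis using Z.one_closed by simp
qed

lemma homogeneous_mult: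
  assumes "x \<in> A (degree_map \<gamma> \<nu>)" "y \<in> A (degree_map \<gamma> \<kappa>)"
  shows "x \<otimes>\<^bsub>S\<^esub> y \<in> A (degree_map \<gamma> (\<nu> + \<kappa>))"
  using mult_degree[OF assms] by (simp add: degree_map_add)

lemma homogeneous_pow:
  assumes x: "x \<in> A (degree_map \<gamma> \<nu>)"
  shows "x [^]\<^bsub>S\<^esub> k \<in> A (degree_map \<gamma> (\<chi> i. k * \<nu> $ i))"
proof (induction k)
  case 0
  have "(\<chi> i. 0 * \<nu> $ i) = (0 :: nat ^ 'r::{finite, linorder})" by (simp add: vec_eq_iff)
  then show ?case using one_degree_zero by simp
next
  case (Suc k)
  have "(\<chi> i. Suc k * \<nu> $ i) = (\<chi> i. k * \<nu> $ i) + \<nu>" by (simp add: vec_eq_iff)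
  then show ?case using homogeneous_mult[OF Suc x] by (simp add: R.nat_pow_Suc)
qed

lemma mult_homogeneous_sums:
  assumes x: "x \<in> homogeneous_sums S A T" and y: "y \<in> homogeneous_sums S A T'"
    and T: "\<And>t t'. t \<in> T \<Longrightarrow> t' \<in> T' \<Longrightarrow> t + t' \<in> T''"
  shows "x \<otimes>\<^bsub>S\<^esub> y \<in> homogeneous_sums S A T''"
proof (rule fsums_bilinear[OF R.abelian_monoid_axioms R.abelian_monoid_axioms
      x[unfolded homogeneous_sums_def] y[unfolded homogeneous_sums_def] A.components_subset A.components_subset])
  show "\<zero>\<^bsub>S\<^esub> \<in> homogeneous_sums S A T''" by (rule A.homogeneous_sums_facts)
  show "\<And>a b. a \<in> homogeneous_sums S A T'' \<Longrightarrow> b \<in> homogeneous_sums S A T'' \<Longrightarrow>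
      a \<oplus>\<^bsub>S\<^esub> b \<in> homogeneous_sums S A T''" by (rule A.homogeneous_sums_facts)
  fix w w' assume "w \<in> (\<Union>t\<in>T. A t)" "w' \<in> (\<Union>t\<in>T'. A t)"
  then obtain t t' where t: "t \<in> T" "t' \<in> T'" "w \<in> A t" "w' \<in> A t'" by blast
  then show "w \<otimes>\<^bsub>S\<^esub> w' \<in> homogeneous_sums S A T''"
    using mult_degree[of w t w' t'] T[of t t'] A.component_subset_homogeneous_sums[of "t + t'" T''] by blast
qed (simp_all add: R.l_distr R.r_distr)

text \<open>The subtraction of \<open>axis i 1\<close> is truncated, so the products have degree \<open>degree_map \<gamma> \<nu>\<close> only when
  \<open>\<nu> $ i\<close> is positive.\<close>

definition divisible_part :: "nat ^ 'r::{finite, linorder} \<Rightarrow> 'r \<Rightarrow> 'a set" where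
  "divisible_part \<nu> i =
     {g i j \<otimes>\<^bsub>S\<^esub> y | j y. 1 \<le> j \<and> j \<le> \<mu> i \<and> y \<in> A (degree_map \<gamma> (\<nu> - axis i 1))}"

lemma generator_carrier: "1 \<le> j \<Longrightarrow> j \<le> \<mu> i \<Longrightarrow> g i j \<in> carrier S"
  using generator_degree A.component_facts(1) by blast

lemma divisible_part_subset: "divisible_part \<nu> i \<subseteq> carrier S"
  unfolding divisible_part_def using A.component_facts(1) generator_carrier by blast

lemma axis_le_diff_add:
  fixes \<nu> \<kappa> :: "nat ^ 'r::{finite, linorder}"
  assumes "0 < \<nu> $ i"
  shows "\<nu> - axis i 1 + \<kappa> = \<nu> + \<kappa> - axis i 1"
  using assms by (auto simp: vec_eq_iff axis_def)

lemma divisible_part_mult: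
  assumes x: "x \<in> fsums S (divisible_part \<nu> i)" and y: "y \<in> A (degree_map \<gamma> \<kappa>)" and i: "0 < \<nu> $ i"
  shows "x \<otimes>\<^bsub>S\<^esub> y \<in> fsums S (divisible_part (\<nu> + \<kappa>) i)"
  using x
proof induction
  case zero
  have "y \<in> carrier S" using y A.component_facts(1) by blast
  then show ?case by (simp add: fsums.zero)
next
  case (add w x)
  have yc: "y \<in> carrier S" using y A.component_facts(1) by blast
  have xc: "x \<in> carrier S" using add.hyps R.fsums_subset_carrier[OF divisible_part_subset] by blast
  obtain j z where w: "w = g i j \<otimes>\<^bsub>S\<^esub> z" "1 \<le> j" "j \<le> \<mu> i" "z \<in> A (degree_map \<gamma> (\<nu> - axis i 1))"
    using add.hyps unfolding divisible_part_def by blast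
  have zc: "z \<in> carrier S" using w A.component_facts(1) by blast
  have "z \<otimes>\<^bsub>S\<^esub> y \<in> A (degree_map \<gamma> (\<nu> + \<kappa> - axis i 1))"
    using homogeneous_mult[OF w(4) y] axis_le_diff_add[OF i] by simp
  moreover have "w \<otimes>\<^bsub>S\<^esub> y = g i j \<otimes>\<^bsub>S\<^esub> (z \<otimes>\<^bsub>S\<^esub> y)"
    using w yc zc generator_carrier by (simp add: R.m_assoc)
  ultimately have "w \<otimes>\<^bsub>S\<^esub> y \<in> divisible_part (\<nu> + \<kappa>) i"
    using w(2,3) unfolding divisible_part_def by blast
  moreover have "(w \<oplus>\<^bsub>S\<^esub> x) \<otimes>\<^bsub>S\<^esub> y = w \<otimes>\<^bsub>S\<^esub> y \<oplus>\<^bsub>S\<^esub> x \<otimes>\<^bsub>S\<^esub> y"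
    using w xc yc zc generator_carrier by (simp add: R.l_distr)
  ultimately show ?case using add.IH by (simp add: fsums.add)
qed

text \<open>The two consequences of generation in the degrees \<open>\<gamma>\<^sub>i\<close>, as a property that is stable under the ring
  operations: nonzero components sit only in degrees spanned by the \<open>\<gamma>\<^sub>i\<close>, and if \<open>\<gamma>\<^sub>i\<close> occurs in the
  degree of an element, some \<open>g\<^sub>i\<^sup>j\<close> can be split off from each of its terms. It will turn out to
  hold for all of \<open>A d\<close>.\<close>

definition decomposable :: "nat ^ 'r::{finite, linorder} \<Rightarrow> 'a set" where
  "decomposable d = {x \<in> A d. (x = \<zero>\<^bsub>S\<^esub> \<or> d \<in> range (degree_map \<gamma>)) \<and>
     (\<forall>\<nu> i. d = degree_map \<gamma> \<nu> \<and> 0 < \<nu> $ i \<longrightarrow> x \<in> fsums S (divisible_part \<nu> i))}"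

lemma decomposable_zero: "\<zero>\<^bsub>S\<^esub> \<in> decomposable d"
  using A.component_facts(2) by (simp add: decomposable_def fsums.zero)

lemma decomposable_add:
  assumes "x \<in> decomposable d" "y \<in> decomposable d"
  shows "x \<oplus>\<^bsub>S\<^esub> y \<in> decomposable d"
  using assms A.component_facts(3) R.fsums_closed[OF divisible_part_subset]
  by (auto simp: decomposable_def)

lemma decomposable_mult:
  assumes x: "x \<in> decomposable d" and y: "y \<in> decomposable e"
  shows "x \<otimes>\<^bsub>S\<^esub> y \<in> decomposable (d + e)"
proof (cases "x = \<zero>\<^bsub>S\<^esub> \<or> y = \<zero>\<^bsub>S\<^esub>")
  case True
  have "x \<in> carrier S" "y \<in> carrier S" using x y A.component_facts(1) by (auto simp: decomposable_def)
  then have "x \<otimes>\<^bsub>S\<^esub> y = \<zero>\<^bsub>S\<^esub>" using True by auto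
  then show ?thesis using decomposable_zero by simp
next
  case False
  have xy: "x \<in> A d" "y \<in> A e" using x y by (auto simp: decomposable_def)
  obtain \<nu> \<kappa> where d: "d = degree_map \<gamma> \<nu>" and e: "e = degree_map \<gamma> \<kappa>"
    using False x y unfolding decomposable_def by blast
  have c: "x \<in> carrier S" "y \<in> carrier S" using xy A.component_facts(1) by blast+
  have de: "d + e = degree_map \<gamma> (\<nu> + \<kappa>)" by (simp add: d e degree_map_add)
  have "x \<otimes>\<^bsub>S\<^esub> y \<in> fsums S (divisible_part (\<nu> + \<kappa>) i)" if i: "0 < (\<nu> + \<kappa>) $ i" for i
  proof (cases "0 < \<nu> $ i")
    case True
    then have "x \<in> fsums S (divisible_part \<nu> i)" using x d by (simp add: decomposable_def)
    then show ?thesis using divisible_part_mult[OF _ xy(2)[unfolded e] True] by simp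
  next
    case False
    then have i': "0 < \<kappa> $ i" using i by simp
    then have "y \<in> fsums S (divisible_part \<kappa> i)" using y e by (simp add: decomposable_def)
    then have "y \<otimes>\<^bsub>S\<^esub> x \<in> fsums S (divisible_part (\<kappa> + \<nu>) i)"
      using divisible_part_mult[OF _ xy(1)[unfolded d] i'] by simp
    then show ?thesis using c by (simp add: R.m_comm add.commute)
  qed
  moreover have "x \<otimes>\<^bsub>S\<^esub> y \<in> A (d + e)" using mult_degree xy by blast
  moreover have "\<nu>' = \<nu> + \<kappa>" if "d + e = degree_map \<gamma> \<nu>'" for \<nu>'
    using degree_map_inj[of \<nu>' "\<nu> + \<kappa>"] de that by simp
  ultimately show ?thesis using de unfolding decomposable_def by blast
qed

lemma decomposable_degree_zero: "A 0 \<subseteq> decomposable 0"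
proof
  fix x assume "x \<in> A 0"
  moreover have "x \<in> fsums S (divisible_part \<nu> i)" if "0 = degree_map \<gamma> \<nu>" "0 < \<nu> $ i" for \<nu> i
    using degree_map_inj[of \<nu> 0] that by simp
  moreover have "(0 :: nat ^ 'r::{finite, linorder}) \<in> range (degree_map \<gamma>)"
    by (rule range_eqI[of _ _ 0]) simp
  ultimately show "x \<in> decomposable 0" unfolding decomposable_def by blast
qed

lemma decomposable_generator:
  assumes j: "1 \<le> j" "j \<le> \<mu> i"
  shows "g i j \<in> decomposable (\<gamma> i)"
proof -
  have "g i j \<in> fsums S (divisible_part \<nu> k)" if "\<gamma> i = degree_map \<gamma> \<nu>" "0 < \<nu> $ k" for \<nu> k
  proof -
    have "degree_map \<gamma> \<nu> = degree_map \<gamma> (axis i 1)"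
      using that(1) unfolding degree_map_axis by (rule sym)
    then have \<nu>: "\<nu> = axis i 1" by (rule degree_map_inj)
    then have k: "k = i" using that(2) by (auto simp: axis_def split: if_splits)
    have "g i j = g i j \<otimes>\<^bsub>S\<^esub> \<one>\<^bsub>S\<^esub>" using generator_carrier[OF j] by simp
    moreover have "\<one>\<^bsub>S\<^esub> \<in> A (degree_map \<gamma> (\<nu> - axis k 1))"
      unfolding \<nu> k using one_degree_zero by simp
    ultimately have "g i j \<in> divisible_part \<nu> k"
      using j unfolding divisible_part_def k by blast
    then show ?thesis using R.fsums_incl[OF divisible_part_subset] by blast
  qed
  moreover have "\<gamma> i \<in> range (degree_map \<gamma>)" by (rule range_eqI[of _ _ "axis i 1"]) (rule degree_map_axis[symmetric])
  ultimately show ?thesis using generator_degree[OF j] unfolding decomposable_def by blast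
qed

text \<open>Induction over the generation of \<open>S\<close>. Negatives are products with \<open>-1\<close>, which has degree zero.\<close>

lemma carrier_eq_fsums_decomposable: "carrier S = fsums S (\<Union>d. decomposable d)"
proof
  have W: "(\<Union>d. decomposable d) \<subseteq> carrier S"
    using A.component_facts(1) by (auto simp: decomposable_def)
  note incl = R.fsums_incl[OF W] and closed = R.fsums_closed[OF W] and sc = R.fsums_subset_carrier[OF W]
  have mult: "x \<otimes>\<^bsub>S\<^esub> y \<in> fsums S (\<Union>d. decomposable d)"
    if x: "x \<in> fsums S (\<Union>d. decomposable d)" and y: "y \<in> fsums S (\<Union>d. decomposable d)" for x y
  proof (rule fsums_bilinear[OF R.abelian_monoid_axioms R.abelian_monoid_axioms x y W W])
    show "\<zero>\<^bsub>S\<^esub> \<in> fsums S (\<Union>d. decomposable d)" by (rule fsums.zero)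
    show "w \<otimes>\<^bsub>S\<^esub> w' \<in> fsums S (\<Union>d. decomposable d)"
      if "w \<in> (\<Union>d. decomposable d)" "w' \<in> (\<Union>d. decomposable d)" for w w'
      using that decomposable_mult incl by blast
  qed (simp_all add: closed R.l_distr R.r_distr)
  have zero: "A 0 \<subseteq> fsums S (\<Union>d. decomposable d)" using decomposable_degree_zero incl by blast
  show "carrier S \<subseteq> fsums S (\<Union>d. decomposable d)"
  proof
    fix x assume "x \<in> carrier S"
    then have "x \<in> generate_ring S (A 0 \<union> {g i j | i j. 1 \<le> j \<and> j \<le> \<mu> i})" using generated by simp
    then show "x \<in> fsums S (\<Union>d. decomposable d)"
    proof induction
      case one
      show ?case using one_degree_zero zero by blast
    next
      case (incl h)
      then show ?case using zero decomposable_generator R.fsums_incl[OF W] by blast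
    next
      case (a_inv h)
      have "\<ominus>\<^bsub>S\<^esub> \<one>\<^bsub>S\<^esub> \<in> fsums S (\<Union>d. decomposable d)"
        using one_degree_zero A.component_facts(4) zero by blast
      from mult[OF this a_inv.IH] have "(\<ominus>\<^bsub>S\<^esub> \<one>\<^bsub>S\<^esub>) \<otimes>\<^bsub>S\<^esub> h \<in> fsums S (\<Union>d. decomposable d)" .
      moreover have "(\<ominus>\<^bsub>S\<^esub> \<one>\<^bsub>S\<^esub>) \<otimes>\<^bsub>S\<^esub> h = \<ominus>\<^bsub>S\<^esub> h" using a_inv.IH sc by (simp add: R.l_minus subset_eq)
      ultimately show ?case by simp
    next
      case (eng_add h1 h2)
      then show ?case using closed by blast
    next
      case (eng_mult h1 h2)
      then show ?case using mult by blast
    qed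
  qed
  show "fsums S (\<Union>d. decomposable d) \<subseteq> carrier S" by (rule sc)
qed

lemma component_decomposable: "A d = decomposable d"
proof
  show "A d \<subseteq> decomposable d"
  proof
    fix x assume x: "x \<in> A d"
    then have "x \<in> carrier S" using A.component_facts(1) by blast
    then have sum: "x \<in> fsums S (\<Union>d. decomposable d)" using carrier_eq_fsums_decomposable by simp
    show "x \<in> decomposable d"
    proof (rule A.component_of_fsums[where H = decomposable])
      show "decomposable e \<subseteq> A e" for e unfolding decomposable_def by blast
    qed (fact decomposable_zero decomposable_add sum x)+
  qed
  show "decomposable d \<subseteq> A d" unfolding decomposable_def by blast
qed

lemma component_support: "x \<in> A d \<Longrightarrow> x \<noteq> \<zero>\<^bsub>S\<^esub> \<Longrightarrow> d \<in> range (degree_map \<gamma>)"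
  using component_decomposable[of d] unfolding decomposable_def by blast

lemma component_divisible:
  "x \<in> A (degree_map \<gamma> \<nu>) \<Longrightarrow> 0 < \<nu> $ i \<Longrightarrow> x \<in> fsums S (divisible_part \<nu> i)"
  using component_decomposable[of "degree_map \<gamma> \<nu>"] unfolding decomposable_def by blast

text \<open>Only degrees in the range of \<open>degree_map\<close> have to be considered for \<open>S\<close>, as the other components vanish.\<close>

lemma smult_homogeneous_sums:
  assumes x: "x \<in> homogeneous_sums S A T" and y: "y \<in> homogeneous_sums M B T'"
    and T: "\<And>t t'. t \<in> T \<Longrightarrow> t \<in> range (degree_map \<gamma>) \<Longrightarrow> t' \<in> T' \<Longrightarrow> int_vec t + t' \<in> T''"
  shows "x \<odot>\<^bsub>M\<^esub> y \<in> homogeneous_sums M B T''"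
proof (rule fsums_bilinear[OF R.abelian_monoid_axioms M.abelian_monoid_axioms
      x[unfolded homogeneous_sums_def] y[unfolded homogeneous_sums_def] A.components_subset B.components_subset])
  show 0: "\<zero>\<^bsub>M\<^esub> \<in> homogeneous_sums M B T''" by (rule B.homogeneous_sums_facts)
  show "\<And>a b. a \<in> homogeneous_sums M B T'' \<Longrightarrow> b \<in> homogeneous_sums M B T'' \<Longrightarrow>
      a \<oplus>\<^bsub>M\<^esub> b \<in> homogeneous_sums M B T''" by (rule B.homogeneous_sums_facts)
  fix w w' assume "w \<in> (\<Union>t\<in>T. A t)" "w' \<in> (\<Union>t\<in>T'. B t)"
  then obtain t t' where t: "t \<in> T" "t' \<in> T'" "w \<in> A t" "w' \<in> B t'" by blast
  show "w \<odot>\<^bsub>M\<^esub> w' \<in> homogeneous_sums M B T''"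
  proof (cases "w = \<zero>\<^bsub>S\<^esub>")
    case True
    then show ?thesis using 0 t B.component_facts(1)[of t'] by (simp add: subset_eq)
  next
    case False
    then have "int_vec t + t' \<in> T''" using T t component_support by blast
    then show ?thesis
      using smult_degree[OF t(3,4)] B.component_subset_homogeneous_sums[of "int_vec t + t'" T''] by blast
  qed
qed (simp_all add: smult_l_distr smult_r_distr)

section \<open>Veronese transforms\<close>

definition ring_degrees :: "nat ^ 'r::{finite, linorder} \<Rightarrow> (nat ^ 'r::{finite, linorder}) set" where
  "ring_degrees a = range (phi \<gamma> a)"

definition module_degrees :: "nat ^ 'r::{finite, linorder} \<Rightarrow> (int ^ 'r::{finite, linorder}) set" where
  "module_degrees a = range (phi \<gamma> a)"

definition ring_part :: "nat ^ 'r::{finite, linorder} \<Rightarrow> 'a set" where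
  "ring_part a = homogeneous_sums S A (ring_degrees a)"

definition module_part :: "nat ^ 'r::{finite, linorder} \<Rightarrow> 'b set" where
  "module_part a = homogeneous_sums M B (module_degrees a)"

lemma ring_degrees_add: "t \<in> ring_degrees a \<Longrightarrow> t' \<in> ring_degrees a \<Longrightarrow> t + t' \<in> ring_degrees a"
  unfolding ring_degrees_def by (auto simp: phi_add[symmetric])

lemma module_degrees_add:
  "t \<in> module_degrees a \<Longrightarrow> t' \<in> module_degrees a \<Longrightarrow> t + t' \<in> module_degrees a"
  unfolding module_degrees_def by (auto simp: phi_add[symmetric])

lemma module_degrees_diff:
  "t \<in> module_degrees a \<Longrightarrow> t' \<in> module_degrees a \<Longrightarrow> t - t' \<in> module_degrees a"
  unfolding module_degrees_def by (auto simp: phi_diff[symmetric])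

lemma zero_ring_degree: "0 \<in> ring_degrees a"
  unfolding ring_degrees_def by (rule range_eqI[of _ _ 0]) simp

lemma int_vec_ring_degrees: "t \<in> ring_degrees a \<Longrightarrow> int_vec t \<in> module_degrees a"
  unfolding ring_degrees_def module_degrees_def by (auto simp: int_vec_phi)

text \<open>In the coordinates of \<open>degree_map\<close>, an integral solution \<open>c\<close> of \<open>\<nu>\<^sub>i = c\<^sub>i a\<^sub>i\<close> with \<open>\<nu>\<^sub>i \<ge> 0\<close> is nonnegative.\<close>

lemma ring_degreesI:
  assumes a: "\<And>i. 0 < a $ i" and t: "t \<in> range (degree_map \<gamma>)" "int_vec t \<in> module_degrees a"
  shows "t \<in> ring_degrees a"
proof -
  obtain \<nu> where \<nu>: "t = degree_map \<gamma> \<nu>" using t by blast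
  obtain c where c: "int_vec t = phi \<gamma> a c" using t unfolding module_degrees_def by blast
  have "degree_map \<gamma> (int_vec \<nu>) = degree_map \<gamma> (\<chi> i. c $ i * of_nat (a $ i))"
    using c unfolding \<nu> int_vec_degree_map phi_eq_degree_map .
  then have eq: "int_vec \<nu> = (\<chi> i. c $ i * of_nat (a $ i))" by (rule degree_map_inj_int)
  have eqi: "int (\<nu> $ i) = c $ i * int (a $ i)" for i
    using eq by (simp add: int_vec_def vec_eq_iff)
  have "0 \<le> c $ i" for i
    using eqi[of i] a[of i] by (metis of_nat_0_le_iff of_nat_0_less_iff zero_le_mult_iff not_less)
  then have "\<nu> $ i = nat (c $ i) * a $ i" for i
    using eqi[of i] by (metis int_nat_eq nat_int of_nat_mult)
  then have "\<nu> = (\<chi> i. (\<chi> i. nat (c $ i)) $ i * of_nat (a $ i))" by (simp add: vec_eq_iff)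
  then have "t = phi \<gamma> a (\<chi> i. nat (c $ i))" unfolding \<nu> phi_eq_degree_map by simp
  then show ?thesis unfolding ring_degrees_def by blast
qed

lemma veronese_ring_eq: "veronese_ring S A \<gamma> a = S\<lparr>carrier := ring_part a\<rparr>"
proof -
  have "family_sum S (\<lambda>n. A (phi \<gamma> a n)) = ring_part a"
    unfolding ring_part_def ring_degrees_def
    by (subst R.family_sum_eq) (simp_all add: A.component homogeneous_sums_def)
  then show ?thesis by (simp add: veronese_ring_def)
qed

lemma veronese_module_eq: "veronese_module M B \<gamma> a = M\<lparr>carrier := module_part a\<rparr>"
proof -
  have "family_sum M (\<lambda>n. B (phi \<gamma> a n)) = module_part a"
    unfolding module_part_def module_degrees_def
    by (subst M.family_sum_eq) (simp_all add: B.component homogeneous_sums_def)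
  then show ?thesis by (simp add: veronese_module_def)
qed

lemma subring_ring_part: "subring (ring_part a) S"
proof (rule R.subringI)
  note facts = A.homogeneous_sums_facts[where T = "ring_degrees a", folded ring_part_def]
  show "ring_part a \<subseteq> carrier S" by (rule facts)
  show "\<one>\<^bsub>S\<^esub> \<in> ring_part a"
    using one_degree_zero A.component_subset_homogeneous_sums[OF zero_ring_degree] 
    unfolding ring_part_def by blast
  show "\<ominus>\<^bsub>S\<^esub> h \<in> ring_part a" if "h \<in> ring_part a" for h using facts that by blast
  show "h1 \<oplus>\<^bsub>S\<^esub> h2 \<in> ring_part a" if "h1 \<in> ring_part a" "h2 \<in> ring_part a" for h1 h2
    using facts that by blast
  show "h1 \<otimes>\<^bsub>S\<^esub> h2 \<in> ring_part a" if "h1 \<in> ring_part a" "h2 \<in> ring_part a" for h1 h2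
    using mult_homogeneous_sums[OF that[unfolded ring_part_def], of "ring_degrees a"] ring_degrees_add
    unfolding ring_part_def by blast
qed

lemma cring_ring_part: "cring (S\<lparr>carrier := ring_part a\<rparr>)"
  using R.subcring_iff[OF subringE(1)[OF subring_ring_part]] R.subcringI'[OF subring_ring_part] by blast

lemma smult_parts: "x \<in> ring_part a \<Longrightarrow> y \<in> module_part a \<Longrightarrow> x \<odot>\<^bsub>M\<^esub> y \<in> module_part a"
  unfolding ring_part_def module_part_def
  by (rule smult_homogeneous_sums) (auto intro: module_degrees_add int_vec_ring_degrees)

lemma module_part_subset: "module_part a \<subseteq> carrier M"
  unfolding module_part_def by (rule B.homogeneous_sums_facts)

lemma module_parts: "module (S\<lparr>carrier := ring_part a\<rparr>) (M\<lparr>carrier := module_part a\<rparr>)"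
proof (rule moduleI)
  show "cring (S\<lparr>carrier := ring_part a\<rparr>)" by (rule cring_ring_part)
  show "abelian_group (M\<lparr>carrier := module_part a\<rparr>)"
    using abelian_group_on_subgroup[OF M.abelian_group_axioms B.subgroup_homogeneous_sums]
    unfolding module_part_def .
qed (use subringE(1)[OF subring_ring_part] module_part_subset smult_parts in
    \<open>auto simp: smult_l_distr smult_r_distr smult_assoc1 subset_eq\<close>)

text \<open>The complement of the ring part is spanned by the components outside \<open>ring_degrees a\<close>. It moves the module
  part out of itself because, by \<open>ring_degreesI\<close>, the degrees of its nonzero components avoid
  the group \<open>module_degrees a\<close>.\<close>

lemma noetherian_parts:
  assumes a: "\<And>i. 0 < a $ i"
  shows "noetherian_module (S\<lparr>carrier := ring_part a\<rparr>) (M\<lparr>carrier := module_part a\<rparr>)"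
proof (rule noetherian_retract[OF module_axioms noetherian_module_if_fin_gen[OF noetherian fin_gen]
      module_parts module_part_subset])
  let ?C = "homogeneous_sums S A (- ring_degrees a)" and ?V = "homogeneous_sums M B (- module_degrees a)"
  show "\<exists>r \<in> ring_part a. \<exists>c \<in> ?C. s = r \<oplus>\<^bsub>S\<^esub> c" if "s \<in> carrier S" for s
    using A.homogeneous_sums_split[of s UNIV "ring_degrees a"] that A.homogeneous_sums_UNIV
    by (simp add: ring_part_def Compl_eq_Diff_UNIV)
  show "ring_part a \<subseteq> carrier S" by (rule subringE(1)[OF subring_ring_part])
  show "?C \<subseteq> carrier S" by (rule A.homogeneous_sums_facts)
  show "subgroup ?V (add_monoid M)" by (rule B.subgroup_homogeneous_sums)
  show "module_part a \<inter> ?V \<subseteq> {\<zero>\<^bsub>M\<^esub>}"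
    unfolding module_part_def by (rule B.homogeneous_sums_disjoint) blast
  fix c n assume c: "c \<in> ?C" and n: "n \<in> module_part a"
  show "c \<odot>\<^bsub>M\<^esub> n \<in> ?V"
  proof (rule smult_homogeneous_sums[OF c n[unfolded module_part_def]])
    fix t t' assume t: "t \<in> - ring_degrees a" "t \<in> range (degree_map \<gamma>)" "t' \<in> module_degrees a"
    have "int_vec t + t' - t' \<in> module_degrees a" if "int_vec t + t' \<in> module_degrees a"
      using module_degrees_diff[OF that t(3)] .
    then show "int_vec t + t' \<in> - module_degrees a" using ring_degreesI[OF a t(2)] t(1) by auto
  qed
qed

lemma maximal_ideal_degree_zero: "ideal \<mm> (S\<lparr>carrier := A 0\<rparr>)"
  using local by (simp add: local_ring_def degree_zero_ring_def maximalideal_def)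

lemma maximal_ideal_subset: "\<mm> \<subseteq> A 0"
  using ideal.Icarr[OF maximal_ideal_degree_zero] by auto

lemma subgroup_maximal_ideal: "subgroup \<mm> (add_monoid S)"
proof (rule R.add.incl_subgroup[OF A.component[of 0]])
  show "subgroup \<mm> (add_monoid S\<lparr>carrier := A 0\<rparr>)"
    using additive_subgroup.a_subgroup[OF ideal.axioms(1)[OF maximal_ideal_degree_zero]] by simp
qed

definition positive_part :: "nat ^ 'r::{finite, linorder} \<Rightarrow> 'a set" where
  "positive_part a = (\<Union>n \<in> - {0}. A (phi \<gamma> a n))"

lemma veronese_max_ideal_eq: "veronese_max_ideal S A \<mm> \<gamma> a = fsums S (\<mm> \<union> positive_part a)"
proof -
  have "(\<Union>n. if n = 0 then \<mm> else A (phi \<gamma> a n)) = \<mm> \<union> positive_part a"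
    by (auto simp: positive_part_def split: if_splits)
  then show ?thesis
    unfolding veronese_max_ideal_def
    by (subst R.family_sum_eq) (auto simp: A.component subgroup_maximal_ideal homogeneous_sums_def)
qed

lemma max_ideal_generators_subset: "\<mm> \<union> positive_part a \<subseteq> ring_part a"
proof -
  have "A (phi \<gamma> a n) \<subseteq> ring_part a" for n
    unfolding ring_part_def ring_degrees_def by (rule A.component_subset_homogeneous_sums) blast
  moreover have "\<mm> \<subseteq> ring_part a" using calculation[of 0] maximal_ideal_subset by simp
  ultimately show ?thesis unfolding positive_part_def by blast
qed

lemma max_ideal_generators_mult:
  assumes x: "x \<in> A (phi \<gamma> a m)" and w: "w \<in> \<mm> \<union> positive_part a"
  shows "x \<otimes>\<^bsub>S\<^esub> w \<in> \<mm> \<union> positive_part a"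
proof (cases "w \<in> \<mm>")
  case True
  then have "w \<in> A 0" using maximal_ideal_subset by blast
  then have xw: "x \<otimes>\<^bsub>S\<^esub> w \<in> A (phi \<gamma> a m)" using mult_degree[OF x, of w 0] by simp
  show ?thesis
  proof (cases "m = 0")
    case m: True
    then have "x \<in> A 0" using x by simp
    then have "x \<otimes>\<^bsub>S\<^esub> w \<in> \<mm>" using ideal.I_l_closed[OF maximal_ideal_degree_zero True] by simp
    then show ?thesis by blast
  next
    case False
    then show ?thesis using xw unfolding positive_part_def by blast
  qed
next
  case False
  then obtain n where n: "n \<noteq> 0" "w \<in> A (phi \<gamma> a n)" using w unfolding positive_part_def by blast
  have "x \<otimes>\<^bsub>S\<^esub> w \<in> A (phi \<gamma> a (m + n))" using mult_degree[OF x n(2)] by (simp add: phi_add)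
  moreover have "m + n \<noteq> 0" using n(1) by (auto simp: vec_eq_iff)
  ultimately show ?thesis unfolding positive_part_def by blast
qed

lemma ideal_veronese_max_ideal:
  "ideal (veronese_max_ideal S A \<mm> \<gamma> a) (S\<lparr>carrier := ring_part a\<rparr>)"
proof -
  let ?W = "\<mm> \<union> positive_part a" and ?R = "S\<lparr>carrier := ring_part a\<rparr>"
  interpret V: cring ?R by (rule cring_ring_part)
  have W: "?W \<subseteq> carrier S" using max_ideal_generators_subset subringE(1)[OF subring_ring_part] by blast
  have neg: "\<ominus>\<^bsub>S\<^esub> w \<in> ?W" if "w \<in> ?W" for w
    using that A.component_facts(4) add_subgroup_facts(4)[OF subgroup_maximal_ideal]
    unfolding positive_part_def by blast
  have sub: "fsums S ?W \<subseteq> ring_part a"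
    by (rule fsums_least)
      (use max_ideal_generators_subset[of a] subringE(2,7)[OF subring_ring_part[of a]] in blast)+
  have sg: "subgroup (fsums S ?W) (add_monoid S\<lparr>carrier := ring_part a\<rparr>)"
    using R.add.subgroup_incl[OF R.subgroup_fsums[OF W neg] _ sub]
      A.subgroup_homogeneous_sums[of "ring_degrees a", folded ring_part_def] by simp
  have l: "x \<otimes>\<^bsub>S\<^esub> w \<in> fsums S ?W" if w: "w \<in> fsums S ?W" and x: "x \<in> ring_part a" for w x
  proof (rule fsums_bilinear[OF R.abelian_monoid_axioms R.abelian_monoid_axioms
        x[unfolded ring_part_def homogeneous_sums_def] w A.components_subset W])
    show "\<zero>\<^bsub>S\<^esub> \<in> fsums S ?W" by (rule fsums.zero)
    show "u \<oplus>\<^bsub>S\<^esub> v \<in> fsums S ?W" if "u \<in> fsums S ?W" "v \<in> fsums S ?W" for u v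
      using R.fsums_closed[OF W that] .
    fix u v assume u: "u \<in> (\<Union>t\<in>ring_degrees a. A t)" and v: "v \<in> ?W"
    obtain m where "u \<in> A (phi \<gamma> a m)" using u unfolding ring_degrees_def by blast
    then have "u \<otimes>\<^bsub>S\<^esub> v \<in> ?W" using max_ideal_generators_mult v by blast
    then show "u \<otimes>\<^bsub>S\<^esub> v \<in> fsums S ?W" using R.fsums_incl[OF W] by blast
  qed (simp_all add: R.l_distr R.r_distr)
  show ?thesis unfolding veronese_max_ideal_eq
  proof (rule idealI)
    show "ring ?R" by (rule V.ring_axioms)
    show "subgroup (fsums S ?W) (add_monoid ?R)" using sg by simp
    fix w x assume "w \<in> fsums S ?W" "x \<in> carrier ?R"
    then have wx: "w \<in> fsums S ?W" "x \<in> ring_part a" by auto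
    show "x \<otimes>\<^bsub>?R\<^esub> w \<in> fsums S ?W" using l[OF wx] by simp
    then show "w \<otimes>\<^bsub>?R\<^esub> x \<in> fsums S ?W" using V.m_comm[of w x] wx sub by auto
  qed
qed

text \<open>The chain condition is available in \<open>S\<close> and not in the degree zero ring, so generators of \<open>\<mm>\<close> are only
  found up to extension to \<open>S\<close>.\<close>

lemma maximal_ideal_finite_generation:
  "\<exists>F. finite F \<and> F \<subseteq> \<mm> \<and> \<mm> \<subseteq> genideal S F"
proof -
  have mc: "\<mm> \<subseteq> carrier S" using maximal_ideal_subset A.component_facts(1) by blast
  let ?Q = "{genideal S F | F. finite F \<and> F \<subseteq> \<mm>}"
  have Q: "genideal S {} \<in> ?Q" by blast
  obtain Z where Z: "Z \<in> ?Q"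
    "\<And>Y. (Y, Z) \<in> {(J, I). ideal J S \<and> ideal I S \<and> I \<subset> J} \<Longrightarrow> Y \<notin> ?Q"
    by (rule wfE_min[OF noetherian_ring.wf_ideals[OF noetherian] Q]) (rule that)
  then obtain F where F: "Z = genideal S F" "finite F" "F \<subseteq> \<mm>" by blast
  have "x \<in> genideal S F" if x: "x \<in> \<mm>" for x
  proof -
    have carr: "F \<subseteq> carrier S" "insert x F \<subseteq> carrier S" using F x mc by auto
    have id: "ideal (genideal S F) S" "ideal (genideal S (insert x F)) S"
      using R.genideal_ideal carr by blast+
    have self: "insert x F \<subseteq> genideal S (insert x F)" using R.genideal_self[OF carr(2)] .
    then have "genideal S F \<subseteq> genideal S (insert x F)" using R.genideal_minimal[OF id(2)] by blast
    moreover have "genideal S (insert x F) \<in> ?Q" using F x by blast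
    ultimately have "genideal S F = genideal S (insert x F)"
      using Z(2)[of "genideal S (insert x F)"] id F(1) by blast
    then show ?thesis using self by blast
  qed
  then show ?thesis using F by blast
qed

text \<open>The elements of \<open>S\<close> whose component of degree zero lies in \<open>P\<close> form an ideal of \<open>S\<close>: since the degrees are
  nonnegative, components of positive degree cannot contribute to degree zero. This ideal contains
  \<open>F\<close>, hence \<open>\<mm>\<close>.\<close>

lemma maximal_ideal_subset_prime:
  assumes P: "ideal P (S\<lparr>carrier := ring_part a\<rparr>)" and F: "F \<subseteq> \<mm>" "\<mm> \<subseteq> genideal S F" "F \<subseteq> P"
  shows "\<mm> \<subseteq> P"
proof -
  let ?R = "S\<lparr>carrier := ring_part a\<rparr>" and ?V = "homogeneous_sums S A (- {0})"
  interpret P: ideal P ?R by fact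
  have P_sub: "subgroup P (add_monoid S)"
  proof (rule R.add.incl_subgroup)
    show "subgroup (ring_part a) (add_monoid S)"
      unfolding ring_part_def by (rule A.subgroup_homogeneous_sums)
    show "subgroup P (add_monoid S\<lparr>carrier := ring_part a\<rparr>)" using P.a_subgroup by simp
  qed
  note Pf = add_subgroup_facts[OF P_sub]
  note Vf = A.homogeneous_sums_facts[where T = "- {0}"]
  note Af = A.component_facts[where n = 0]
  have A0: "A 0 \<subseteq> ring_part a"
    unfolding ring_part_def by (rule A.component_subset_homogeneous_sums[OF zero_ring_degree])
  define I where "I = {p \<oplus>\<^bsub>S\<^esub> v | p v. p \<in> P \<inter> A 0 \<and> v \<in> ?V}"
  have l: "s \<otimes>\<^bsub>S\<^esub> y \<in> I" if y: "y \<in> I" and s: "s \<in> carrier S" for y s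
  proof -
    obtain p v where pv: "y = p \<oplus>\<^bsub>S\<^esub> v" "p \<in> P" "p \<in> A 0" "v \<in> ?V"
      using y unfolding I_def by blast
    have "s \<in> homogeneous_sums S A UNIV" using s A.homogeneous_sums_UNIV by simp
    from A.homogeneous_sums_split[OF this, of "{0}"]
    obtain s0 s' where ss: "s = s0 \<oplus>\<^bsub>S\<^esub> s'" "s0 \<in> A 0" "s' \<in> ?V"
      by (auto simp: A.homogeneous_sums_singleton Compl_eq_Diff_UNIV)
    have c: "p \<in> carrier S" "v \<in> carrier S" "s0 \<in> carrier S" "s' \<in> carrier S"
      using pv(3,4) ss(2,3) Vf(1) Af(1) by auto
    have "s \<otimes>\<^bsub>S\<^esub> y = s0 \<otimes>\<^bsub>S\<^esub> p \<oplus>\<^bsub>S\<^esub> (s' \<otimes>\<^bsub>S\<^esub> p \<oplus>\<^bsub>S\<^esub> s \<otimes>\<^bsub>S\<^esub> v)"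
      using c unfolding pv(1) ss(1) by (simp add: R.l_distr R.r_distr R.a_ac)
    moreover have "s0 \<otimes>\<^bsub>S\<^esub> p \<in> P" using P.I_l_closed[OF pv(2), of s0] ss A0 by auto
    moreover have "s0 \<otimes>\<^bsub>S\<^esub> p \<in> A 0" using mult_degree[OF ss(2) pv(3)] by simp
    moreover have "s' \<otimes>\<^bsub>S\<^esub> p \<in> ?V"
      using mult_homogeneous_sums[OF ss(3), of p "{0}" "- {0}"] pv(3)
      by (simp add: A.homogeneous_sums_singleton)
    moreover have "s \<otimes>\<^bsub>S\<^esub> v \<in> ?V"
    proof (rule mult_homogeneous_sums[OF _ pv(4)])
      show "s \<in> homogeneous_sums S A UNIV" using s A.homogeneous_sums_UNIV by simp
      show "t + t' \<in> - {0}" if "t' \<in> - {0}" for t t' :: "nat ^ 'r::{finite, linorder}"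
        using that by (auto simp: vec_eq_iff)
    qed
    ultimately show ?thesis unfolding I_def using Vf(3) by blast
  qed
  have "ideal I S"
  proof (rule idealI)
    show "ring S" by (rule R.ring_axioms)
    show "subgroup I (add_monoid S)"
    proof (rule R.add.subgroupI)
      show "I \<subseteq> carrier S"
        unfolding I_def using Vf(1) Af(1) by (auto intro!: R.a_closed)
      show "I \<noteq> {}" unfolding I_def using Pf(2) Af(2) Vf(2) by blast
      fix x assume "x \<in> I"
      then obtain p v where x: "x = p \<oplus>\<^bsub>S\<^esub> v" "p \<in> P" "p \<in> A 0" "v \<in> ?V" unfolding I_def by blast
      have c: "p \<in> carrier S" "v \<in> carrier S" using x(3,4) Vf(1) Af(1) by auto
      then have "\<ominus>\<^bsub>S\<^esub> x = \<ominus>\<^bsub>S\<^esub> p \<oplus>\<^bsub>S\<^esub> \<ominus>\<^bsub>S\<^esub> v" using x by (simp add: R.minus_add)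
      moreover have "\<ominus>\<^bsub>S\<^esub> p \<in> P \<inter> A 0" "\<ominus>\<^bsub>S\<^esub> v \<in> ?V" using x(2,3,4) Pf(4) Af(4) Vf(4) by auto
      ultimately show "\<ominus>\<^bsub>S\<^esub> x \<in> I" unfolding I_def by blast
      fix y assume "y \<in> I"
      then obtain q w where y: "y = q \<oplus>\<^bsub>S\<^esub> w" "q \<in> P" "q \<in> A 0" "w \<in> ?V" unfolding I_def by blast
      have c': "q \<in> carrier S" "w \<in> carrier S" using y(3,4) Vf(1) Af(1) by auto
      have "x \<oplus>\<^bsub>S\<^esub> y = (p \<oplus>\<^bsub>S\<^esub> q) \<oplus>\<^bsub>S\<^esub> (v \<oplus>\<^bsub>S\<^esub> w)" using x y c c' by (simp add: R.a_ac)
      moreover have "p \<oplus>\<^bsub>S\<^esub> q \<in> P \<inter> A 0" "v \<oplus>\<^bsub>S\<^esub> w \<in> ?V" using x(2,3,4) y(2,3,4) Pf(3) Af(3) Vf(3) by auto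
      ultimately show "x \<oplus>\<^bsub>S\<^esub> y \<in> I" unfolding I_def by blast
    qed
    fix y s assume y: "y \<in> I" and s: "s \<in> carrier S"
    show "s \<otimes>\<^bsub>S\<^esub> y \<in> I" using l[OF y s] .
    moreover have "y \<in> carrier S" using y Vf(1) Af(1) unfolding I_def by (auto intro!: R.a_closed)
    ultimately show "y \<otimes>\<^bsub>S\<^esub> s \<in> I" using s by (simp add: R.m_comm)
  qed
  moreover have "F \<subseteq> I"
  proof
    fix x assume x: "x \<in> F"
    then have "x \<in> A 0" "x \<in> P" using F maximal_ideal_subset by blast+
    moreover from this have "x = x \<oplus>\<^bsub>S\<^esub> \<zero>\<^bsub>S\<^esub>" using Af(1) by (simp add: subset_eq)
    ultimately show "x \<in> I" unfolding I_def using Vf(2) by blast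
  qed
  ultimately have "\<mm> \<subseteq> I" using R.genideal_minimal F(2) by blast
  show "\<mm> \<subseteq> P"
  proof
    fix x assume x: "x \<in> \<mm>"
    then obtain p v where pv: "x = p \<oplus>\<^bsub>S\<^esub> v" "p \<in> P" "p \<in> A 0" "v \<in> ?V"
      using \<open>\<mm> \<subseteq> I\<close> unfolding I_def by blast
    have "A 0 \<inter> ?V \<subseteq> {\<zero>\<^bsub>S\<^esub>}"
      using A.homogeneous_sums_disjoint[of "{0}" "- {0}"] by (simp add: A.homogeneous_sums_singleton)
    moreover have "x \<in> A 0" using x maximal_ideal_subset by blast
    ultimately have "x = p"
      using direct_sum_unique[OF R.abelian_group_axioms
          abelian_group_on_subgroup[OF R.abelian_group_axioms A.component] Af(1) Vf(1) _ _ pv(1,3,4)]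
      by blast
    then show "x \<in> P" using pv by simp
  qed
qed

lemma prime_contains_base:
  assumes P: "primeideal P (S\<lparr>carrier := ring_part a\<rparr>)" and w: "w \<in> ring_part a"
  shows "w [^]\<^bsub>S\<^esub> (k::nat) \<in> P \<Longrightarrow> w \<in> P"
proof (induction k)
  interpret P: primeideal P "S\<lparr>carrier := ring_part a\<rparr>" by fact
  case 0
  then have "\<one>\<^bsub>S\<^esub> \<in> P" by simp
  then show ?case using P.one_imp_carrier w by simp
next
  case (Suc k)
  interpret P: primeideal P "S\<lparr>carrier := ring_part a\<rparr>" by fact
  have pow: "w [^]\<^bsub>S\<^esub> k \<in> ring_part a"
  proof (induction k)
    case 0
    show ?case using subringE(3)[OF subring_ring_part] by simp
  next
    case (Suc k)
    then show ?case using subringE(6)[OF subring_ring_part] w by (simp add: R.nat_pow_Suc)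
  qed
  have "w [^]\<^bsub>S\<^esub> k \<otimes>\<^bsub>S\<^esub> w \<in> P" using Suc.prems by (simp add: R.nat_pow_Suc)
  then have "w [^]\<^bsub>S\<^esub> k \<in> P \<or> w \<in> P" using P.I_prime[of "w [^]\<^bsub>S\<^esub> k" w] pow w by simp
  then show ?case using Suc.IH by blast
qed

text \<open>Some \<open>n\<^sub>i\<close> is positive, so an element of degree \<open>phi \<gamma> a n\<close> is a sum of products \<open>w = g\<^sub>i\<^sup>j y\<close>. The power of \<open>w\<close> with
  exponent \<open>b\<^sub>i\<close> is the same power of \<open>g\<^sub>i\<^sup>j\<close>, which lies in \<open>P\<close>, times an element of \<open>S\<close> whose degree is
  again in the Veronese lattice of \<open>a\<close>, because \<open>b\<^sub>i\<close> is a multiple of \<open>a\<^sub>i\<close>. Hence \<open>w \<in> P\<close>.\<close>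

lemma positive_component_subset_prime:
  assumes P: "primeideal P (S\<lparr>carrier := ring_part a\<rparr>)" and a: "\<And>i. 0 < a $ i"
    and b: "\<And>i. b $ i = l $ i * a $ i" and n: "n \<noteq> 0"
    and gens: "\<And>i j. 1 \<le> j \<Longrightarrow> j \<le> \<mu> i \<Longrightarrow> g i j [^]\<^bsub>S\<^esub> (b $ i) \<in> P"
  shows "A (phi \<gamma> a n) \<subseteq> P"
proof -
  let ?R = "S\<lparr>carrier := ring_part a\<rparr>"
  interpret P: primeideal P ?R by fact
  define \<nu> where "\<nu> = (\<chi> i. n $ i * a $ i)"
  have \<nu>: "phi \<gamma> a n = degree_map \<gamma> \<nu>" by (simp add: phi_eq_degree_map \<nu>_def)
  obtain i where i: "0 < n $ i" using n by (auto simp: vec_eq_iff)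
  then have \<nu>i: "0 < \<nu> $ i" using a[of i] by (simp add: \<nu>_def)
  have "divisible_part \<nu> i \<subseteq> P"
  proof
    fix w assume "w \<in> divisible_part \<nu> i"
    then obtain j y where w: "w = g i j \<otimes>\<^bsub>S\<^esub> y" and j: "1 \<le> j" "j \<le> \<mu> i"
      and y: "y \<in> A (degree_map \<gamma> (\<nu> - axis i 1))" unfolding divisible_part_def by blast
    have c: "g i j \<in> carrier S" "y \<in> carrier S" using generator_carrier[OF j] y A.component_facts(1) by blast+
    (* phi \<gamma> a \<kappa> is b_i times the degree of y, because b_i (\<nu>_i - 1) = (b_i n_i - l_i) a_i *)
    define \<kappa> where "\<kappa> = (\<chi> k. b $ i * n $ k - (if k = i then l $ i else 0))"
    have "(\<chi> k. b $ i * (\<nu> - axis i 1) $ k) = (\<chi> k. \<kappa> $ k * a $ k)"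
      by (auto simp: vec_eq_iff \<nu>_def \<kappa>_def axis_def b algebra_simps diff_mult_distrib2)
    then have "y [^]\<^bsub>S\<^esub> (b $ i) \<in> A (phi \<gamma> a \<kappa>)"
      using homogeneous_pow[OF y, of "b $ i"] by (simp add: phi_eq_degree_map)
    moreover have "A (phi \<gamma> a \<kappa>) \<subseteq> ring_part a"
      unfolding ring_part_def ring_degrees_def by (rule A.component_subset_homogeneous_sums) blast
    ultimately have yr: "y [^]\<^bsub>S\<^esub> (b $ i) \<in> ring_part a" by blast
    have "g i j [^]\<^bsub>S\<^esub> (b $ i) \<otimes>\<^bsub>S\<^esub> y [^]\<^bsub>S\<^esub> (b $ i) \<in> P"
      using P.I_r_closed[OF gens[OF j]] yr by simp
    moreover have "w [^]\<^bsub>S\<^esub> (b $ i) = g i j [^]\<^bsub>S\<^esub> (b $ i) \<otimes>\<^bsub>S\<^esub> y [^]\<^bsub>S\<^esub> (b $ i)"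
      unfolding w using c by (intro R.pow_mult_distrib) (auto simp: R.m_comm)
    ultimately have wP: "w [^]\<^bsub>S\<^esub> (b $ i) \<in> P" by simp
    have "axis i 1 + (\<nu> - axis i 1) = \<nu>" using \<nu>i by (auto simp: vec_eq_iff axis_def)
    then have "w \<in> A (phi \<gamma> a n)"
      using mult_degree[OF generator_degree[OF j] y] unfolding w \<nu>
      by (metis degree_map_add degree_map_axis)
    then have "w \<in> ring_part a"
      using A.component_subset_homogeneous_sums[of "phi \<gamma> a n" "ring_degrees a"]
      unfolding ring_part_def ring_degrees_def by blast
    then show "w \<in> P" using prime_contains_base[OF P _ wP] by blast
  qed
  moreover have "fsums S (divisible_part \<nu> i) \<subseteq> P" if "divisible_part \<nu> i \<subseteq> P"
    by (rule fsums_least) (use that additive_subgroup.zero_closed[OF P.additive_subgroup_axioms]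
      additive_subgroup.a_closed[OF P.additive_subgroup_axioms] in auto)
  ultimately show ?thesis using component_divisible[OF _ \<nu>i] unfolding \<nu> by blast
qed

lemma veronese_max_ideal_subset_prime:
  assumes P: "primeideal P (S\<lparr>carrier := ring_part a\<rparr>)" and a: "\<And>i. 0 < a $ i"
    and b: "\<And>i. b $ i = l $ i * a $ i"
    and F: "F \<subseteq> \<mm>" "\<mm> \<subseteq> genideal S F" "F \<subseteq> P"
    and gens: "\<And>i j. 1 \<le> j \<Longrightarrow> j \<le> \<mu> i \<Longrightarrow> g i j [^]\<^bsub>S\<^esub> (b $ i) \<in> P"
  shows "veronese_max_ideal S A \<mm> \<gamma> a \<subseteq> P"
proof -
  interpret P: primeideal P "S\<lparr>carrier := ring_part a\<rparr>" by fact
  have "\<mm> \<subseteq> P" using maximal_ideal_subset_prime[OF P.is_ideal F] .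
  moreover have "positive_part a \<subseteq> P"
    using positive_component_subset_prime[OF P, of b l] a b gens unfolding positive_part_def by blast
  ultimately show ?thesis unfolding veronese_max_ideal_eq
    by (intro fsums_least) (use additive_subgroup.zero_closed[OF P.additive_subgroup_axioms]
      additive_subgroup.a_closed[OF P.additive_subgroup_axioms] in auto)
qed

lemma generator_power_in_max_ideal:
  assumes j: "1 \<le> j" "j \<le> \<mu> i"
  shows "g i j [^]\<^bsub>S\<^esub> (b $ i) \<in> veronese_max_ideal S A \<mm> \<gamma> b"
proof -
  have "g i j \<in> A (degree_map \<gamma> (axis i 1))" using generator_degree[OF j] unfolding degree_map_axis .
  then have "g i j [^]\<^bsub>S\<^esub> (b $ i) \<in> A (degree_map \<gamma> (\<chi> k. b $ i * axis i 1 $ k))"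
    by (rule homogeneous_pow)
  moreover have "(\<chi> k. b $ i * axis i 1 $ k) = (\<chi> k. axis i 1 $ k * b $ k)"
    by (auto simp: vec_eq_iff axis_def)
  ultimately have "g i j [^]\<^bsub>S\<^esub> (b $ i) \<in> A (phi \<gamma> b (axis i 1))" by (simp add: phi_eq_degree_map)
  moreover have "axis i 1 \<noteq> (0 :: nat ^ 'r::{finite, linorder})" by (auto simp: vec_eq_iff axis_def)
  ultimately have "g i j [^]\<^bsub>S\<^esub> (b $ i) \<in> positive_part b" unfolding positive_part_def by blast
  moreover have "\<mm> \<union> positive_part b \<subseteq> carrier S"
    using max_ideal_generators_subset subringE(1)[OF subring_ring_part] by blast
  ultimately show ?thesis unfolding veronese_max_ideal_eq using R.fsums_incl by blast
qed

text \<open>The length of \<open>zs b\<close> is the same for all \<open>b\<close>, which bounds all depths at once. The primes live over the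
  Veronese ring of \<open>a\<close> while the generators belong to its multiple \<open>b\<close>.\<close>

lemma max_ideal_radical_generators:
  "\<exists>zs :: nat ^ 'r::{finite, linorder} \<Rightarrow> 'a list. (\<exists>h. \<forall>b. length (zs b) = h) \<and>
     (\<forall>b. set (zs b) \<subseteq> veronese_max_ideal S A \<mm> \<gamma> b) \<and>
     (\<forall>a b l P. (\<forall>i. 0 < a $ i) \<longrightarrow> (\<forall>i. b $ i = l $ i * a $ i) \<longrightarrow>
        primeideal P (S\<lparr>carrier := ring_part a\<rparr>) \<longrightarrow> set (zs b) \<subseteq> P \<longrightarrow>
        veronese_max_ideal S A \<mm> \<gamma> a \<subseteq> P)"
proof -
  obtain F where F: "finite F" "F \<subseteq> \<mm>" "\<mm> \<subseteq> genideal S F"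
    using maximal_ideal_finite_generation by blast
  obtain fs where fs: "set fs = F" using finite_list[OF F(1)] by blast
  have "finite (SIGMA i : UNIV. {1..\<mu> i})" by (rule finite_SigmaI) auto
  then obtain ijs where ijs: "set ijs = (SIGMA i : UNIV. {1..\<mu> i})" using finite_list by blast
  define zs where "zs b = fs @ map (\<lambda>(i, j). g i j [^]\<^bsub>S\<^esub> (b $ i)) ijs" for b :: "nat ^ 'r::{finite, linorder}"
  have set_zs: "set (zs b) = F \<union> {g i j [^]\<^bsub>S\<^esub> (b $ i) | i j. 1 \<le> j \<and> j \<le> \<mu> i}" for b
    by (force simp: zs_def fs ijs)
  have "length (zs b) = length fs + length ijs" for b by (simp add: zs_def)
  moreover have "set (zs b) \<subseteq> veronese_max_ideal S A \<mm> \<gamma> b" for b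
  proof -
    have "\<mm> \<union> positive_part b \<subseteq> carrier S"
      using max_ideal_generators_subset subringE(1)[OF subring_ring_part] by blast
    then have "F \<subseteq> veronese_max_ideal S A \<mm> \<gamma> b"
      using R.fsums_incl F(2) unfolding veronese_max_ideal_eq by blast
    then show ?thesis using generator_power_in_max_ideal unfolding set_zs by blast
  qed
  moreover have "veronese_max_ideal S A \<mm> \<gamma> a \<subseteq> P"
    if "\<forall>i. 0 < a $ i" "\<forall>i. b $ i = l $ i * a $ i" "primeideal P (S\<lparr>carrier := ring_part a\<rparr>)"
      "set (zs b) \<subseteq> P" for a b l P
    using veronese_max_ideal_subset_prime[OF that(3), of b l F] that(1,2,4) F unfolding set_zs by blast
  ultimately show ?thesis by blast
qed

lemma ring_degrees_multiple:
  assumes "\<And>i. b $ i = l $ i * a $ i"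
  shows "ring_degrees b \<subseteq> ring_degrees a"
  unfolding ring_degrees_def
proof
  fix t assume "t \<in> range (phi \<gamma> b :: nat ^ 'r::{finite, linorder} \<Rightarrow> _)"
  then obtain n where "t = phi \<gamma> b n" by blast
  then have "t = phi \<gamma> a (\<chi> i. n $ i * l $ i)" by (simp add: phi_def assms ac_simps)
  then show "t \<in> range (phi \<gamma> a)" by blast
qed

lemma module_degrees_multiple:
  assumes "\<And>i. b $ i = l $ i * a $ i"
  shows "module_degrees b \<subseteq> module_degrees a"
  unfolding module_degrees_def
proof
  fix t assume "t \<in> range (phi \<gamma> b :: int ^ 'r::{finite, linorder} \<Rightarrow> _)"
  then obtain n where "t = phi \<gamma> b n" by blast
  then have "t = phi \<gamma> a (\<chi> i. n $ i * int (l $ i))" by (simp add: phi_def assms ac_simps)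
  then show "t \<in> range (phi \<gamma> a)" by blast
qed

lemma veronese_depth_multiple:
  assumes a: "\<And>i. 0 < a $ i" and b: "\<And>i. b $ i = l $ i * a $ i"
  shows "veronese_depth S A \<mm> M B \<gamma> a \<le> veronese_depth S A \<mm> M B \<gamma> b"
proof -
  obtain zs :: "nat ^ 'r::{finite, linorder} \<Rightarrow> 'a list"
    where zs: "\<forall>b. set (zs b) \<subseteq> veronese_max_ideal S A \<mm> \<gamma> b"
    "\<forall>a b l P. (\<forall>i. 0 < a $ i) \<longrightarrow> (\<forall>i. b $ i = l $ i * a $ i) \<longrightarrow>
        primeideal P (S\<lparr>carrier := ring_part a\<rparr>) \<longrightarrow> set (zs b) \<subseteq> P \<longrightarrow>
        veronese_max_ideal S A \<mm> \<gamma> a \<subseteq> P"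
    using max_ideal_radical_generators by blast
  let ?R = "S\<lparr>carrier := ring_part a\<rparr>" and ?N = "M\<lparr>carrier := module_part a\<rparr>"
  let ?V = "homogeneous_sums M B (module_degrees a - module_degrees b)"
  interpret RN: module ?R ?N by (rule module_parts)
  have sub: "ring_part b \<subseteq> ring_part a"
    unfolding ring_part_def by (rule A.homogeneous_sums_mono) (rule ring_degrees_multiple[OF b])
  have subM: "module_part b \<subseteq> module_part a"
    unfolding module_part_def by (rule B.homogeneous_sums_mono) (rule module_degrees_multiple[OF b])
  have "depth ?R (veronese_max_ideal S A \<mm> \<gamma> a) ?N
      \<le> depth (?R\<lparr>carrier := ring_part b\<rparr>) (veronese_max_ideal S A \<mm> \<gamma> b) (?N\<lparr>carrier := module_part b\<rparr>)"
  proof (rule depth_le_depth_summand[OF module_parts noetherian_parts[OF a], where zs = "zs b" and V = ?V])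
    show "veronese_max_ideal S A \<mm> \<gamma> a \<subseteq> carrier ?R"
      using ideal.Icarr[OF ideal_veronese_max_ideal] by blast
    have "ring (S\<lparr>carrier := ring_part b\<rparr>)" using cring_ring_part cring.axioms(1) by blast
    then show "subring (ring_part b) ?R" using RN.R.subring_iff[of "ring_part b"] sub by simp
    show "module (?R\<lparr>carrier := ring_part b\<rparr>) (?N\<lparr>carrier := module_part b\<rparr>)"
      using module_parts by simp
    show "module_part b \<subseteq> carrier ?N" using subM by simp
    have "?V \<subseteq> module_part a" unfolding module_part_def by (rule B.homogeneous_sums_mono) blast
    moreover have "subgroup (module_part a) (add_monoid M)"
      unfolding module_part_def by (rule B.subgroup_homogeneous_sums)
    ultimately have "subgroup ?V (add_monoid M\<lparr>carrier := module_part a\<rparr>)"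
      using M.add.subgroup_incl[OF B.subgroup_homogeneous_sums] by blast
    then show "subgroup ?V (add_monoid ?N)" by simp
    show "module_part b \<inter> ?V \<subseteq> {\<zero>\<^bsub>?N\<^esub>}"
      unfolding module_part_def using B.homogeneous_sums_disjoint by simp
    show "u \<odot>\<^bsub>?N\<^esub> v \<in> ?V" if u: "u \<in> ring_part b" and v: "v \<in> ?V" for u v
    proof -
      have "u \<odot>\<^bsub>M\<^esub> v \<in> ?V"
      proof (rule smult_homogeneous_sums[OF u[unfolded ring_part_def] v])
        fix t t' assume t: "t \<in> ring_degrees b" "t' \<in> module_degrees a - module_degrees b"
        have tb: "int_vec t \<in> module_degrees b" using t int_vec_ring_degrees by blast
        have "int_vec t + t' \<in> module_degrees a"
          using module_degrees_add tb t module_degrees_multiple[OF b] by blast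
        moreover have "int_vec t + t' \<notin> module_degrees b"
          using module_degrees_diff[OF _ tb, of "int_vec t + t'"] t by auto
        ultimately show "int_vec t + t' \<in> module_degrees a - module_degrees b" by blast
      qed
      then show ?thesis by simp
    qed
    show "\<exists>n \<in> module_part b. \<exists>v \<in> ?V. m = n \<oplus>\<^bsub>?N\<^esub> v" if "m \<in> carrier ?N" for m
    proof -
      have "module_degrees a \<inter> module_degrees b = module_degrees b"
        using module_degrees_multiple[OF b] by blast
      then show ?thesis
        using B.homogeneous_sums_split[of m "module_degrees a" "module_degrees b"] that
        by (simp add: module_part_def)
    qed
    show "ideal (veronese_max_ideal S A \<mm> \<gamma> b) (?R\<lparr>carrier := ring_part b\<rparr>)"
      using ideal_veronese_max_ideal by simp
    show "set (zs b) \<subseteq> veronese_max_ideal S A \<mm> \<gamma> b" using zs(1) by blast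
    show "veronese_max_ideal S A \<mm> \<gamma> a \<subseteq> P" if "primeideal P ?R" "set (zs b) \<subseteq> P" for P
      using zs(2) a b that by blast
  qed
  then show ?thesis by (simp add: veronese_depth_def veronese_ring_eq veronese_module_eq)
qed

lemma veronese_depth_bounded:
  "\<exists>h :: nat. \<forall>a. (\<forall>i. 0 < a $ i) \<longrightarrow>
     veronese_depth S A \<mm> M B \<gamma> a = \<infinity> \<or> veronese_depth S A \<mm> M B \<gamma> a \<le> enat h"
proof -
  obtain zs :: "nat ^ 'r::{finite, linorder} \<Rightarrow> 'a list" and h
    where h: "\<forall>b. length (zs b) = h" and zs: "\<forall>b. set (zs b) \<subseteq> veronese_max_ideal S A \<mm> \<gamma> b"
    "\<forall>a b l P. (\<forall>i. 0 < a $ i) \<longrightarrow> (\<forall>i. b $ i = l $ i * a $ i) \<longrightarrow>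
        primeideal P (S\<lparr>carrier := ring_part a\<rparr>) \<longrightarrow> set (zs b) \<subseteq> P \<longrightarrow>
        veronese_max_ideal S A \<mm> \<gamma> a \<subseteq> P"
    using max_ideal_radical_generators by blast
  have "veronese_depth S A \<mm> M B \<gamma> a = \<infinity> \<or> veronese_depth S A \<mm> M B \<gamma> a \<le> enat h"
    if a: "\<forall>i. 0 < a $ i" for a
  proof -
    interpret RN: module "S\<lparr>carrier := ring_part a\<rparr>" "M\<lparr>carrier := module_part a\<rparr>"
      by (rule module_parts)
    have "\<forall>i. a $ i = (\<chi> i. 1) $ i * a $ i" by simp
    then have rad: "veronese_max_ideal S A \<mm> \<gamma> a \<subseteq> P"
      if "primeideal P (S\<lparr>carrier := ring_part a\<rparr>)" "set (zs a) \<subseteq> P" for P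
      using zs(2) a that by blast
    have "noetherian_module (S\<lparr>carrier := ring_part a\<rparr>) (M\<lparr>carrier := module_part a\<rparr>)"
      using noetherian_parts a by blast
    from RN.depth_le_number_of_generators[OF this ideal_veronese_max_ideal _ rad, of "zs a"] zs(1) h
    show ?thesis by (simp add: veronese_depth_def veronese_ring_eq veronese_module_eq)
  qed
  then show ?thesis by blast
qed

theorem vad_eventually_attained:
  "\<exists>a :: nat ^ 'r::{finite, linorder}. (\<forall>i. 0 < a $ i) \<and>
     (\<forall>b \<in> {(\<chi> i. l $ i * a $ i) | l :: nat ^ 'r::{finite, linorder}. \<forall>i. 0 < l $ i}.
        veronese_depth S A \<mm> M B \<gamma> b = vad S A \<mm> M B \<gamma>)"
proof -
  let ?d = "veronese_depth S A \<mm> M B \<gamma>" and ?pos = "{a :: nat ^ 'r::{finite, linorder}. \<forall>i. 0 < a $ i}"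
  from veronese_depth_bounded obtain h
    where h: "\<forall>a. (\<forall>i. 0 < a $ i) \<longrightarrow> ?d a = \<infinity> \<or> ?d a \<le> enat h" by (elim exE)
  have "?d ` ?pos \<subseteq> insert \<infinity> (enat ` {..h})"
  proof
    fix x assume "x \<in> ?d ` ?pos"
    then obtain a where "x = ?d a" "\<forall>i. 0 < a $ i" by auto
    then have "x = \<infinity> \<or> x \<le> enat h" using h by simp
    then show "x \<in> insert \<infinity> (enat ` {..h})" by (cases x) auto
  qed
  then have fin: "finite (?d ` ?pos)" using finite_subset by blast
  have "(\<chi> i. 1) \<in> ?pos" by simp
  then have ne: "?d ` ?pos \<noteq> {}" by blast
  have "vad S A \<mm> M B \<gamma> = Max (?d ` ?pos)"
    unfolding vad_def using fin ne by (simp add: Max_Sup)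
  then have "vad S A \<mm> M B \<gamma> \<in> ?d ` ?pos" using Max_in[OF fin ne] by simp
  then obtain a where a: "\<forall>i. 0 < a $ i" "vad S A \<mm> M B \<gamma> = ?d a" by blast
  have "?d b = vad S A \<mm> M B \<gamma>" if l: "\<forall>i. 0 < l $ i" and b: "b = (\<chi> i. l $ i * a $ i)" for b l
  proof (rule antisym)
    have "\<forall>i. 0 < b $ i" using a l b by simp
    then show "?d b \<le> vad S A \<mm> M B \<gamma>" unfolding vad_def by (intro SUP_upper) simp
    show "vad S A \<mm> M B \<gamma> \<le> ?d b" unfolding a(2)
      by (rule veronese_depth_multiple[where l = l]) (use a b in auto)
  qed
  then show ?thesis using a by blast
qed

end

theorem proposition2p1:
  fixes S :: "'a ring"
    and A :: "nat ^ 'r::{finite, linorder} \<Rightarrow> 'a set"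
    and \<mm> :: "'a set"
    and \<gamma> :: "'r::{finite, linorder} \<Rightarrow> nat ^ 'r::{finite, linorder}"
    and \<mu> :: "'r \<Rightarrow> nat"
    and g :: "'r \<Rightarrow> nat \<Rightarrow> 'a"
    and M :: "('a, 'b) module"
    and B :: "int ^ 'r::{finite, linorder} \<Rightarrow> 'b set"
    and s :: enat
  assumes gamma_triangular: "\<And>i j. i < j \<Longrightarrow> \<gamma> i $ j = 0"
    and gamma_diagonal: "\<And>i. \<gamma> i $ i \<noteq> 0"
    and graded: "multigraded_ring S A"
    and noetherian: "noetherian_ring S"
    and generator_degree: "\<And>i j. 1 \<le> j \<Longrightarrow> j \<le> \<mu> i \<Longrightarrow> g i j \<in> A (\<gamma> i)"
    and generated: "generate_ring S (A 0 \<union> {g i j | i j. 1 \<le> j \<and> j \<le> \<mu> i}) = carrier S"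
    and local: "local_ring (degree_zero_ring S A) \<mm>"
    and infinite_residue_field: "infinite (carrier (degree_zero_ring S A Quot \<mm>))"
    and graded_module: "multigraded_module S A M B"
    and fin_gen: "fin_gen_module S M"
    and s: "s = vad S A \<mm> M B \<gamma>"
  shows "\<exists>a :: nat ^ 'r::{finite, linorder}. (\<forall>i. 0 < a $ i) \<and>
           (\<forall>b \<in> {(\<chi> i. l $ i * a $ i) | l :: nat ^ 'r::{finite, linorder}. \<forall>i. 0 < l $ i}.
              veronese_depth S A \<mm> M B \<gamma> b = s)"
proof -
  have M: "module S M" using graded_module by (simp add: multigraded_module_def)
  interpret module S M by (rule M)
  have "graded_module_setting S A M B \<gamma> \<mu> g \<mm>"
  proof (intro graded_module_setting.intro graded_module_setting_axioms.intro M
      direct_sum.intro direct_sum_axioms.intro)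
    show "abelian_group S" by (rule R.abelian_group_axioms)
    show "abelian_group M" by (rule M.abelian_group_axioms)
    show "internal_direct_sum S A" "\<And>m n x y. x \<in> A m \<Longrightarrow> y \<in> A n \<Longrightarrow> x \<otimes>\<^bsub>S\<^esub> y \<in> A (m + n)"
      using graded by (auto simp: multigraded_ring_def)
    show "internal_direct_sum M B"
      "\<And>m n x y. x \<in> A m \<Longrightarrow> y \<in> B n \<Longrightarrow> x \<odot>\<^bsub>M\<^esub> y \<in> B (int_vec m + n)"
      using graded_module by (auto simp: multigraded_module_def)
  qed (fact gamma_triangular gamma_diagonal noetherian generator_degree generated local fin_gen)+
  then show ?thesis unfolding s by (rule graded_module_setting.vad_eventually_attained)
qed

end
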